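(* There exists a universal constant $C\ge1$ such that the following holds. Let $q\ge2$, $d,N\ge1$ be integers, let $\Lambda\subseteq\Lambda_{\le d,q,N}$ be non-empty, and set $m=m(\Lambda):=\max_{\alpha\in\Lambda}|\alpha|$. Then $$\boldsymbol{gl}\big(\mathcal P_\Lambda(C_q^N)\big)\le\boldsymbol{\chi}\big(\mathcal P_\Lambda(C_q^N)\big)\le\mathbf{Sid}\big(\mathcal P_\Lambda(C_q^N)\big)\le(C\log q)^{2d}\,2^m\,\boldsymbol{gl}\big(\mathcal P_\Lambda(C_q^N)\big).$$ In particular, this applies to $\mathcal B_d(C_q^N)$ with $m=(q-1)d$, and to $\mathcal P_d(C_q^N)$ and $\mathcal T_d(C_q^N)$ with $m=d$ (whenever the corresponding index sets are non-empty).
   Context: $C_q\subset\mathbb C$ is the group of $q$-th roots of unity. For $\alpha\in\{0,\ldots,q-1\}^N$: $\chi_\alpha(x)=x_1^{\alpha_1}\cdots x_N^{\alpha_N}$ ($x\in C_q^N$), $|\alpha|=\sum_j\alpha_j$ (sum in $\mathbb N_0$), $\operatorname{supp}(\alpha)=\{j:\alpha_j\ne0\}$. $\Lambda_{\le d,q,N}=\{\alpha\in\{0,\ldots,q-1\}^N:|\operatorname{supp}(\alpha)|\le d\}$. For $\Lambda\subset\{0,\ldots,q-1\}^N$, $\mathcal P_\Lambda(C_q^N)=\operatorname{span}_{\mathbb C}\{\chi_\alpha:\alpha\in\Lambda\}$ with the supremum norm on $C_q^N$. $\mathcal B_d(C_q^N)$, $\mathcal P_d(C_q^N)$, $\mathcal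 T_d(C_q^N)$ are the spaces $\mathcal P_\Lambda(C_q^N)$ for $\Lambda=\{|\operatorname{supp}(\alpha)|=d\}$, $\Lambda=\{|\alpha|=d\}$, and $\Lambda=\{|\alpha|=d,\ |\operatorname{supp}(\alpha)|=d\}$, respectively. Sidon constant: $\mathbf{Sid}(\mathcal P_\Lambda(C_q^N))$ is the least $c>0$ with $\sum_{\alpha\in\Lambda}|\widehat f(\alpha)|\le c\,\|f\|_{L_\infty(C_q^N)}$ for all $f=\sum_{\alpha\in\Lambda}\widehat f(\alpha)\chi_\alpha$. Unconditional basis constant: for a basis $(e_i)_{i\in I}$ of a complex Banach space $X$, $\boldsymbol\chi((e_i))$ is the infimum of all $K>0$ with $\|\sum\varepsilon_i\alpha_ie_i\|\le K\|\sum\alpha_ie_i\|$ for all finitely supported scalars $\alpha_i$ and unimodular complex scalars $\varepsilon_i$; $\boldsymbol\chi(X)$ is the infimum of $\boldsymbol\chi((e_i))$ over all unconditional bases of $X$. Gordon–Lewis constant: for an operator $u:X\to Y$, $\gamma_1(u)=\inf\|v\|\|w\|$ over all factorizations $\kappa_Yu=wv$ with $v:X\to L_1(\mu)$, $w:L_1(\mu)\to Y^{**}$, $\mu$ a measure and $\kappa_Y:Y\to Y^{**}$ the canonical embedding; $\pi_1(u)$ is the least $c$ with $\sum_j\|ux_j\|\le c\sup_{\|x^*\|_{X^*}\le1}\sum_j|x^*(x_j)|$ for all finite families $(x_j)$ in $X$. $\boldsymbol{gl}(X)$ is the least $c>0$ such that $\gamma_1(u)\le c\,\pi_1(u)$ for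 all $1$-summing (i.e. $\pi_1(u)<\infty$) operators $u:X\to\ell_2$. *)

theory Defs
  imports "HOL-Analysis.Analysis"
begin

section \<open>Complex normed spaces of functions\<close>

text \<open>All spaces involved are spaces of complex-valued functions with the pointwise vector
  operations, given by a carrier and a norm. A space may be merely seminormed (only
  \<open>L1\<close> below is); it then stands for the normed space obtained by identifying
  functions at distance zero.\<close>

record 'i cfs =
  vecs :: "('i \<Rightarrow> complex) set"
  nrm :: "('i \<Rightarrow> complex) \<Rightarrow> real"

definition unit_ball :: "'i cfs \<Rightarrow> ('i \<Rightarrow> complex) set" where
  "unit_ball X = {f \<in> vecs X. nrm X f \<le> 1}"

definition same_in :: "'i cfs \<Rightarrow> ('i \<Rightarrow> complex) \<Rightarrow> ('i \<Rightarrow> complex) \<Rightarrow> bool" where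
  "same_in X f g \<longleftrightarrow> nrm X (\<lambda>t. f t - g t) = 0"

text \<open>Linearity is required up to \<open>same_in\<close> in the target: this is plain linearity when the
  target is normed, and linearity of the map into equivalence classes, described by
  representatives, when the target is \<open>L1\<close>. On a seminormed source the bound makes the
  map well defined on equivalence classes.\<close>

definition bounded_op :: "'i cfs \<Rightarrow> 'j cfs \<Rightarrow> (('i \<Rightarrow> complex) \<Rightarrow> ('j \<Rightarrow> complex)) \<Rightarrow> bool" where
  "bounded_op X Y T \<longleftrightarrow>
     (\<forall>f\<in>vecs X. T f \<in> vecs Y) \<and>
     (\<forall>f\<in>vecs X. \<forall>g\<in>vecs X. same_in Y (T (\<lambda>t. f t + g t)) (\<lambda>s. T f s + T g s)) \<and>
     (\<forall>c. \<forall>f\<in>vecs X. same_in Y (T (\<lambda>t. c * f t)) (\<lambda>s. c * T f s)) \<and>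
     (\<exists>K. \<forall>f\<in>vecs X. nrm Y (T f) \<le> K * nrm X f)"

definition op_norm :: "'i cfs \<Rightarrow> 'j cfs \<Rightarrow> (('i \<Rightarrow> complex) \<Rightarrow> ('j \<Rightarrow> complex)) \<Rightarrow> real" where
  "op_norm X Y T = (SUP f\<in>unit_ball X. nrm Y (T f))"

text \<open>Functionals are set to 0 off the carrier, so that the dual is again a space of functions
  with pointwise operations and a functional is determined by its values on the carrier.\<close>

definition dual :: "'i cfs \<Rightarrow> ('i \<Rightarrow> complex) cfs" where
  "dual X = \<lparr>
     vecs = {\<phi>. (\<forall>f. f \<notin> vecs X \<longrightarrow> \<phi> f = 0) \<and>
                (\<forall>f\<in>vecs X. \<forall>g\<in>vecs X. \<phi> (\<lambda>t. f t + g t) = \<phi> f + \<phi> g) \<and>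
                (\<forall>c. \<forall>f\<in>vecs X. \<phi> (\<lambda>t. c * f t) = c * \<phi> f) \<and>
                (\<exists>K. \<forall>f\<in>vecs X. cmod (\<phi> f) \<le> K * nrm X f)},
     nrm = (\<lambda>\<phi>. SUP f\<in>unit_ball X. cmod (\<phi> f)) \<rparr>"

definition bidual_emb :: "'i cfs \<Rightarrow> ('i \<Rightarrow> complex) \<Rightarrow> (('i \<Rightarrow> complex) \<Rightarrow> complex) \<Rightarrow> complex" where
  "bidual_emb X f = (\<lambda>\<phi>. if \<phi> \<in> vecs (dual X) then \<phi> f else 0)"

definition ell2 :: "nat cfs" where
  "ell2 = \<lparr> vecs = {x. summable (\<lambda>n. (cmod (x n))\<^sup>2)},
            nrm = (\<lambda>x. sqrt (\<Sum>n. (cmod (x n))\<^sup>2)) \<rparr>"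

definition L1 :: "'m measure \<Rightarrow> 'm cfs" where
  "L1 M = \<lparr> vecs = {f. integrable M f}, nrm = (\<lambda>f. LINT t|M. cmod (f t)) \<rparr>"


section \<open>Unconditional basis constant\<close>

text \<open>All constants take values in \<^typ>\<open>ennreal\<close>, so that the infimum of an empty set of
  admissible constants is infinite.\<close>

text \<open>Every vector has a unique expansion, and the expansion converges unconditionally, i.e.
  along the net of finite subsets of the index set.\<close>

definition unconditional_basis :: "'i cfs \<Rightarrow> 'k set \<Rightarrow> ('k \<Rightarrow> 'i \<Rightarrow> complex) \<Rightarrow> bool" where
  "unconditional_basis X I e \<longleftrightarrow>
     (\<forall>i\<in>I. e i \<in> vecs X) \<and>
     (\<forall>f\<in>vecs X. \<exists>!a. (\<forall>i. i \<notin> I \<longrightarrow> a i = 0) \<and>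
        ((\<lambda>F. nrm X (\<lambda>t. f t - (\<Sum>i\<in>F. a i * e i t))) \<longlongrightarrow> 0) (finite_subsets_at_top I))"

definition basis_const :: "'i cfs \<Rightarrow> 'k set \<Rightarrow> ('k \<Rightarrow> 'i \<Rightarrow> complex) \<Rightarrow> ennreal" where
  "basis_const X I e = Inf {ennreal K | K. K > 0 \<and>
     (\<forall>F a \<epsilon>. finite F \<and> F \<subseteq> I \<and> (\<forall>i\<in>F. cmod (\<epsilon> i) = 1) \<longrightarrow>
        nrm X (\<lambda>t. \<Sum>i\<in>F. \<epsilon> i * a i * e i t) \<le> K * nrm X (\<lambda>t. \<Sum>i\<in>F. a i * e i t))}"

text \<open>The members of a basis are distinct, so index sets consisting of vectors suffice: every
  basis can be indexed by its own members.\<close>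

definition uncond_const :: "'i cfs \<Rightarrow> ennreal" where
  "uncond_const X = Inf {basis_const X I e | (I :: ('i \<Rightarrow> complex) set) e.
     unconditional_basis X I e}"


section \<open>Gordon--Lewis constant\<close>

text \<open>The infimum runs over the measures on one type, which loses no factorization. Given
  \<open>v\<close> from \<open>X\<close> to \<open>L1 M\<close> and \<open>w\<close> from \<open>L1 M\<close>, with \<open>M\<close> a measure on any type, push
  \<open>M\<close> forward under the map sending \<open>s\<close> to the function \<open>\<lambda>f. v f s\<close>, with the product
  sigma-algebra on the target. Then \<open>v\<close> is replaced by the coordinate evaluations and \<open>w\<close> by
  its composition with the induced isometric embedding, and no norm increases.\<close>

definition gamma1 ::
  "'i cfs \<Rightarrow> 'j cfs \<Rightarrow> (('i \<Rightarrow> complex) \<Rightarrow> ('j \<Rightarrow> complex)) \<Rightarrow> ennreal" where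
  "gamma1 X Y u =
     Inf {ennreal (op_norm X (L1 M) v * op_norm (L1 M) (dual (dual Y)) w) |
          (M :: (('i \<Rightarrow> complex) \<Rightarrow> complex) measure) v w.
          bounded_op X (L1 M) v \<and> bounded_op (L1 M) (dual (dual Y)) w \<and>
          (\<forall>f\<in>vecs X. w (v f) = bidual_emb Y (u f))}"

definition pi1 ::
  "'i cfs \<Rightarrow> 'j cfs \<Rightarrow> (('i \<Rightarrow> complex) \<Rightarrow> ('j \<Rightarrow> complex)) \<Rightarrow> ennreal" where
  "pi1 X Y u = Inf {ennreal c | c. c \<ge> 0 \<and>
     (\<forall>(n::nat) x. (\<forall>j<n. x j \<in> vecs X) \<longrightarrow>
        ennreal (\<Sum>j<n. nrm Y (u (x j))) \<le>
        ennreal c * (SUP \<phi>\<in>unit_ball (dual X). ennreal (\<Sum>j<n. cmod (\<phi> (x j)))))}"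

definition gl :: "'i cfs \<Rightarrow> ennreal" where
  "gl X = Inf {ennreal c | c. c > 0 \<and>
     (\<forall>u. bounded_op X ell2 u \<and> pi1 X ell2 u < \<infinity> \<longrightarrow>
        gamma1 X ell2 u \<le> ennreal c * pi1 X ell2 u)}"


section \<open>Polynomials on cyclic groups\<close>

text \<open>Points and multi-indices are functions on the coordinate set \<open>{..<N}\<close>.\<close>

definition cyc :: "nat \<Rightarrow> nat \<Rightarrow> (nat \<Rightarrow> complex) set" where
  "cyc q N = {..<N} \<rightarrow>\<^sub>E {z. z ^ q = 1}"

definition multi_indices :: "nat \<Rightarrow> nat \<Rightarrow> (nat \<Rightarrow> nat) set" where
  "multi_indices q N = {..<N} \<rightarrow>\<^sub>E {0..q - 1}"

definition character :: "nat \<Rightarrow> (nat \<Rightarrow> nat) \<Rightarrow> (nat \<Rightarrow> complex) \<Rightarrow> complex" where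
  "character N \<alpha> x = (\<Prod>j<N. x j ^ \<alpha> j)"

definition mdeg :: "nat \<Rightarrow> (nat \<Rightarrow> nat) \<Rightarrow> nat" where
  "mdeg N \<alpha> = (\<Sum>j<N. \<alpha> j)"

definition msupp :: "nat \<Rightarrow> (nat \<Rightarrow> nat) \<Rightarrow> nat set" where
  "msupp N \<alpha> = {j \<in> {..<N}. \<alpha> j \<noteq> 0}"

definition Lambda_le :: "nat \<Rightarrow> nat \<Rightarrow> nat \<Rightarrow> (nat \<Rightarrow> nat) set" where
  "Lambda_le d q N = {\<alpha> \<in> multi_indices q N. card (msupp N \<alpha>) \<le> d}"

definition max_deg :: "nat \<Rightarrow> (nat \<Rightarrow> nat) set \<Rightarrow> nat" where
  "max_deg N \<Lambda> = Max (mdeg N ` \<Lambda>)"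

definition poly_fun ::
  "nat \<Rightarrow> nat \<Rightarrow> (nat \<Rightarrow> nat) set \<Rightarrow> ((nat \<Rightarrow> nat) \<Rightarrow> complex) \<Rightarrow> (nat \<Rightarrow> complex) \<Rightarrow> complex" where
  "poly_fun q N \<Lambda> a = (\<lambda>x. if x \<in> cyc q N then \<Sum>\<alpha>\<in>\<Lambda>. a \<alpha> * character N \<alpha> x else 0)"

definition sup_norm :: "nat \<Rightarrow> nat \<Rightarrow> ((nat \<Rightarrow> complex) \<Rightarrow> complex) \<Rightarrow> real" where
  "sup_norm q N f = (SUP x\<in>cyc q N. cmod (f x))"

definition poly_space :: "nat \<Rightarrow> nat \<Rightarrow> (nat \<Rightarrow> nat) set \<Rightarrow> (nat \<Rightarrow> complex) cfs" where
  "poly_space q N \<Lambda> = \<lparr> vecs = range (poly_fun q N \<Lambda>), nrm = sup_norm q N \<rparr>"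

definition Sid :: "nat \<Rightarrow> nat \<Rightarrow> (nat \<Rightarrow> nat) set \<Rightarrow> ennreal" where
  "Sid q N \<Lambda> = Inf {ennreal c | c. c > 0 \<and>
     (\<forall>a. (\<Sum>\<alpha>\<in>\<Lambda>. cmod (a \<alpha>)) \<le> c * sup_norm q N (poly_fun q N \<Lambda> a))}"

text \<open>The index sets of \<open>\<B>\<^sub>d\<close>, \<open>\<P>\<^sub>d\<close> and \<open>\<T>\<^sub>d\<close>.\<close>

definition B_index :: "nat \<Rightarrow> nat \<Rightarrow> nat \<Rightarrow> (nat \<Rightarrow> nat) set" where
  "B_index d q N = {\<alpha> \<in> multi_indices q N. card (msupp N \<alpha>) = d}"

definition P_index :: "nat \<Rightarrow> nat \<Rightarrow> nat \<Rightarrow> (nat \<Rightarrow> nat) set" where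
  "P_index d q N = {\<alpha> \<in> multi_indices q N. mdeg N \<alpha> = d}"

definition T_index :: "nat \<Rightarrow> nat \<Rightarrow> nat \<Rightarrow> (nat \<Rightarrow> nat) set" where
  "T_index d q N = {\<alpha> \<in> multi_indices q N. mdeg N \<alpha> = d \<and> card (msupp N \<alpha>) = d}"

end

theory Submission
  imports Defs "HOL-Library.Function_Algebras"
begin

text \<open>The Gordon--Lewis constant is below every unconditional basis constant, because a 1-summing
  \<open>u\<close> factors through \<open>\<ell>\<^sub>1\<close> of the basis by \<open>e\<^sub>i \<mapsto> \<parallel>u e\<^sub>i\<parallel> \<delta>\<^sub>i\<close>, \<open>\<delta>\<^sub>i \<mapsto> u e\<^sub>i / \<parallel>u e\<^sub>i\<parallel>\<close>; and the
  characters are an unconditional basis whose constant is at most the Sidon constant.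

  For the last inequality let \<open>B = 10\<^sup>d \<surd>2\<^sup>m\<close>. A two-to-four hypercontractive estimate on \<open>C\<^sub>q\<close>, with
  \<open>z\<^sup>k\<close> (\<open>k \<ge> 1\<close>) given the weight \<open>10 \<surd>2\<^sup>k\<close>, tensorizes to \<open>\<parallel>f\<parallel>\<^sub>4 \<le> \<surd>B \<parallel>f\<parallel>\<^sub>2\<close>, hence
  \<open>\<parallel>f\<parallel>\<^sub>2 \<le> B \<parallel>f\<parallel>\<^sub>1\<close> on \<open>\<P>\<^sub>\<Lambda>\<close>. So the coefficient operator \<open>u\<close> into \<open>\<ell>\<^sub>2\<close>, followed by any unimodular
  diagonal operator, has summing norm at most \<open>B\<close>. Factor it as \<open>w v\<close> through \<open>L\<^sub>1\<close> with
  \<open>\<parallel>v\<parallel> \<parallel>w\<parallel> \<le> c B\<close>, where \<open>c\<close> exceeds the Gordon--Lewis constant. Choosing the diagonal to be the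
  conjugate signs of the coefficients \<open>a\<close> of \<open>f\<close>, \<open>\<Sum> \<bar>a\<^sub>\<alpha>\<bar>\<close> is the trace
  \<open>\<Sum> a\<^sub>\<alpha> \<langle>w v \<chi>\<^sub>\<alpha>, e\<^sub>\<alpha>\<rangle> \<le> \<parallel>w\<parallel> \<integral> (\<Sum> \<bar>a\<^sub>\<alpha> v \<chi>\<^sub>\<alpha>\<bar>\<^sup>2)\<^sup>1\<^sup>/\<^sup>2\<close>, and the norm comparison, applied pointwise under
  the integral, bounds this by \<open>\<parallel>w\<parallel> B\<close> times the average over \<open>x\<close> of \<open>\<parallel>v f(x \<cdot>)\<parallel>\<close>, that is by
  \<open>c B\<^sup>2 \<parallel>f\<parallel>\<^sub>\<infinity>\<close>.\<close>

section \<open>Seminormed spaces, duals and bounded operators\<close>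

text \<open>Definiteness is left out so that \<open>L1\<close> is an instance. Nonnegativity follows
  from subadditivity applied to \<open>f\<close> and its negative.\<close>

locale seminormed =
  fixes X :: "'i cfs"
  assumes zero_mem: "(\<lambda>_. 0) \<in> vecs X"
    and add_mem: "\<lbrakk>f \<in> vecs X; g \<in> vecs X\<rbrakk> \<Longrightarrow> (\<lambda>t. f t + g t) \<in> vecs X"
    and scale_mem: "f \<in> vecs X \<Longrightarrow> (\<lambda>t. c * f t) \<in> vecs X"
    and nrm_add: "\<lbrakk>f \<in> vecs X; g \<in> vecs X\<rbrakk> \<Longrightarrow> nrm X (\<lambda>t. f t + g t) \<le> nrm X f + nrm X g"
    and nrm_scale: "f \<in> vecs X \<Longrightarrow> nrm X (\<lambda>t. c * f t) = cmod c * nrm X f"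
begin

lemma nrm_zero: "nrm X (\<lambda>_. 0) = 0"
  using nrm_scale[OF zero_mem, of 0] by simp

lemma diff_mem:
  assumes "f \<in> vecs X" "g \<in> vecs X" shows "(\<lambda>t. f t - g t) \<in> vecs X"
  using add_mem[OF assms(1) scale_mem[OF assms(2), of "-1"]] by simp

lemma nrm_nonneg:
  assumes f: "f \<in> vecs X" shows "0 \<le> nrm X f"
  using nrm_add[OF f scale_mem[OF f, of "-1"]] nrm_scale[OF f, of "-1"] nrm_zero by simp

lemma nrm_minus: "f \<in> vecs X \<Longrightarrow> nrm X (\<lambda>t. - f t) = nrm X f"
  using nrm_scale[of f "-1"] by simp

lemma sum_mem:
  assumes "finite I" "\<And>i. i \<in> I \<Longrightarrow> f i \<in> vecs X"
  shows "(\<lambda>t. \<Sum>i\<in>I. f i t) \<in> vecs X"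
  using assms by (induction I) (auto simp: zero_mem intro!: add_mem)

lemma nrm_sum_le:
  assumes "finite I" "\<And>i. i \<in> I \<Longrightarrow> f i \<in> vecs X"
  shows "nrm X (\<lambda>t. \<Sum>i\<in>I. f i t) \<le> (\<Sum>i\<in>I. nrm X (f i))"
  using assms
proof (induction I)
  case (insert i I)
  then have "nrm X (\<lambda>t. f i t + (\<Sum>i\<in>I. f i t)) \<le> nrm X (f i) + nrm X (\<lambda>t. \<Sum>i\<in>I. f i t)"
    by (intro nrm_add sum_mem) auto
  with insert show ?case by force
qed (simp add: nrm_zero)

lemma nrm_le_if_same_in:
  assumes f: "f \<in> vecs X" and g: "g \<in> vecs X" and "same_in X f g"
  shows "nrm X f \<le> nrm X g"
  using nrm_add[OF diff_mem[OF f g] g] assms(3) by (simp add: same_in_def)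

lemma same_in_refl: "same_in X f f"
  by (simp add: same_in_def nrm_zero)

lemma same_in_sym:
  assumes f: "f \<in> vecs X" and g: "g \<in> vecs X" and "same_in X f g"
  shows "same_in X g f"
  using nrm_minus[OF diff_mem[OF f g]] assms(3) by (simp add: same_in_def)

lemma same_in_add:
  assumes "f \<in> vecs X" "g \<in> vecs X" "f' \<in> vecs X" "g' \<in> vecs X"
    and "same_in X f g" "same_in X f' g'"
  shows "same_in X (\<lambda>t. f t + f' t) (\<lambda>t. g t + g' t)"
proof -
  have "nrm X (\<lambda>t. (f t - g t) + (f' t - g' t)) \<le> 0"
    using nrm_add[OF diff_mem[OF assms(1,2)] diff_mem[OF assms(3,4)]] assms(5,6)
    by (simp add: same_in_def)
  moreover have "(\<lambda>t. (f t - g t) + (f' t - g' t)) \<in> vecs X"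
    by (intro add_mem diff_mem assms)
  ultimately show ?thesis
    unfolding same_in_def using nrm_nonneg by (fastforce simp: algebra_simps)
qed

lemma same_in_trans:
  assumes "f \<in> vecs X" "g \<in> vecs X" "h \<in> vecs X" and "same_in X f g" "same_in X g h"
  shows "same_in X f h"
proof -
  have "nrm X (\<lambda>t. (f t - g t) + (g t - h t)) \<le> 0"
    using nrm_add[OF diff_mem[OF assms(1,2)] diff_mem[OF assms(2,3)]] assms(4,5)
    by (simp add: same_in_def)
  then show ?thesis
    unfolding same_in_def using nrm_nonneg[OF diff_mem[OF assms(1,3)]] by simp
qed

lemma zero_in_unit_ball: "(\<lambda>_. 0) \<in> unit_ball X"
  by (simp add: unit_ball_def zero_mem nrm_zero)

lemma bdd_above_unit_ball:
  assumes bound: "\<And>f. f \<in> vecs X \<Longrightarrow> p f \<le> K * nrm X f"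
  shows "bdd_above (p ` unit_ball X)"
proof (rule bdd_aboveI2)
  fix g assume "g \<in> unit_ball X"
  then have g: "g \<in> vecs X" "nrm X g \<le> 1" by (auto simp: unit_ball_def)
  \<comment> \<open>\<open>K\<close> is an arbitrary bound and may be negative, hence its absolute
    value.\<close>
  have "p g \<le> \<bar>K\<bar> * nrm X g"
    using bound[OF g(1)] nrm_nonneg[OF g(1)] by (smt (verit) mult_right_mono)
  also have "\<dots> \<le> \<bar>K\<bar>" using g(2) by (simp add: mult_left_le)
  finally show "p g \<le> \<bar>K\<bar>" .
qed

lemma SUP_unit_ball_nonneg:
  assumes "\<And>f. f \<in> vecs X \<Longrightarrow> p f \<le> K * nrm X f"
    and "\<And>f. f \<in> vecs X \<Longrightarrow> (0::real) \<le> p f"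
  shows "0 \<le> (SUP f\<in>unit_ball X. p f)"
  using cSUP_upper[OF zero_in_unit_ball bdd_above_unit_ball[of p K]] assms zero_mem
  by (meson order_trans)

text \<open>Rescale \<open>f\<close> to norm one. If the seminorm of \<open>f\<close> vanishes, the
  bound by \<open>K * nrm X f\<close> settles the case instead. The abstract \<open>p\<close> covers
  both moduli of functionals and norms of operator values.\<close>

lemma le_SUP_unit_ball:
  assumes f: "f \<in> vecs X"
    and bound: "\<And>f. f \<in> vecs X \<Longrightarrow> p f \<le> K * nrm X f"
    and nonneg: "\<And>f. f \<in> vecs X \<Longrightarrow> 0 \<le> p f"
    and scale: "\<And>c f. f \<in> vecs X \<Longrightarrow> p (\<lambda>t. c * f t) = cmod c * p f"
  shows "p f \<le> (SUP f\<in>unit_ball X. p f) * nrm X f"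
proof (cases "nrm X f = 0")
  case True
  then show ?thesis using bound[OF f] by simp
next
  case False
  then have pos: "nrm X f > 0" using nrm_nonneg[OF f] by simp
  let ?c = "complex_of_real (1 / nrm X f)"
  have "(\<lambda>t. ?c * f t) \<in> unit_ball X"
    using pos by (simp only: unit_ball_def mem_Collect_eq nrm_scale[OF f] scale_mem[OF f] norm_of_real) simp
  from cSUP_upper[OF this bdd_above_unit_ball[of p, OF bound]] have "p f / nrm X f \<le> (SUP f\<in>unit_ball X. p f)"
    using pos by (simp only: scale[OF f] norm_of_real) simp
  then show ?thesis using pos by (simp add: field_simps)
qed

section \<open>Dual and bidual spaces\<close>

lemma dual_mem_iff:
  "\<phi> \<in> vecs (dual X) \<longleftrightarrow>
     (\<forall>f. f \<notin> vecs X \<longrightarrow> \<phi> f = 0) \<and>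
     (\<forall>f\<in>vecs X. \<forall>g\<in>vecs X. \<phi> (\<lambda>t. f t + g t) = \<phi> f + \<phi> g) \<and>
     (\<forall>c. \<forall>f\<in>vecs X. \<phi> (\<lambda>t. c * f t) = c * \<phi> f) \<and>
     (\<exists>K. \<forall>f\<in>vecs X. cmod (\<phi> f) \<le> K * nrm X f)"
  by (simp add: dual_def)

lemma dual_memI:
  assumes "\<And>f. f \<notin> vecs X \<Longrightarrow> \<phi> f = 0"
    and "\<And>f g. f \<in> vecs X \<Longrightarrow> g \<in> vecs X \<Longrightarrow> \<phi> (\<lambda>t. f t + g t) = \<phi> f + \<phi> g"
    and "\<And>c f. f \<in> vecs X \<Longrightarrow> \<phi> (\<lambda>t. c * f t) = c * \<phi> f"
    and "\<And>f. f \<in> vecs X \<Longrightarrow> cmod (\<phi> f) \<le> K * nrm X f"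
  shows "\<phi> \<in> vecs (dual X)"
  unfolding dual_mem_iff using assms by blast

lemma dual_nrm: "nrm (dual X) \<phi> = (SUP f\<in>unit_ball X. cmod (\<phi> f))"
  by (simp add: dual_def)

lemma dual_boundE:
  assumes "\<phi> \<in> vecs (dual X)"
  obtains K where "\<And>f. f \<in> vecs X \<Longrightarrow> cmod (\<phi> f) \<le> K * nrm X f"
  using assms unfolding dual_mem_iff by blast

lemma dual_apply_le:
  assumes "\<phi> \<in> vecs (dual X)" "f \<in> vecs X"
  shows "cmod (\<phi> f) \<le> nrm (dual X) \<phi> * nrm X f"
  unfolding dual_nrm using assms(1)
  by (elim dual_boundE, intro le_SUP_unit_ball[where p="\<lambda>f. cmod (\<phi> f)", OF assms(2)])
     (auto simp: dual_mem_iff norm_mult)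

lemma dual_nrm_least:
  assumes "0 \<le> K" "\<And>f. f \<in> vecs X \<Longrightarrow> cmod (\<phi> f) \<le> K * nrm X f"
  shows "nrm (dual X) \<phi> \<le> K"
  unfolding dual_nrm
proof (rule cSUP_least)
  show "unit_ball X \<noteq> {}" using zero_in_unit_ball by blast
  fix f assume "f \<in> unit_ball X"
  then have "f \<in> vecs X" "nrm X f \<le> 1" by (auto simp: unit_ball_def)
  with assms show "cmod (\<phi> f) \<le> K" by (meson mult_left_le order_trans)
qed

lemma dual_add:
  "\<phi> \<in> vecs (dual X) \<Longrightarrow> f \<in> vecs X \<Longrightarrow> g \<in> vecs X \<Longrightarrow> \<phi> (\<lambda>t. f t + g t) = \<phi> f + \<phi> g"
  by (simp add: dual_mem_iff)

lemma dual_scale: "\<phi> \<in> vecs (dual X) \<Longrightarrow> f \<in> vecs X \<Longrightarrow> \<phi> (\<lambda>t. c * f t) = c * \<phi> f"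
  by (simp add: dual_mem_iff)

lemma dual_sum:
  assumes \<phi>: "\<phi> \<in> vecs (dual X)" and "finite I" "\<And>i. i \<in> I \<Longrightarrow> f i \<in> vecs X"
  shows "\<phi> (\<lambda>t. \<Sum>i\<in>I. f i t) = (\<Sum>i\<in>I. \<phi> (f i))"
  using assms(2,3)
proof (induction I)
  case empty
  have "\<forall>f\<in>vecs X. \<phi> (\<lambda>t. 0 * f t) = 0 * \<phi> f"
    using \<phi> unfolding dual_mem_iff by blast
  from bspec[OF this zero_mem]
  show ?case by simp
next
  case (insert i I)
  then have "\<phi> (\<lambda>t. f i t + (\<Sum>i\<in>I. f i t)) = \<phi> (f i) + \<phi> (\<lambda>t. \<Sum>i\<in>I. f i t)"
    using \<phi> sum_mem[of I f] by (simp add: dual_mem_iff)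
  with insert show ?case by simp
qed

lemma seminormed_dual: "seminormed (dual X)"
proof
  show "(\<lambda>_. 0) \<in> vecs (dual X)"
    by (auto simp: dual_mem_iff intro!: exI[of _ 0])
  fix \<phi> assume \<phi>: "\<phi> \<in> vecs (dual X)"
  then obtain K where K: "\<And>f. f \<in> vecs X \<Longrightarrow> cmod (\<phi> f) \<le> K * nrm X f"
    using dual_boundE[OF \<phi>] by blast
  have nn: "0 \<le> nrm (dual X) \<xi>" if "\<xi> \<in> vecs (dual X)" for \<xi>
    unfolding dual_nrm
    by (rule dual_boundE[OF that]) (rule SUP_unit_ball_nonneg[of "\<lambda>f. cmod (\<xi> f)"], auto)
  { fix \<psi> assume \<psi>: "\<psi> \<in> vecs (dual X)"
    then obtain L where L: "\<And>f. f \<in> vecs X \<Longrightarrow> cmod (\<psi> f) \<le> L * nrm X f"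
      using dual_boundE[OF \<psi>] by blast
    show "(\<lambda>f. \<phi> f + \<psi> f) \<in> vecs (dual X)"
    proof (rule dual_memI)
      show "cmod (\<phi> f + \<psi> f) \<le> (K + L) * nrm X f" if "f \<in> vecs X" for f
        using K[OF that] L[OF that] norm_triangle_ineq[of "\<phi> f" "\<psi> f"] by (simp add: distrib_right)
    qed (use \<phi> \<psi> in \<open>simp_all add: dual_mem_iff algebra_simps\<close>)
    show "nrm (dual X) (\<lambda>f. \<phi> f + \<psi> f) \<le> nrm (dual X) \<phi> + nrm (dual X) \<psi>"
    proof (rule dual_nrm_least)
      fix f assume f: "f \<in> vecs X"
      show "cmod (\<phi> f + \<psi> f) \<le> (nrm (dual X) \<phi> + nrm (dual X) \<psi>) * nrm X f"
        using dual_apply_le[OF \<phi> f] dual_apply_le[OF \<psi> f] norm_triangle_ineq[of "\<phi> f" "\<psi> f"]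
        by (simp add: distrib_right)
    qed (use nn \<phi> \<psi> in simp) }
  fix c
  show c\<phi>: "(\<lambda>f. c * \<phi> f) \<in> vecs (dual X)"
  proof (rule dual_memI)
    show "cmod (c * \<phi> f) \<le> (cmod c * K) * nrm X f" if "f \<in> vecs X" for f
      using K[OF that] by (simp add: norm_mult mult.assoc mult_left_mono)
  qed (use \<phi> in \<open>simp_all add: dual_mem_iff algebra_simps\<close>)
  show "nrm (dual X) (\<lambda>f. c * \<phi> f) = cmod c * nrm (dual X) \<phi>"
  proof (rule antisym)
    show "nrm (dual X) (\<lambda>f. c * \<phi> f) \<le> cmod c * nrm (dual X) \<phi>"
      by (rule dual_nrm_least)
         (use nn[OF \<phi>] dual_apply_le[OF \<phi>] in \<open>auto simp: norm_mult mult.assoc mult_left_mono\<close>)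
    show "cmod c * nrm (dual X) \<phi> \<le> nrm (dual X) (\<lambda>f. c * \<phi> f)"
    proof (cases "c = 0")
      case False
      \<comment> \<open>The reverse inequality: a bound for \<open>c * \<phi>\<close>, divided by
        \<open>cmod c\<close>, is a bound for \<open>\<phi>\<close>.\<close>
      have "nrm (dual X) \<phi> \<le> nrm (dual X) (\<lambda>f. c * \<phi> f) / cmod c"
        by (rule dual_nrm_least)
           (use nn[OF c\<phi>] dual_apply_le[OF c\<phi>] False in \<open>auto simp: norm_mult field_simps\<close>)
      then show ?thesis using False by (simp add: field_simps)
    qed (use nn[OF c\<phi>] in simp)
  qed
qed

lemma bidual_emb_mem:
  assumes f: "f \<in> vecs X" shows "bidual_emb X f \<in> vecs (dual (dual X))"
proof -
  interpret D: seminormed "dual X" by (rule seminormed_dual)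
  show ?thesis
  proof (rule D.dual_memI)
    show "cmod (bidual_emb X f \<phi>) \<le> nrm X f * nrm (dual X) \<phi>" if "\<phi> \<in> vecs (dual X)" for \<phi>
      using dual_apply_le[OF that f] that by (simp add: bidual_emb_def mult.commute)
  qed (simp_all add: bidual_emb_def D.add_mem D.scale_mem)
qed

lemma bidual_emb_nrm_le:
  assumes f: "f \<in> vecs X" shows "nrm (dual (dual X)) (bidual_emb X f) \<le> nrm X f"
proof -
  interpret D: seminormed "dual X" by (rule seminormed_dual)
  show ?thesis
    by (rule D.dual_nrm_least)
       (use dual_apply_le f nrm_nonneg in \<open>auto simp: bidual_emb_def mult.commute\<close>)
qed

lemma bidual_emb_add:
  "f \<in> vecs X \<Longrightarrow> g \<in> vecs X \<Longrightarrow>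
    bidual_emb X (\<lambda>t. f t + g t) = (\<lambda>\<phi>. bidual_emb X f \<phi> + bidual_emb X g \<phi>)"
  by (simp add: bidual_emb_def dual_add fun_eq_iff)

lemma bidual_emb_scale:
  "f \<in> vecs X \<Longrightarrow> bidual_emb X (\<lambda>t. c * f t) = (\<lambda>\<phi>. c * bidual_emb X f \<phi>)"
  by (simp add: bidual_emb_def dual_scale fun_eq_iff)

text \<open>An element of the bidual is determined by its values. Evaluating at a functional thus
  turns the linearity of operators into the bidual, which holds up to \<open>same_in\<close>, into
  equations.\<close>

lemma bidual_apply_eq_if_same_in:
  assumes "\<Phi> \<in> vecs (dual (dual X))" "\<Psi> \<in> vecs (dual (dual X))"
    and "same_in (dual (dual X)) \<Phi> \<Psi>" and "\<phi> \<in> vecs (dual X)"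
  shows "\<Phi> \<phi> = \<Psi> \<phi>"
proof -
  interpret D: seminormed "dual X" by (rule seminormed_dual)
  interpret DD: seminormed "dual (dual X)" by (rule D.seminormed_dual)
  show ?thesis
    using D.dual_apply_le[OF DD.diff_mem[OF assms(1,2)] assms(4)] assms(3)
    by (simp add: same_in_def)
qed

end

section \<open>Operators that are linear up to \<open>same_in\<close>\<close>

locale bounded_operator = X: seminormed X + Y: seminormed Y
  for X :: "'i cfs" and Y :: "'j cfs" +
  fixes T assumes bounded_op: "bounded_op X Y T"
begin

lemma mem: "f \<in> vecs X \<Longrightarrow> T f \<in> vecs Y"
  using bounded_op by (simp add: bounded_op_def)

lemma add: "f \<in> vecs X \<Longrightarrow> g \<in> vecs X \<Longrightarrow> same_in Y (T (\<lambda>t. f t + g t)) (\<lambda>s. T f s + T g s)"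
  using bounded_op by (simp add: bounded_op_def)

lemma scale: "f \<in> vecs X \<Longrightarrow> same_in Y (T (\<lambda>t. c * f t)) (\<lambda>s. c * T f s)"
  using bounded_op by (simp add: bounded_op_def)

lemma boundE:
  obtains K where "\<And>f. f \<in> vecs X \<Longrightarrow> nrm Y (T f) \<le> K * nrm X f"
  using bounded_op unfolding bounded_op_def by blast

lemma nrm_le:
  assumes "f \<in> vecs X" shows "nrm Y (T f) \<le> op_norm X Y T * nrm X f"
proof -
  obtain K where K: "\<And>f. f \<in> vecs X \<Longrightarrow> nrm Y (T f) \<le> K * nrm X f"
    using boundE by blast
  show ?thesis
    unfolding op_norm_def
  proof (rule X.le_SUP_unit_ball[where p="\<lambda>f. nrm Y (T f)", OF assms K])
    fix c f assume f: "f \<in> vecs X"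
    have 1: "T (\<lambda>t. c * f t) \<in> vecs Y" "(\<lambda>s. c * T f s) \<in> vecs Y"
      using f by (auto intro: mem X.scale_mem Y.scale_mem)
    \<comment> \<open>Homogeneity holds only up to \<open>same_in\<close>, so the equation is
      obtained from that relation read in both directions.\<close>
    show "nrm Y (T (\<lambda>t. c * f t)) = cmod c * nrm Y (T f)"
      using Y.nrm_le_if_same_in[OF 1 scale[OF f]]
        Y.nrm_le_if_same_in[OF 1(2,1) Y.same_in_sym[OF 1 scale[OF f]]]
        Y.nrm_scale[OF mem[OF f]] by simp
  qed (auto intro: Y.nrm_nonneg mem)
qed

lemma op_norm_nonneg: "0 \<le> op_norm X Y T"
proof -
  obtain K where K: "\<And>f. f \<in> vecs X \<Longrightarrow> nrm Y (T f) \<le> K * nrm X f"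
    using boundE by blast
  then show ?thesis
    unfolding op_norm_def
    by (intro X.SUP_unit_ball_nonneg[where p="\<lambda>f. nrm Y (T f)"]) (auto intro: Y.nrm_nonneg mem)
qed

lemma sum:
  assumes "finite I" "\<And>i. i \<in> I \<Longrightarrow> f i \<in> vecs X"
  shows "same_in Y (T (\<lambda>t. \<Sum>i\<in>I. f i t)) (\<lambda>s. \<Sum>i\<in>I. T (f i) s)"
  using assms
proof (induction I)
  case empty
  show ?case using scale[OF X.zero_mem, of 0] by simp
next
  case (insert i I)
  have m: "(\<lambda>t. \<Sum>i\<in>I. f i t) \<in> vecs X" "f i \<in> vecs X" "(\<lambda>s. \<Sum>i\<in>I. T (f i) s) \<in> vecs Y"
    using insert by (auto intro!: X.sum_mem Y.sum_mem mem)
  have "same_in Y (T (\<lambda>t. f i t + (\<Sum>i\<in>I. f i t))) (\<lambda>s. T (f i) s + (\<Sum>i\<in>I. T (f i) s))"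
  proof (rule Y.same_in_trans)
    show "same_in Y (T (\<lambda>t. f i t + (\<Sum>i\<in>I. f i t))) (\<lambda>s. T (f i) s + T (\<lambda>t. \<Sum>i\<in>I. f i t) s)"
      using m by (intro add)
    show "same_in Y (\<lambda>s. T (f i) s + T (\<lambda>t. \<Sum>i\<in>I. f i t) s) (\<lambda>s. T (f i) s + (\<Sum>i\<in>I. T (f i) s))"
      using insert m by (intro Y.same_in_add mem Y.same_in_refl) auto
  qed (use m in \<open>auto intro!: mem X.add_mem Y.add_mem\<close>)
  then show ?case using insert by simp
qed

lemma sum_scale:
  assumes "finite I" "\<And>i. i \<in> I \<Longrightarrow> f i \<in> vecs X"
  shows "same_in Y (T (\<lambda>t. \<Sum>i\<in>I. c i * f i t)) (\<lambda>s. \<Sum>i\<in>I. c i * T (f i) s)"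
proof (rule Y.same_in_trans)
  show "same_in Y (T (\<lambda>t. \<Sum>i\<in>I. c i * f i t)) (\<lambda>s. \<Sum>i\<in>I. T (\<lambda>t. c i * f i t) s)"
    using assms by (intro sum X.scale_mem)
  show "same_in Y (\<lambda>s. \<Sum>i\<in>I. T (\<lambda>t. c i * f i t) s) (\<lambda>s. \<Sum>i\<in>I. c i * T (f i) s)"
    using assms
  proof (induction I)
    case (insert i I)
    then show ?case
      by (auto intro!: Y.same_in_add scale mem X.scale_mem Y.scale_mem Y.sum_mem)
  qed (simp add: Y.same_in_refl)
qed (use assms in \<open>auto intro!: mem X.sum_mem X.scale_mem Y.sum_mem Y.scale_mem\<close>)

end

lemma op_norm_le:
  assumes "seminormed X" "0 \<le> K" "\<And>f. f \<in> vecs X \<Longrightarrow> nrm Y (T f) \<le> K * nrm X f"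
  shows "op_norm X Y T \<le> K"
  unfolding op_norm_def
proof (rule cSUP_least)
  interpret seminormed X by fact
  show "unit_ball X \<noteq> {}" using zero_in_unit_ball by blast
  fix f assume "f \<in> unit_ball X"
  then have "f \<in> vecs X" "nrm X f \<le> 1" by (auto simp: unit_ball_def)
  with assms(2,3) show "nrm Y (T f) \<le> K" by (meson mult_left_le order_trans)
qed

section \<open>The spaces \<open>L1\<close> and \<open>ell2\<close>\<close>

lemma seminormed_L1: "seminormed (L1 M)"
proof
  fix f g assume "f \<in> vecs (L1 M)" "g \<in> vecs (L1 M)"
  then have fg: "integrable M f" "integrable M g" by (auto simp: L1_def)
  then show "(\<lambda>t. f t + g t) \<in> vecs (L1 M)" by (simp add: L1_def)
  have "(LINT t|M. cmod (f t + g t)) \<le> (LINT t|M. cmod (f t) + cmod (g t))"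
    using fg by (intro integral_mono) (auto simp: norm_triangle_ineq)
  then show "nrm (L1 M) (\<lambda>t. f t + g t) \<le> nrm (L1 M) f + nrm (L1 M) g"
    using fg by (simp add: L1_def)
qed (auto simp: L1_def norm_mult)

lemma ell2_mem_iff: "x \<in> vecs ell2 \<longleftrightarrow> summable (\<lambda>n. (cmod (x n))\<^sup>2)"
  and ell2_nrm: "nrm ell2 x = sqrt (\<Sum>n. (cmod (x n))\<^sup>2)"
  by (simp_all add: ell2_def)

lemma L2_set_le_ell2_nrm:
  assumes "x \<in> vecs ell2" "finite F" shows "L2_set (\<lambda>n. cmod (x n)) F \<le> nrm ell2 x"
  unfolding L2_set_def ell2_nrm
  by (intro real_sqrt_le_mono sum_le_suminf) (use assms in \<open>auto simp: ell2_mem_iff\<close>)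

lemma ell2_nrm_finite:
  assumes "\<And>k. k \<ge> n \<Longrightarrow> x k = 0"
  shows "x \<in> vecs ell2" "nrm ell2 x = L2_set (\<lambda>k. cmod (x k)) {..<n}"
proof -
  have "(\<lambda>k. (cmod (x k))\<^sup>2) sums (\<Sum>k<n. (cmod (x k))\<^sup>2)"
    by (rule sums_finite) (use assms in auto)
  then show "x \<in> vecs ell2" "nrm ell2 x = L2_set (\<lambda>k. cmod (x k)) {..<n}"
    by (auto simp: ell2_mem_iff ell2_nrm L2_set_def sums_iff)
qed

lemma seminormed_ell2: "seminormed ell2"
proof
  fix x y assume xy: "x \<in> vecs ell2" "y \<in> vecs ell2"
  \<comment> \<open>Minkowski's inequality for partial sums, uniformly in \<open>n\<close>; it
    yields both summability and the triangle inequality.\<close>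
  have bound: "(\<Sum>k<n. (cmod (x k + y k))\<^sup>2) \<le> (nrm ell2 x + nrm ell2 y)\<^sup>2" for n
  proof -
    have "L2_set (\<lambda>k. cmod (x k + y k)) {..<n} \<le> L2_set (\<lambda>k. cmod (x k) + cmod (y k)) {..<n}"
      by (intro L2_set_mono norm_triangle_ineq) auto
    also have "\<dots> \<le> L2_set (\<lambda>k. cmod (x k)) {..<n} + L2_set (\<lambda>k. cmod (y k)) {..<n}"
      by (rule L2_set_triangle_ineq)
    also have "\<dots> \<le> nrm ell2 x + nrm ell2 y"
      using xy by (intro add_mono L2_set_le_ell2_nrm) auto
    finally show ?thesis
      unfolding L2_set_def by (meson real_sqrt_le_iff sqrt_le_D)
  qed
  have s: "summable (\<lambda>n. (cmod (x n + y n))\<^sup>2)"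
    by (rule summableI_nonneg_bounded[OF _ bound]) simp
  then show "(\<lambda>t. x t + y t) \<in> vecs ell2" by (simp add: ell2_mem_iff)
  have nn: "0 \<le> nrm ell2 x" "0 \<le> nrm ell2 y"
    using xy by (auto simp: ell2_nrm ell2_mem_iff intro!: suminf_nonneg)
  have "(\<Sum>n. (cmod (x n + y n))\<^sup>2) \<le> (nrm ell2 x + nrm ell2 y)\<^sup>2"
    by (rule suminf_le_const[OF s bound])
  with nn show "nrm ell2 (\<lambda>t. x t + y t) \<le> nrm ell2 x + nrm ell2 y"
    using real_le_lsqrt real_sqrt_le_mono by (fastforce simp: ell2_nrm[of "\<lambda>t. x t + y t"])
next
  fix x c assume x: "x \<in> vecs ell2"
  then show "(\<lambda>t. c * x t) \<in> vecs ell2"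
    by (auto simp: ell2_mem_iff norm_mult power_mult_distrib intro: summable_mult)
  show "nrm ell2 (\<lambda>t. c * x t) = cmod c * nrm ell2 x"
    using x by (simp add: ell2_nrm ell2_mem_iff norm_mult power_mult_distrib suminf_mult real_sqrt_mult)
qed (auto simp: ell2_mem_iff)

interpretation ell2: seminormed ell2 by (rule seminormed_ell2)

text \<open>A single coordinate is dominated by the norm, so \<open>ell2\<close> is definite and
  operators into it are linear in the plain sense.\<close>

lemma ell2_eq_if_same_in:
  assumes "x \<in> vecs ell2" "y \<in> vecs ell2" "same_in ell2 x y" shows "x = y"
proof
  fix n
  have "L2_set (\<lambda>k. cmod (x k - y k)) {n} \<le> 0"
    using L2_set_le_ell2_nrm[OF ell2.diff_mem[OF assms(1,2)], of "{n}"] assms(3)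
    by (simp add: same_in_def)
  then show "x n = y n" by (simp add: L2_set_def)
qed

text \<open>The pairing with a finite coefficient vector, without conjugation. The value 0 off the
  carrier is what \<open>dual\<close> demands.\<close>

definition ell2_functional :: "nat \<Rightarrow> (nat \<Rightarrow> complex) \<Rightarrow> (nat \<Rightarrow> complex) \<Rightarrow> complex" where
  "ell2_functional n b = (\<lambda>x. if x \<in> vecs ell2 then \<Sum>k<n. b k * x k else 0)"

lemma ell2_functional_le:
  assumes "x \<in> vecs ell2"
  shows "cmod (ell2_functional n b x) \<le> L2_set (\<lambda>k. cmod (b k)) {..<n} * nrm ell2 x"
proof -
  have "cmod (\<Sum>k<n. b k * x k) \<le> (\<Sum>k<n. \<bar>cmod (b k)\<bar> * \<bar>cmod (x k)\<bar>)"
    by (rule order_trans[OF norm_sum]) (simp add: norm_mult)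
  also have "\<dots> \<le> L2_set (\<lambda>k. cmod (b k)) {..<n} * L2_set (\<lambda>k. cmod (x k)) {..<n}"
    by (rule L2_set_mult_ineq)
  also have "\<dots> \<le> L2_set (\<lambda>k. cmod (b k)) {..<n} * nrm ell2 x"
    using assms by (intro mult_left_mono L2_set_le_ell2_nrm) (auto simp: L2_set_nonneg)
  finally show ?thesis using assms by (simp add: ell2_functional_def)
qed

lemma ell2_functional_mem: "ell2_functional n b \<in> vecs (dual ell2)"
  by (rule ell2.dual_memI[OF _ _ _ ell2_functional_le])
     (simp_all add: ell2_functional_def sum.distrib sum_distrib_left algebra_simps ell2.add_mem ell2.scale_mem)

lemma ell2_functional_nrm_le: "nrm (dual ell2) (ell2_functional n b) \<le> L2_set (\<lambda>k. cmod (b k)) {..<n}"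
  using ell2_functional_le by (intro ell2.dual_nrm_least) (auto simp: L2_set_nonneg)


section \<open>Comparison of \<open>L\<^sub>1\<close> and \<open>L\<^sub>2\<close> norms on cyclic groups\<close>

definition roots :: "nat \<Rightarrow> complex set" where
  "roots q = {z. z ^ q = 1}"

lemma finite_roots: "q > 0 \<Longrightarrow> finite (roots q)"
  unfolding roots_def using finite_roots_unity[of q] by simp

lemma card_roots: "q > 0 \<Longrightarrow> card (roots q) = q"
  unfolding roots_def by (rule card_roots_unity_eq)

lemma norm_root:
  assumes "q > 0" "z \<in> roots q" shows "cmod z = 1"
  using assms power_eq_imp_eq_base[of "cmod z" q 1] by (simp add: roots_def flip: norm_power)

text \<open>Multiplication by a primitive root \<open>\<omega>\<close> permutes the roots, so the
  sum is invariant under multiplication by \<open>\<omega> ^ k * cnj \<omega> ^ l\<close>. For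
  \<open>k \<noteq> l\<close> this factor is not 1, because the powers of \<open>\<omega>\<close>
  below \<open>q\<close> are distinct, and the sum vanishes.\<close>

lemma sum_power_mult_cnj_power_roots:
  assumes "k < q" "l < q"
  shows "(\<Sum>z\<in>roots q. z ^ k * cnj z ^ l) = (if k = l then of_nat q else 0)"
proof (cases "k = l")
  case True
  have "z ^ k * cnj z ^ l = 1" if "z \<in> roots q" for z
    using norm_root[OF _ that] assms True
    by (simp flip: power_mult_distrib add: complex_norm_square[symmetric])
  then show ?thesis using True card_roots[of q] assms by simp
next
  case False
  define \<omega> where "\<omega> = cis (2 * pi / q)"
  let ?c = "\<omega> ^ k * cnj \<omega> ^ l"
  have [simp]: "cmod \<omega> = 1" "\<omega> \<noteq> 0" by (simp_all add: \<omega>_def)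
  have \<omega>q: "\<omega> ^ q = 1"
    unfolding \<omega>_def Complex.DeMoivre using assms by simp
  have "inj_on (\<lambda>j. cis (2 * pi * real j / real q)) {..<q}"
    using Complex.bij_betw_roots_unity[of q] assms by (auto simp: bij_betw_def)
  then have "\<omega> ^ k \<noteq> \<omega> ^ l"
    using assms False unfolding inj_on_def \<omega>_def by (force simp: Complex.DeMoivre mult.commute)
  moreover have "\<omega> ^ l * ?c = \<omega> ^ k"
    by (simp add: mult.left_commute flip: power_mult_distrib complex_norm_square)
  ultimately have c: "?c \<noteq> 1" by (metis mult.right_neutral)
  have "bij_betw ((*) \<omega>) (roots q) (roots q)"
    by (rule bij_betwI[where g="\<lambda>z. z / \<omega>"])
       (use \<omega>q in \<open>auto simp: roots_def power_mult_distrib power_divide\<close>)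
  from sum.reindex_bij_betw[OF this, of "\<lambda>z. z ^ k * cnj z ^ l"]
  have "(\<Sum>z\<in>roots q. ?c * (z ^ k * cnj z ^ l)) = (\<Sum>z\<in>roots q. z ^ k * cnj z ^ l)"
    by (simp add: power_mult_distrib mult_ac)
  then have "?c * (\<Sum>z\<in>roots q. z ^ k * cnj z ^ l) = (\<Sum>z\<in>roots q. z ^ k * cnj z ^ l)"
    by (simp add: sum_distrib_left)
  with c False show ?thesis by auto
qed

lemma cyc_altdef: "cyc q N = {..<N} \<rightarrow>\<^sub>E roots q"
  by (simp add: cyc_def roots_def)

lemma finite_cyc: "q > 0 \<Longrightarrow> finite (cyc q N)"
  unfolding cyc_altdef by (intro finite_PiE) (auto simp: finite_roots)

lemma card_cyc: "q > 0 \<Longrightarrow> card (cyc q N) = q ^ N"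
  unfolding cyc_altdef by (simp add: card_PiE card_roots)

lemma cyc_nonempty: "q > 0 \<Longrightarrow> cyc q N \<noteq> {}"
  using card_cyc[of q N] by auto

lemma finite_multi_indices: "finite (multi_indices q N)"
  unfolding multi_indices_def by (intro finite_PiE) auto

lemma norm_character:
  assumes "q > 0" "x \<in> cyc q N" shows "cmod (character N \<alpha> x) = 1"
  unfolding character_def prod_norm[symmetric] norm_power
proof (rule prod.neutral, rule ballI)
  fix j assume "j \<in> {..<N}"
  with assms have "cmod (x j) = 1"
    by (intro norm_root[of q]) (auto simp: cyc_altdef)
  then show "cmod (x j) ^ \<alpha> j = 1" by simp
qed

text \<open>The sum over the product group factors into one-coordinate sums, one of which vanishes
  as soon as the indices differ.\<close>

lemma sum_character_mult_cnj:
  assumes q: "q > 0" and "\<alpha> \<in> multi_indices q N" "\<beta> \<in> multi_indices q N"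
  shows "(\<Sum>x\<in>cyc q N. character N \<alpha> x * cnj (character N \<beta> x)) =
    (if \<alpha> = \<beta> then of_nat (q ^ N) else 0)"
proof -
  have lt: "\<alpha> j < q" "\<beta> j < q" if "j < N" for j
    using PiE_mem[OF assms(2)[unfolded multi_indices_def], of j]
      PiE_mem[OF assms(3)[unfolded multi_indices_def], of j] that q by auto
  have "(\<Sum>x\<in>cyc q N. character N \<alpha> x * cnj (character N \<beta> x)) =
      (\<Sum>x\<in>cyc q N. \<Prod>j<N. x j ^ \<alpha> j * cnj (x j) ^ \<beta> j)"
    by (simp add: character_def prod.distrib)
  also have "\<dots> = (\<Prod>j<N. \<Sum>z\<in>roots q. z ^ \<alpha> j * cnj z ^ \<beta> j)"
    unfolding cyc_altdef using q by (intro prod_sum_PiE[symmetric]) (auto simp: finite_roots)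
  also have "\<dots> = (\<Prod>j<N. if \<alpha> j = \<beta> j then of_nat q else 0)"
    by (intro prod.cong refl sum_power_mult_cnj_power_roots) (use lt in auto)
  also have "\<dots> = (if \<alpha> = \<beta> then of_nat (q ^ N) else 0)"
  proof (cases "\<alpha> = \<beta>")
    case False
    have "\<exists>j<N. \<alpha> j \<noteq> \<beta> j"
      using False assms(2,3) unfolding multi_indices_def by (metis PiE_ext lessThan_iff)
    then have "(\<Prod>j<N. if \<alpha> j = \<beta> j then of_nat q else (0::complex)) = 0"
      by (auto intro!: prod_zero)
    with False show ?thesis by simp
  qed simp
  finally show ?thesis .
qed

text \<open>Defined as an average over the group, it is linear on all functions and does not refer
  to a representation of \<open>f\<close> as a polynomial.\<close>

definition fourier_coeff :: "nat \<Rightarrow> nat \<Rightarrow> ((nat \<Rightarrow> complex) \<Rightarrow> complex) \<Rightarrow> (nat \<Rightarrow> nat) \<Rightarrow> complex" where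
  "fourier_coeff q N f \<alpha> = (\<Sum>x\<in>cyc q N. f x * cnj (character N \<alpha> x)) / of_nat (q ^ N)"

lemma fourier_coeff_poly_fun:
  assumes q: "q > 0" and \<Lambda>: "\<Lambda> \<subseteq> multi_indices q N" and \<beta>: "\<beta> \<in> \<Lambda>"
  shows "fourier_coeff q N (poly_fun q N \<Lambda> a) \<beta> = a \<beta>"
proof -
  have fin: "finite \<Lambda>" using \<Lambda> finite_multi_indices finite_subset by blast
  have "(\<Sum>x\<in>cyc q N. poly_fun q N \<Lambda> a x * cnj (character N \<beta> x)) =
     (\<Sum>x\<in>cyc q N. \<Sum>\<alpha>\<in>\<Lambda>. a \<alpha> * (character N \<alpha> x * cnj (character N \<beta> x)))"
    by (intro sum.cong refl) (simp add: poly_fun_def sum_distrib_right mult.assoc)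
  also have "\<dots> = (\<Sum>\<alpha>\<in>\<Lambda>. a \<alpha> * (\<Sum>x\<in>cyc q N. character N \<alpha> x * cnj (character N \<beta> x)))"
    unfolding sum_distrib_left by (rule sum.swap)
  also have "\<dots> = (\<Sum>\<alpha>\<in>\<Lambda>. if \<alpha> = \<beta> then a \<alpha> * of_nat (q ^ N) else 0)"
    using \<Lambda> \<beta> q by (intro sum.cong refl) (subst sum_character_mult_cnj, auto)
  also have "\<dots> = a \<beta> * of_nat (q ^ N)"
    using fin \<beta> by (simp add: sum.delta')
  finally show ?thesis using q by (simp add: fourier_coeff_def)
qed

text \<open>Expanding only the conjugate factor of \<open>?f x * cnj (?f x)\<close> leaves Fourier
  coefficients of \<open>?f\<close>.\<close>

lemma parseval_poly_fun:
  assumes q: "q > 0" and \<Lambda>: "\<Lambda> \<subseteq> multi_indices q N"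
  shows "(\<Sum>x\<in>cyc q N. (cmod (poly_fun q N \<Lambda> a x))\<^sup>2) = q ^ N * (\<Sum>\<alpha>\<in>\<Lambda>. (cmod (a \<alpha>))\<^sup>2)"
proof -
  let ?f = "poly_fun q N \<Lambda> a"
  have coeff: "of_nat (q ^ N) * fourier_coeff q N ?f \<alpha> = (\<Sum>x\<in>cyc q N. ?f x * cnj (character N \<alpha> x))" for \<alpha>
    using q by (simp add: fourier_coeff_def)
  have "complex_of_real (\<Sum>x\<in>cyc q N. (cmod (?f x))\<^sup>2) = (\<Sum>x\<in>cyc q N. ?f x * cnj (?f x))"
    by (simp only: of_real_sum complex_norm_square)
  also have "\<dots> = (\<Sum>x\<in>cyc q N. \<Sum>\<alpha>\<in>\<Lambda>. cnj (a \<alpha>) * (?f x * cnj (character N \<alpha> x)))"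
    by (intro sum.cong refl) (simp add: poly_fun_def sum_distrib_left mult_ac)
  also have "\<dots> = (\<Sum>\<alpha>\<in>\<Lambda>. cnj (a \<alpha>) * (of_nat (q ^ N) * fourier_coeff q N ?f \<alpha>))"
    unfolding coeff by (subst sum.swap) (simp add: sum_distrib_left)
  also have "\<dots> = (\<Sum>\<alpha>\<in>\<Lambda>. of_nat (q ^ N) * (a \<alpha> * cnj (a \<alpha>)))"
    using fourier_coeff_poly_fun[OF q \<Lambda>] by (intro sum.cong refl) simp
  also have "\<dots> = complex_of_real (q ^ N * (\<Sum>\<alpha>\<in>\<Lambda>. (cmod (a \<alpha>))\<^sup>2))"
    by (simp only: of_real_mult of_real_sum complex_norm_square sum_distrib_left) simp
  finally show ?thesis by (simp only: of_real_eq_iff of_nat_power)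
qed

section \<open>Hypercontractivity: fourth moments against weighted second moments\<close>

definition weight :: "nat \<Rightarrow> real" where
  "weight k = (if k = 0 then 1 else 10 * sqrt 2 ^ k)"

lemma weight_pos: "weight k > 0"
  by (simp add: weight_def)

lemma weight_nonneg [simp]: "weight k \<ge> 0" and weight_nonzero [simp]: "weight k \<noteq> 0"
  using weight_pos[of k] by auto

text \<open>A geometric series of ratio \<open>1 / sqrt 2\<close> has sum at most
  \<open>sqrt 2 + 1\<close>, hence at most 5/2; the factor 10 in \<open>weight\<close> brings this
  down to 1/4, the value that \<open>norm_add_power4_le\<close> asks for.\<close>

lemma sum_inverse_weight_le: "(\<Sum>k=1..<q. 1 / weight k) \<le> 1 / 4"
proof -
  have s: "sqrt 2 > (1::real)" "sqrt 2 \<le> (3 / 2::real)"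
    by simp (rule real_le_lsqrt, simp_all add: power2_eq_square)
  let ?r = "1 / sqrt 2 :: real"
  have "(\<Sum>k=1..<q. 1 / weight k) = (\<Sum>k=1..<q. (1/10) * ?r ^ k)"
    by (intro sum.cong) (auto simp: weight_def power_divide)
  also have "\<dots> \<le> (1/10) * (?r / (1 - ?r))"
  proof -
    have "(\<Sum>k=1..<q. ?r ^ k) = ?r * (\<Sum>k<q-1. ?r ^ k)"
      by (cases q) (simp_all only: One_nat_def sum.shift_bounds_Suc_ivl power_Suc sum_distrib_left
          atLeast0LessThan diff_Suc_1, simp_all)
    also have "(\<Sum>k<q-1. ?r ^ k) \<le> 1 / (1 - ?r)"
      using s by (subst sum_gp_strict) (auto simp: field_simps)
    finally show ?thesis
      unfolding sum_distrib_left[symmetric] using s by (simp add: divide_right_mono)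
  qed
  also have "?r / (1 - ?r) = sqrt 2 + 1"
    using s by (simp add: field_simps)
  finally show ?thesis using s by simp
qed

text \<open>All terms of the expansion are absorbed into the square except the one linear in
  \<open>g\<close>. That one is kept, because it cancels when \<open>g\<close> has mean
  zero.\<close>

lemma norm_add_power4_le:
  fixes a g :: complex
  assumes "(cmod g)\<^sup>2 \<le> s / 4"
  shows "cmod (a + g) ^ 4 \<le> ((cmod a)\<^sup>2 + s)\<^sup>2 + 4 * (cmod a)\<^sup>2 * Re (cnj a * g)"
proof -
  define A G R where "A = cmod a" and "G = cmod g" and "R = Re (cnj a * g)"
  have nn: "0 \<le> A" "0 \<le> G" by (auto simp: A_def G_def)
  have R: "\<bar>R\<bar> \<le> A * G"
    using abs_Re_le_cmod[of "cnj a * g"] by (simp add: R_def A_def G_def norm_mult)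
  have "(cmod (a + g))\<^sup>2 = A\<^sup>2 + 2 * R + G\<^sup>2"
    unfolding A_def G_def R_def cmod_power2 by (simp add: power2_eq_square algebra_simps)
  then have "cmod (a + g) ^ 4 = (A\<^sup>2 + 2 * R + G\<^sup>2)\<^sup>2"
    by (metis mult_2_right numeral_Bit0 power_even_eq power2_eq_square power_add)
  also have "\<dots> = A^4 + 4 * R\<^sup>2 + G^4 + 4 * A\<^sup>2 * R + 2 * A\<^sup>2 * G\<^sup>2 + 4 * R * G\<^sup>2"
    by (simp add: power2_eq_square power4_eq_xxxx algebra_simps)
  \<comment> \<open>From \<open>\<bar>R\<bar> \<le> A * G\<close> and the arithmetic-geometric mean
    inequality for the mixed term \<open>A * G * G\<^sup>2\<close>.\<close>
  also have "\<dots> \<le> A^4 + 8 * A\<^sup>2 * G\<^sup>2 + 3 * G^4 + 4 * A\<^sup>2 * R"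
  proof -
    have "R\<^sup>2 \<le> (A * G)\<^sup>2" using R by (metis abs_le_square_iff abs_of_nonneg nn mult_nonneg_nonneg)
    moreover have "R * G\<^sup>2 \<le> (A * G) * G\<^sup>2" using R by (intro mult_right_mono) auto
    moreover have "2 * ((A * G) * G\<^sup>2) \<le> (A * G)\<^sup>2 + (G\<^sup>2)\<^sup>2"
      using sum_squares_bound[of "A * G" "G\<^sup>2"] by (simp add: mult_ac)
    ultimately show ?thesis by (simp add: power_mult_distrib)
  qed
  also have "\<dots> \<le> (A\<^sup>2 + s)\<^sup>2 + 4 * A\<^sup>2 * R"
  proof -
    have G: "4 * G\<^sup>2 \<le> s" using assms by (simp add: G_def)
    then have "A\<^sup>2 * (4 * G\<^sup>2) \<le> A\<^sup>2 * s" by (intro mult_left_mono) auto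
    moreover have "(4 * G\<^sup>2)\<^sup>2 \<le> s\<^sup>2" using G by (intro power_mono) auto
    moreover have "(4 * G\<^sup>2)\<^sup>2 = 16 * G ^ 4" "(A\<^sup>2 + s)\<^sup>2 = A ^ 4 + 2 * (A\<^sup>2 * s) + s\<^sup>2"
      by (simp_all add: power2_sum power_mult_distrib)
    moreover have "0 \<le> G ^ 4" by simp
    ultimately show ?thesis by (simp only: mult.assoc mult.left_commute[of _ "numeral _"])
  qed
  finally show ?thesis by (simp add: A_def R_def)
qed

text \<open>Write the polynomial as its constant term \<open>b 0\<close> plus a mean-zero part
  \<open>g\<close>. Cauchy-Schwarz bounds \<open>g\<close> pointwise,
  \<open>norm_add_power4_le\<close> applies at every root, and the linear terms sum to zero.\<close>

lemma one_variable_fourth_moment: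
  assumes q: "q > 0"
  shows "(\<Sum>z\<in>roots q. cmod (\<Sum>k<q. b k * z ^ k) ^ 4) \<le> q * (\<Sum>k<q. weight k * (cmod (b k))\<^sup>2)\<^sup>2"
proof -
  define s where "s = (\<Sum>k=1..<q. weight k * (cmod (b k))\<^sup>2)"
  define g where "g z = (\<Sum>k=1..<q. b k * z ^ k)" for z
  have split: "(\<Sum>k<q. h k) = h 0 + (\<Sum>k=1..<q. h k)" for h :: "nat \<Rightarrow> 'a::comm_monoid_add"
    using q by (simp add: lessThan_atLeast0 sum.atLeast_Suc_lessThan)
  have g: "(cmod (g z))\<^sup>2 \<le> s / 4" if z: "z \<in> roots q" for z
  proof -
    \<comment> \<open>Inserting \<open>sqrt (weight k)\<close> and its inverse prepares
      Cauchy-Schwarz with the weighted sum \<open>s\<close> as one factor.\<close>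
    have "cmod (g z) \<le> (\<Sum>k=1..<q. sqrt (weight k) * cmod (b k) * (1 / sqrt (weight k)))"
      unfolding g_def using norm_root[OF q z]
      by (intro order_trans[OF norm_sum]) (auto simp: norm_mult norm_power intro!: sum_mono)
    then have "(cmod (g z))\<^sup>2 \<le> (\<Sum>k=1..<q. sqrt (weight k) * cmod (b k) * (1 / sqrt (weight k)))\<^sup>2"
      by (intro power_mono) auto
    also have "\<dots> \<le> (\<Sum>k=1..<q. (sqrt (weight k) * cmod (b k))\<^sup>2) * (\<Sum>k=1..<q. (1 / sqrt (weight k))\<^sup>2)"
      by (rule Cauchy_Schwarz_ineq_sum)
    also have "\<dots> = s * (\<Sum>k=1..<q. 1 / weight k)"
      by (simp add: s_def power_mult_distrib power_divide)
    also have "\<dots> \<le> s * (1 / 4)"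
      using sum_inverse_weight_le
      by (intro mult_left_mono) (auto simp: s_def intro!: sum_nonneg)
    finally show ?thesis by simp
  qed
  have "(\<Sum>z\<in>roots q. z ^ k) = 0" if "k \<in> {1..<q}" for k
    using sum_power_mult_cnj_power_roots[of k q 0] that by auto
  then have g0: "(\<Sum>z\<in>roots q. g z) = 0"
    unfolding g_def by (subst sum.swap) (simp add: sum_distrib_left[symmetric])
  have "(\<Sum>z\<in>roots q. cmod (\<Sum>k<q. b k * z ^ k) ^ 4) = (\<Sum>z\<in>roots q. cmod (b 0 + g z) ^ 4)"
    by (simp add: split g_def)
  also have "\<dots> \<le> (\<Sum>z\<in>roots q. ((cmod (b 0))\<^sup>2 + s)\<^sup>2 + 4 * (cmod (b 0))\<^sup>2 * Re (cnj (b 0) * g z))"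
    by (intro sum_mono norm_add_power4_le g)
  also have "\<dots> = q * ((cmod (b 0))\<^sup>2 + s)\<^sup>2 + 4 * (cmod (b 0))\<^sup>2 * Re (cnj (b 0) * (\<Sum>z\<in>roots q. g z))"
    by (simp add: sum.distrib card_roots[OF q] sum_distrib_left algebra_simps sum_subtractf)
  also have "\<dots> = q * (\<Sum>k<q. weight k * (cmod (b k))\<^sup>2)\<^sup>2"
    by (simp add: g0 split s_def weight_def)
  finally show ?thesis .
qed

lemma sum_PiE_Suc:
  fixes h :: "(nat \<Rightarrow> 'a) \<Rightarrow> 'b::comm_monoid_add"
  shows "(\<Sum>x\<in>{..<Suc N} \<rightarrow>\<^sub>E S. h x) = (\<Sum>x\<in>{..<N} \<rightarrow>\<^sub>E S. \<Sum>z\<in>S. h (x(N := z)))"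
proof -
  have "(\<Sum>x\<in>{..<Suc N} \<rightarrow>\<^sub>E S. h x) = (\<Sum>(z, x)\<in>S \<times> ({..<N} \<rightarrow>\<^sub>E S). h (x(N := z)))"
    unfolding lessThan_Suc PiE_insert_eq
    by (subst sum.reindex[OF inj_combinator]) (auto simp: case_prod_unfold)
  also have "\<dots> = (\<Sum>z\<in>S. \<Sum>x\<in>{..<N} \<rightarrow>\<^sub>E S. h (x(N := z)))"
    by (rule sum.cartesian_product[symmetric])
  also have "\<dots> = (\<Sum>x\<in>{..<N} \<rightarrow>\<^sub>E S. \<Sum>z\<in>S. h (x(N := z)))"
    by (rule sum.swap)
  finally show ?thesis .
qed

lemma character_Suc_upd:
  "character (Suc N) (\<alpha>(N := k)) (x(N := z)) = character N \<alpha> x * z ^ k"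
  unfolding character_def by simp

definition mweight :: "nat \<Rightarrow> (nat \<Rightarrow> nat) \<Rightarrow> real" where
  "mweight N \<alpha> = (\<Prod>j<N. weight (\<alpha> j))"

lemma mweight_nonneg: "0 \<le> mweight N \<alpha>"
  by (simp add: mweight_def prod_nonneg)

lemma mweight_Suc_upd: "mweight (Suc N) (\<alpha>(N := k)) = mweight N \<alpha> * weight k"
  unfolding mweight_def by simp

text \<open>Induction on \<open>N\<close>: with the first \<open>N\<close> coordinates frozen, the
  one-variable bound applies in the last one. The resulting square is expanded, and each mixed
  product is reduced to the induction hypothesis by Cauchy-Schwarz in \<open>x\<close>.\<close>

lemma fourth_moment_le:
  assumes q: "q > 0"
  shows "(\<Sum>x\<in>cyc q N. cmod (\<Sum>\<alpha>\<in>multi_indices q N. c \<alpha> * character N \<alpha> x) ^ 4)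
     \<le> q ^ N * (\<Sum>\<alpha>\<in>multi_indices q N. mweight N \<alpha> * (cmod (c \<alpha>))\<^sup>2)\<^sup>2"
proof (induction N arbitrary: c)
  case 0
  show ?case
    by (simp add: cyc_def multi_indices_def character_def mweight_def power2_eq_square
        power4_eq_xxxx mult.assoc)
next
  case (Suc N)
  \<comment> \<open>The coefficient of the \<open>k\<close>-th power of the last variable;
    \<open>S k\<close> is its weighted second moment.\<close>
  define f where "f k x = (\<Sum>\<alpha>\<in>multi_indices q N. c (\<alpha>(N := k)) * character N \<alpha> x)" for k x
  define S where "S k = (\<Sum>\<alpha>\<in>multi_indices q N. mweight N \<alpha> * (cmod (c (\<alpha>(N := k))))\<^sup>2)" for k
  have S0: "0 \<le> S k" for k
    unfolding S_def by (intro sum_nonneg mult_nonneg_nonneg mweight_nonneg) auto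
  have f4: "(\<Sum>x\<in>cyc q N. cmod (f k x) ^ 4) \<le> q ^ N * (S k)\<^sup>2" for k
    unfolding f_def S_def using Suc.IH[of "\<lambda>\<alpha>. c (\<alpha>(N := k))"] by simp
  have square: "(\<Sum>k<q. h k)\<^sup>2 = (\<Sum>k<q. \<Sum>l<q. h k * h l)" for h :: "nat \<Rightarrow> real"
    by (simp add: power2_eq_square sum_product)
  have I: "{0..q-1} = {..<q}" using q by auto
  have "(\<Sum>x\<in>cyc q (Suc N). cmod (\<Sum>\<alpha>\<in>multi_indices q (Suc N). c \<alpha> * character (Suc N) \<alpha> x) ^ 4)
     = (\<Sum>x\<in>cyc q N. \<Sum>z\<in>roots q. cmod (\<Sum>k<q. f k x * z ^ k) ^ 4)"
  proof -
    have "(\<Sum>\<alpha>\<in>multi_indices q (Suc N). c \<alpha> * character (Suc N) \<alpha> (x(N := z))) = (\<Sum>k<q. f k x * z ^ k)" for x z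
      unfolding multi_indices_def sum_PiE_Suc character_Suc_upd I f_def sum_distrib_right
      by (subst sum.swap) (simp add: mult.assoc)
    then show ?thesis unfolding cyc_altdef sum_PiE_Suc by simp
  qed
  also have "\<dots> \<le> (\<Sum>x\<in>cyc q N. q * (\<Sum>k<q. weight k * (cmod (f k x))\<^sup>2)\<^sup>2)"
    by (intro sum_mono one_variable_fourth_moment q)
  also have "\<dots> = q * (\<Sum>x\<in>cyc q N. \<Sum>k<q. \<Sum>l<q. weight k * weight l * ((cmod (f k x))\<^sup>2 * (cmod (f l x))\<^sup>2))"
    unfolding square sum_distrib_left[of "real q"] by (intro sum.cong refl) (simp add: mult_ac)
  also have "\<dots> = q * (\<Sum>k<q. \<Sum>l<q. weight k * weight l * (\<Sum>x\<in>cyc q N. (cmod (f k x))\<^sup>2 * (cmod (f l x))\<^sup>2))"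
    unfolding sum_distrib_left[of "weight _ * weight _"]
    by (subst sum.swap, intro arg_cong2[where f="(*)"] sum.cong refl, subst sum.swap) (rule refl)
  also have "\<dots> \<le> q * (\<Sum>k<q. \<Sum>l<q. weight k * weight l * (q ^ N * (S k * S l)))"
  proof (intro mult_left_mono sum_mono)
    fix k l
    let ?P = "\<Sum>x\<in>cyc q N. (cmod (f k x))\<^sup>2 * (cmod (f l x))\<^sup>2"
    \<comment> \<open>Cauchy-Schwarz separates \<open>f k\<close> from \<open>f l\<close>, so that
      the induction hypothesis applies to each.\<close>
    have "?P\<^sup>2 \<le> (\<Sum>x\<in>cyc q N. ((cmod (f k x))\<^sup>2)\<^sup>2) * (\<Sum>x\<in>cyc q N. ((cmod (f l x))\<^sup>2)\<^sup>2)"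
      by (rule Cauchy_Schwarz_ineq_sum)
    also have "\<dots> \<le> (q ^ N * (S k)\<^sup>2) * (q ^ N * (S l)\<^sup>2)"
      using f4 by (intro mult_mono) (auto intro!: sum_nonneg simp flip: power_mult)
    also have "\<dots> = (q ^ N * (S k * S l))\<^sup>2"
      by (simp add: power2_eq_square mult_ac)
    finally show "?P \<le> q ^ N * (S k * S l)"
      using S0 by (intro power2_le_imp_le[of ?P]) auto
  qed auto
  also have "\<dots> = q ^ Suc N * (\<Sum>k<q. weight k * S k)\<^sup>2"
    unfolding square sum_distrib_left by (intro sum.cong refl) (simp add: mult_ac)
  also have "(\<Sum>k<q. weight k * S k) = (\<Sum>\<alpha>\<in>multi_indices q (Suc N). mweight (Suc N) \<alpha> * (cmod (c \<alpha>))\<^sup>2)"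
    unfolding multi_indices_def sum_PiE_Suc mweight_Suc_upd I
    unfolding S_def multi_indices_def I sum_distrib_left
    by (subst sum.swap) (simp add: mult_ac)
  finally show ?case by (simp only: of_nat_power)
qed

text \<open>Interpolation of the second moment between the first and the fourth: Cauchy-Schwarz
  bounds the second moment by the first and third, and again the third by the second and
  fourth.\<close>

lemma second_moment_power4_le:
  fixes f :: "'a \<Rightarrow> real"
  assumes "\<And>x. x \<in> A \<Longrightarrow> 0 \<le> f x"
  shows "(\<Sum>x\<in>A. (f x)\<^sup>2) ^ 4 \<le> (\<Sum>x\<in>A. f x)\<^sup>2 * ((\<Sum>x\<in>A. (f x)\<^sup>2) * (\<Sum>x\<in>A. f x ^ 4))"
proof -
  have "(\<Sum>x\<in>A. (f x)\<^sup>2) = (\<Sum>x\<in>A. sqrt (f x) * (sqrt (f x) * f x))"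
    using assms by (intro sum.cong) (auto simp: power2_eq_square simp flip: mult.assoc)
  then have "(\<Sum>x\<in>A. (f x)\<^sup>2)\<^sup>2 \<le> (\<Sum>x\<in>A. (sqrt (f x))\<^sup>2) * (\<Sum>x\<in>A. (sqrt (f x) * f x)\<^sup>2)"
    using Cauchy_Schwarz_ineq_sum by metis
  also have "\<dots> = (\<Sum>x\<in>A. f x) * (\<Sum>x\<in>A. f x * (f x)\<^sup>2)"
    using assms by (simp add: power_mult_distrib)
  finally have "((\<Sum>x\<in>A. (f x)\<^sup>2)\<^sup>2)\<^sup>2 \<le> ((\<Sum>x\<in>A. f x) * (\<Sum>x\<in>A. f x * (f x)\<^sup>2))\<^sup>2"
    by (intro power_mono) auto
  also have "\<dots> = (\<Sum>x\<in>A. f x)\<^sup>2 * (\<Sum>x\<in>A. f x * (f x)\<^sup>2)\<^sup>2"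
    by (rule power_mult_distrib)
  also have "\<dots> \<le> (\<Sum>x\<in>A. f x)\<^sup>2 * ((\<Sum>x\<in>A. (f x)\<^sup>2) * (\<Sum>x\<in>A. ((f x)\<^sup>2)\<^sup>2))"
    by (intro mult_left_mono Cauchy_Schwarz_ineq_sum) auto
  finally show ?thesis by (simp flip: power_mult)
qed

text \<open>The fourth moment is at most \<open>Q * (B * s)\<^sup>2\<close> by hypercontractivity.
  In the interpolation inequality this leaves a bound of the second moment by the first, after
  cancelling powers of \<open>s\<close>.\<close>

lemma L2_le_L1_poly_fun:
  assumes q: "q > 0" and \<Lambda>: "\<Lambda> \<subseteq> multi_indices q N" and B: "\<And>\<alpha>. \<alpha> \<in> \<Lambda> \<Longrightarrow> mweight N \<alpha> \<le> B" "0 \<le> B"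
  shows "L2_set (\<lambda>\<alpha>. cmod (a \<alpha>)) \<Lambda> \<le> B * ((\<Sum>x\<in>cyc q N. cmod (poly_fun q N \<Lambda> a x)) / q ^ N)"
proof -
  let ?f = "poly_fun q N \<Lambda> a"
  define Q :: real where "Q = q ^ N"
  have Q: "Q > 0" using q by (simp add: Q_def)
  define s where "s = (\<Sum>\<alpha>\<in>\<Lambda>. (cmod (a \<alpha>))\<^sup>2)"
  define t where "t = (\<Sum>x\<in>cyc q N. cmod (?f x))"
  have st: "s \<ge> 0" "t \<ge> 0" by (auto simp: s_def t_def intro!: sum_nonneg)
  \<comment> \<open>Extension by zero, since \<open>fourth_moment_le\<close> sums over all
    multi-indices.\<close>
  define c where "c \<alpha> = (if \<alpha> \<in> \<Lambda> then a \<alpha> else 0)" for \<alpha>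
  have f: "?f x = (\<Sum>\<alpha>\<in>multi_indices q N. c \<alpha> * character N \<alpha> x)" if "x \<in> cyc q N" for x
    using that \<Lambda> finite_multi_indices by (auto simp: poly_fun_def c_def intro!: sum.mono_neutral_cong_left)
  have "(\<Sum>x\<in>cyc q N. cmod (?f x) ^ 4) =
      (\<Sum>x\<in>cyc q N. cmod (\<Sum>\<alpha>\<in>multi_indices q N. c \<alpha> * character N \<alpha> x) ^ 4)"
    using f by simp
  also have "\<dots> \<le> Q * (\<Sum>\<alpha>\<in>multi_indices q N. mweight N \<alpha> * (cmod (c \<alpha>))\<^sup>2)\<^sup>2"
    unfolding Q_def using fourth_moment_le[OF q] by simp
  also have "(\<Sum>\<alpha>\<in>multi_indices q N. mweight N \<alpha> * (cmod (c \<alpha>))\<^sup>2) = (\<Sum>\<alpha>\<in>\<Lambda>. mweight N \<alpha> * (cmod (a \<alpha>))\<^sup>2)"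
    using \<Lambda> finite_multi_indices by (auto simp: c_def intro!: sum.mono_neutral_cong_right)
  also have "Q * \<dots>\<^sup>2 \<le> Q * (B * s)\<^sup>2"
    unfolding s_def sum_distrib_left using Q B
    by (intro mult_left_mono power_mono sum_mono sum_nonneg mult_right_mono)
       (auto simp: mweight_nonneg)
  finally have f4: "(\<Sum>x\<in>cyc q N. cmod (?f x) ^ 4) \<le> Q * (B * s)\<^sup>2" .
  have "(Q * s) ^ 4 \<le> t\<^sup>2 * ((Q * s) * (\<Sum>x\<in>cyc q N. cmod (?f x) ^ 4))"
    using second_moment_power4_le[of "cyc q N" "\<lambda>x. cmod (?f x)"] parseval_poly_fun[OF q \<Lambda>, of a]
    by (simp add: Q_def s_def t_def)
  also have "\<dots> \<le> t\<^sup>2 * ((Q * s) * (Q * (B * s)\<^sup>2))"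
    using f4 Q st by (intro mult_left_mono) auto
  \<comment> \<open>Arranged so that \<open>Q\<^sup>2 * s ^ 3\<close> can be cancelled; it is
    positive unless \<open>s = 0\<close>.\<close>
  finally have main: "(Q\<^sup>2 * s ^ 3) * (Q\<^sup>2 * s) \<le> (Q\<^sup>2 * s ^ 3) * (B * t)\<^sup>2"
    by (simp add: power2_eq_square power3_eq_cube power4_eq_xxxx mult_ac)
  have "Q\<^sup>2 * s \<le> (B * t)\<^sup>2"
  proof (cases "s = 0")
    case False
    then have "Q\<^sup>2 * s ^ 3 > 0" using Q st by simp
    then show ?thesis using main by (rule mult_left_le_imp_le[rotated])
  qed simp
  then have "sqrt (Q\<^sup>2 * s) \<le> B * t"
    using B st by (intro real_le_lsqrt) auto
  then have "sqrt s \<le> B * (t / Q)"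
    using Q by (simp add: real_sqrt_mult field_simps)
  then show ?thesis
    by (simp add: L2_set_def s_def t_def Q_def)
qed

text \<open>Coordinates off the support have weight 1. On the support the factors 10 count its
  elements and the exponents of \<open>sqrt 2\<close> add up to the degree.\<close>

lemma mweight_le:
  assumes "\<alpha> \<in> Lambda_le d q N" "mdeg N \<alpha> \<le> m"
  shows "mweight N \<alpha> \<le> 10 ^ d * sqrt 2 ^ m"
proof -
  have "mweight N \<alpha> = (\<Prod>j\<in>msupp N \<alpha>. 10 * sqrt 2 ^ \<alpha> j)"
    unfolding mweight_def
    by (rule prod.mono_neutral_cong_right) (auto simp: msupp_def weight_def)
  also have "\<dots> = 10 ^ card (msupp N \<alpha>) * sqrt 2 ^ (\<Sum>j\<in>msupp N \<alpha>. \<alpha> j)"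
    by (simp add: prod.distrib power_sum)
  also have "(\<Sum>j\<in>msupp N \<alpha>. \<alpha> j) = mdeg N \<alpha>"
    unfolding mdeg_def by (rule sum.mono_neutral_left) (auto simp: msupp_def)
  also have "10 ^ card (msupp N \<alpha>) * sqrt 2 ^ mdeg N \<alpha> \<le> 10 ^ d * sqrt 2 ^ m"
    using assms by (intro mult_mono power_increasing) (auto simp: Lambda_le_def)
  finally show ?thesis .
qed


section \<open>Operators from \<open>L\<^sub>1\<close> to a Hilbert space\<close>

text \<open>A bounded functional on \<open>L1\<close>, acting on representatives. The bound by the
  seminorm makes it well defined on classes, see \<open>diff_bound\<close>.\<close>

locale L1_functional =
  fixes M :: "'m measure" and D :: "('m \<Rightarrow> complex) \<Rightarrow> complex" and K :: real
  assumes add: "integrable M f \<Longrightarrow> integrable M g \<Longrightarrow> D (\<lambda>t. f t + g t) = D f + D g"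
    and scale: "integrable M f \<Longrightarrow> D (\<lambda>t. c * f t) = c * D f"
    and bound: "integrable M f \<Longrightarrow> cmod (D f) \<le> K * (LINT t|M. cmod (f t))"
begin

lemma sum_scale:
  assumes "finite I" "\<And>i. i \<in> I \<Longrightarrow> integrable M (f i)"
  shows "D (\<lambda>t. \<Sum>i\<in>I. c i * f i t) = (\<Sum>i\<in>I. c i * D (f i))"
  using assms
proof (induction I)
  case empty
  show ?case using scale[of "\<lambda>_. 0" 0] by simp
next
  case (insert i I)
  then show ?case by (simp add: add scale)
qed

lemma diff_bound:
  assumes "integrable M f" "integrable M g"
  shows "cmod (D f - D g) \<le> K * (LINT t|M. cmod (f t - g t))"
  using bound[of "\<lambda>t. f t + (-1) * g t"] add[of f "\<lambda>t. (-1) * g t"] scale[of g "-1"] assms by simp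

end

text \<open>The functions \<open>s k\<close> are jointly constant on finitely many disjoint sets.
  \<open>ind\<close> treats one such set with its vector of values; the triangle inequality adds up
  the contributions, and by disjointness their sum is exactly the integral of the pointwise
  Euclidean norm.\<close>

lemma sum_functionals_simple_le:
  fixes D :: "nat \<Rightarrow> ('m \<Rightarrow> complex) \<Rightarrow> complex"
  assumes D: "\<And>k. L1_functional M (D k) K"
    and ind: "\<And>A b. A \<in> sets M \<Longrightarrow> emeasure M A < \<infinity> \<Longrightarrow>
      cmod (\<Sum>k<n. b k * D k (\<lambda>t. of_real (indicator A t))) \<le> C * (measure M A * L2_set (\<lambda>k. cmod (b k)) {..<n})"
    and s: "\<And>k. Bochner_Integration.simple_bochner_integrable M (s k)"
  shows "cmod (\<Sum>k<n. D k (s k)) \<le> C * (LINT t|M. L2_set (\<lambda>k. cmod (s k t)) {..<n})"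
proof -
  \<comment> \<open>\<open>T\<close> records the \<open>n\<close> values at \<open>t\<close> as a
    single point, so its level sets refine those of all \<open>s k\<close>.\<close>
  define T where "T t = (\<lambda>k\<in>{..<n}. s k t)" for t
  \<comment> \<open>The zero vector is excluded because its level set may have infinite
    measure.\<close>
  define Y where "Y = {y \<in> T ` space M. \<exists>k<n. y k \<noteq> 0}"
  define A where "A y = {t \<in> space M. \<forall>k\<in>{..<n}. s k t = y k}" for y
  have sf: "simple_function M (s k)" and fin: "emeasure M {t \<in> space M. s k t \<noteq> 0} \<noteq> \<infinity>" for k
    using s[of k] by (auto elim: Bochner_Integration.simple_bochner_integrable.cases)
  have [measurable]: "s k \<in> borel_measurable M" for k
    by (rule borel_measurable_simple_function[OF sf])
  have int_s: "integrable M (s k)" for k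
    using has_bochner_integral_simple_bochner_integrable[OF s] by (rule integrable.intros)
  have "T ` space M \<subseteq> {..<n} \<rightarrow>\<^sub>E (\<Union>k<n. s k ` space M)"
    by (intro image_subsetI PiE_I) (auto simp: T_def)
  moreover have "finite ({..<n} \<rightarrow>\<^sub>E (\<Union>k<n. s k ` space M))"
    using simple_functionD(1)[OF sf] by (intro finite_PiE) auto
  ultimately have "finite (T ` space M)" by (rule finite_subset)
  then have finY: "finite Y" by (simp add: Y_def)
  have A_sets[measurable]: "A y \<in> sets M" for y
    unfolding A_def by measurable
  have A_fin: "emeasure M (A y) < \<infinity>" if y: "y \<in> Y" for y
  proof -
    obtain k where k: "k < n" "y k \<noteq> 0" using y by (auto simp: Y_def)
    have "emeasure M (A y) \<le> emeasure M {t \<in> space M. s k t \<noteq> 0}"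
      using k by (intro emeasure_mono) (auto simp: A_def)
    then show ?thesis using fin[of k] by (simp add: less_top top.not_eq_extremum le_less_trans)
  qed
  have mem_A: "t \<in> A y \<longleftrightarrow> y = T t" if "t \<in> space M" "y \<in> Y" for t y
    using that by (auto simp: A_def T_def Y_def fun_eq_iff restrict_def)
  \<comment> \<open>At \<open>t\<close> only the summand \<open>y = T t\<close> survives; if
    \<open>T t\<close> was excluded from \<open>Y\<close>, the sum is 0 and \<open>h\<close> has to
    vanish there as well.\<close>
  have rep: "(\<Sum>y\<in>Y. h y * indicator (A y) t) = h (T t)"
    if t: "t \<in> space M" and h: "T t \<notin> Y \<Longrightarrow> h (T t) = 0" for t and h :: "(nat \<Rightarrow> complex) \<Rightarrow> 'b::semiring_1"
  proof -
    have "(\<Sum>y\<in>Y. h y * indicator (A y) t) = (\<Sum>y\<in>Y. if y = T t then h y else 0)"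
      using mem_A[OF t] by (intro sum.cong) (auto simp: indicator_def)
    also have "\<dots> = h (T t)"
      using finY h by (simp add: sum.delta)
    finally show ?thesis .
  qed
  have T_notin: "s k t = 0" if "t \<in> space M" "T t \<notin> Y" "k < n" for t k
    using that by (auto simp: Y_def T_def)
  define \<iota> where "\<iota> y t = complex_of_real (indicator (A y) t)" for y t
  have int_\<iota>: "integrable M (\<iota> y)" if "y \<in> Y" for y
    unfolding \<iota>_def using A_fin[OF that] by (intro integrable_of_real integrable_real_indicator) auto
  have Ds: "D k (s k) = (\<Sum>y\<in>Y. y k * D k (\<iota> y))" if k: "k < n" for k
  proof -
    interpret L1_functional M "D k" K by (rule D)
    have eq: "s k t = (\<Sum>y\<in>Y. y k * \<iota> y t)" if t: "t \<in> space M" for t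
      using rep[OF t, of "\<lambda>y. y k"] T_notin[OF t _ k] k by (simp add: \<iota>_def of_real_indicator T_def)
    have int: "integrable M (\<lambda>t. \<Sum>y\<in>Y. y k * \<iota> y t)"
      using int_\<iota> by (intro Bochner_Integration.integrable_sum integrable_mult_right) auto
    \<comment> \<open>The two functions are only known to agree on \<open>space M\<close>; their
      distance is still zero, so \<open>D k\<close> takes the same value on both.\<close>
    have "(LINT t|M. cmod (s k t - (\<Sum>y\<in>Y. y k * \<iota> y t))) = (LINT t|M. 0)"
      using eq by (intro Bochner_Integration.integral_cong) auto
    then have "D k (s k) = D k (\<lambda>t. \<Sum>y\<in>Y. y k * \<iota> y t)"
      using diff_bound[OF int_s[of k] int] by simp
    also have "\<dots> = (\<Sum>y\<in>Y. y k * D k (\<iota> y))"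
      by (rule sum_scale[OF finY int_\<iota>])
    finally show ?thesis .
  qed
  have "(\<Sum>k<n. D k (s k)) = (\<Sum>y\<in>Y. \<Sum>k<n. y k * D k (\<iota> y))"
    by (subst sum.swap, intro sum.cong refl Ds) simp
  then have "cmod (\<Sum>k<n. D k (s k)) \<le> (\<Sum>y\<in>Y. cmod (\<Sum>k<n. y k * D k (\<iota> y)))"
    by (simp add: norm_sum)
  also have "\<dots> \<le> (\<Sum>y\<in>Y. C * (measure M (A y) * L2_set (\<lambda>k. cmod (y k)) {..<n}))"
    unfolding \<iota>_def by (intro sum_mono ind A_fin A_sets)
  also have "\<dots> = C * (LINT t|M. (\<Sum>y\<in>Y. L2_set (\<lambda>k. cmod (y k)) {..<n} * indicator (A y) t))"
    using A_fin by (subst Bochner_Integration.integral_sum)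
      (auto simp: sum_distrib_left mult.commute intro!: integrable_mult_right integrable_real_indicator)
  also have "(LINT t|M. (\<Sum>y\<in>Y. L2_set (\<lambda>k. cmod (y k)) {..<n} * indicator (A y) t))
     = (LINT t|M. L2_set (\<lambda>k. cmod (s k t)) {..<n})"
  proof (intro Bochner_Integration.integral_cong refl)
    fix t assume t: "t \<in> space M"
    have "L2_set (\<lambda>k. cmod (T t k)) {..<n} = L2_set (\<lambda>k. cmod (s k t)) {..<n}"
      by (intro L2_set_cong) (auto simp: T_def)
    moreover have "L2_set (\<lambda>k. cmod (s k t)) {..<n} = 0" if "T t \<notin> Y"
      using T_notin[OF t that] by (intro L2_set_0') auto
    ultimately show "(\<Sum>y\<in>Y. L2_set (\<lambda>k. cmod (y k)) {..<n} * indicator (A y) t) = L2_set (\<lambda>k. cmod (s k t)) {..<n}"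
      using rep[OF t, of "\<lambda>y. L2_set (\<lambda>k. cmod (y k)) {..<n}"] by simp
  qed
  finally show ?thesis .
qed

text \<open>Bochner integrability is defined through such approximations, so they are read off from
  the definition.\<close>

lemma ex_simple_L1_approx:
  fixes g :: "'m \<Rightarrow> complex"
  assumes g: "integrable M g" and e: "e > 0"
  obtains s where "Bochner_Integration.simple_bochner_integrable M s" "(LINT t|M. cmod (g t - s t)) < e"
proof -
  obtain x where "has_bochner_integral M g x" using g by (auto elim: integrable.cases)
  then obtain s where s: "\<And>i. Bochner_Integration.simple_bochner_integrable M (s i)"
    and lim: "(\<lambda>i. \<integral>\<^sup>+t. norm (g t - s i t) \<partial>M) \<longlonglongrightarrow> 0"
    by (cases rule: has_bochner_integral.cases) auto
  have "eventually (\<lambda>i. (\<integral>\<^sup>+t. norm (g t - s i t) \<partial>M) < ennreal e) sequentially"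
    by (rule order_tendstoD[OF lim]) (use e in simp)
  then obtain i where i: "(\<integral>\<^sup>+t. norm (g t - s i t) \<partial>M) < ennreal e"
    by (auto simp: eventually_sequentially)
  have "integrable M (s i)"
    using has_bochner_integral_simple_bochner_integrable[OF s] by (rule integrable.intros)
  then have "integrable M (\<lambda>t. cmod (g t - s i t))" using g by simp
  from nn_integral_eq_integral[OF this] i have "ennreal (LINT t|M. cmod (g t - s i t)) < ennreal e"
    by simp
  then have "(LINT t|M. cmod (g t - s i t)) < e"
    using e by (simp add: ennreal_less_iff)
  with s show thesis using that by blast
qed

lemma integrable_L2_set:
  fixes g :: "nat \<Rightarrow> 'm \<Rightarrow> complex"
  assumes "\<And>k. integrable M (g k)"
  shows "integrable M (\<lambda>t. L2_set (\<lambda>k. cmod (g k t)) {..<n})"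
proof (rule Bochner_Integration.integrable_bound[where f="\<lambda>t. \<Sum>k<n. cmod (g k t)"])
  have [measurable]: "g k \<in> borel_measurable M" for k using assms by auto
  show "(\<lambda>t. L2_set (\<lambda>k. cmod (g k t)) {..<n}) \<in> borel_measurable M"
    unfolding L2_set_def by measurable
  have "L2_set (\<lambda>k. cmod (g k t)) {..<n} \<le> (\<Sum>k<n. cmod (g k t))" for t
    by (intro L2_set_le_sum) auto
  then show "AE t in M. norm (L2_set (\<lambda>k. cmod (g k t)) {..<n}) \<le> norm (\<Sum>k<n. cmod (g k t))"
    by (auto simp: sum_nonneg)
qed (use assms in auto)

text \<open>Both sides are continuous in the \<open>L1\<close> distance, so the estimate passes from
  simple functions to all integrable ones.\<close>

lemma sum_functionals_le:
  fixes D :: "nat \<Rightarrow> ('m \<Rightarrow> complex) \<Rightarrow> complex"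
  assumes D: "\<And>k. L1_functional M (D k) K" and K: "0 \<le> K" and C: "0 \<le> C"
    and ind: "\<And>A b. A \<in> sets M \<Longrightarrow> emeasure M A < \<infinity> \<Longrightarrow>
      cmod (\<Sum>k<n. b k * D k (\<lambda>t. of_real (indicator A t))) \<le> C * (measure M A * L2_set (\<lambda>k. cmod (b k)) {..<n})"
    and g: "\<And>k. integrable M (g k)"
  shows "cmod (\<Sum>k<n. D k (g k)) \<le> C * (LINT t|M. L2_set (\<lambda>k. cmod (g k t)) {..<n})"
proof (rule field_le_epsilon)
  fix e :: real assume "e > 0"
  \<comment> \<open>Replacing each \<open>g k\<close> by a simple function costs at most
    \<open>K * n * \<delta>\<close> on the left and \<open>C * n * \<delta>\<close> on the right;
    the \<open>+ 1\<close> keeps the denominator positive.\<close>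
  define \<delta> where "\<delta> = e / ((K + C) * n + 1)"
  have KC: "0 \<le> (K + C) * n" using K C by simp
  then have \<delta>: "\<delta> > 0" using \<open>e > 0\<close> by (simp add: \<delta>_def)
  have "\<exists>s. Bochner_Integration.simple_bochner_integrable M s \<and> (LINT t|M. cmod (g k t - s t)) < \<delta>" for k
    using ex_simple_L1_approx[OF g \<delta>] by metis
  then obtain s where s: "\<And>k. Bochner_Integration.simple_bochner_integrable M (s k)"
    and close: "\<And>k. (LINT t|M. cmod (g k t - s k t)) < \<delta>" by metis
  have int_s: "integrable M (s k)" for k
    using has_bochner_integral_simple_bochner_integrable[OF s] by (rule integrable.intros)
  have "cmod ((\<Sum>k<n. D k (g k)) - (\<Sum>k<n. D k (s k))) \<le> (\<Sum>k<n. cmod (D k (g k) - D k (s k)))"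
    unfolding sum_subtractf[symmetric] by (rule norm_sum)
  also have "\<dots> \<le> (\<Sum>k<n. K * \<delta>)"
  proof (rule sum_mono)
    fix k
    interpret L1_functional M "D k" K by (rule D)
    show "cmod (D k (g k) - D k (s k)) \<le> K * \<delta>"
      using diff_bound[OF g int_s] close K by (meson less_imp_le mult_left_mono order_trans)
  qed
  finally have 1: "cmod ((\<Sum>k<n. D k (g k)) - (\<Sum>k<n. D k (s k))) \<le> n * (K * \<delta>)" by simp
  have "(LINT t|M. L2_set (\<lambda>k. cmod (s k t)) {..<n}) \<le>
      (LINT t|M. L2_set (\<lambda>k. cmod (g k t)) {..<n} + (\<Sum>k<n. cmod (g k t - s k t)))"
  proof (rule integral_mono)
    fix t
    have "L2_set (\<lambda>k. cmod (s k t)) {..<n} \<le> L2_set (\<lambda>k. cmod (g k t) + cmod (g k t - s k t)) {..<n}"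
      by (intro L2_set_mono norm_ge_zero) (metis norm_minus_commute norm_triangle_sub)
    also have "\<dots> \<le> L2_set (\<lambda>k. cmod (g k t)) {..<n} + L2_set (\<lambda>k. cmod (g k t - s k t)) {..<n}"
      by (rule L2_set_triangle_ineq)
    also have "L2_set (\<lambda>k. cmod (g k t - s k t)) {..<n} \<le> (\<Sum>k<n. cmod (g k t - s k t))"
      by (intro L2_set_le_sum) auto
    finally show "L2_set (\<lambda>k. cmod (s k t)) {..<n} \<le> L2_set (\<lambda>k. cmod (g k t)) {..<n} + (\<Sum>k<n. cmod (g k t - s k t))"
      by simp
  qed (use g int_s in \<open>auto intro!: integrable_L2_set Bochner_Integration.integrable_add Bochner_Integration.integrable_sum\<close>)
  also have "\<dots> = (LINT t|M. L2_set (\<lambda>k. cmod (g k t)) {..<n}) + (\<Sum>k<n. LINT t|M. cmod (g k t - s k t))"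
    using g int_s by (subst Bochner_Integration.integral_add) (auto intro!: integrable_L2_set)
  also have "(\<Sum>k<n. LINT t|M. cmod (g k t - s k t)) \<le> (\<Sum>k<n. \<delta>)"
    using close by (intro sum_mono less_imp_le)
  finally have 2: "(LINT t|M. L2_set (\<lambda>k. cmod (s k t)) {..<n}) \<le> (LINT t|M. L2_set (\<lambda>k. cmod (g k t)) {..<n}) + n * \<delta>"
    by simp
  have "cmod (\<Sum>k<n. D k (g k)) \<le> cmod (\<Sum>k<n. D k (s k)) + n * (K * \<delta>)"
    using 1 norm_triangle_sub[of "\<Sum>k<n. D k (g k)" "\<Sum>k<n. D k (s k)"] by linarith
  also have "\<dots> \<le> C * (LINT t|M. L2_set (\<lambda>k. cmod (s k t)) {..<n}) + n * (K * \<delta>)"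
    using sum_functionals_simple_le[of M D K n C s, OF D ind s] by simp
  also have "\<dots> \<le> C * ((LINT t|M. L2_set (\<lambda>k. cmod (g k t)) {..<n}) + n * \<delta>) + n * (K * \<delta>)"
    using 2 C by (intro add_right_mono mult_left_mono)
  also have "\<dots> = C * (LINT t|M. L2_set (\<lambda>k. cmod (g k t)) {..<n}) + ((K + C) * n) * \<delta>"
    by (simp add: algebra_simps)
  also have "((K + C) * n) * \<delta> \<le> e"
    using KC \<open>e > 0\<close> by (simp add: \<delta>_def field_simps)
  finally show "cmod (\<Sum>k<n. D k (g k)) \<le> C * (LINT t|M. L2_set (\<lambda>k. cmod (g k t)) {..<n}) + e"
    by simp
qed


section \<open>The Sidon constant and the Gordon--Lewis constant\<close>

lemma sup_norm_ge:
  assumes "q > 0" "x \<in> cyc q N" shows "cmod (f x) \<le> sup_norm q N f"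
  unfolding sup_norm_def using assms by (intro cSUP_upper bdd_above_finite) (auto simp: finite_cyc)

lemma sup_norm_le:
  assumes "q > 0" "\<And>x. x \<in> cyc q N \<Longrightarrow> cmod (f x) \<le> K" shows "sup_norm q N f \<le> K"
  unfolding sup_norm_def using assms by (intro cSUP_least) (auto simp: cyc_nonempty)

lemma sup_norm_nonneg:
  assumes q: "q > 0" shows "0 \<le> sup_norm q N f"
proof -
  obtain x where "x \<in> cyc q N" using cyc_nonempty[OF q] by blast
  from sup_norm_ge[OF q this, of f] show ?thesis by (rule order_trans[OF norm_ge_zero])
qed

lemma poly_space_mem_iff: "f \<in> vecs (poly_space q N \<Lambda>) \<longleftrightarrow> (\<exists>a. f = poly_fun q N \<Lambda> a)"
  and poly_space_nrm: "nrm (poly_space q N \<Lambda>) = sup_norm q N"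
  by (auto simp: poly_space_def)

lemma poly_fun_mem [simp]: "poly_fun q N \<Lambda> a \<in> vecs (poly_space q N \<Lambda>)"
  by (auto simp: poly_space_mem_iff)

lemma poly_fun_add: "poly_fun q N \<Lambda> (\<lambda>\<alpha>. a \<alpha> + b \<alpha>) = (\<lambda>t. poly_fun q N \<Lambda> a t + poly_fun q N \<Lambda> b t)"
  by (auto simp: poly_fun_def fun_eq_iff sum.distrib distrib_right)

lemma poly_fun_scale: "poly_fun q N \<Lambda> (\<lambda>\<alpha>. c * a \<alpha>) = (\<lambda>t. c * poly_fun q N \<Lambda> a t)"
  by (auto simp: poly_fun_def fun_eq_iff sum_distrib_left mult.assoc)

lemma poly_fun_off_cyc: "x \<notin> cyc q N \<Longrightarrow> poly_fun q N \<Lambda> a x = 0"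
  by (simp add: poly_fun_def)

lemma seminormed_poly_space:
  assumes q: "q > 0" shows "seminormed (poly_space q N \<Lambda>)"
proof
  show "(\<lambda>_. 0) \<in> vecs (poly_space q N \<Lambda>)"
    unfolding poly_space_mem_iff by (rule exI[of _ "\<lambda>_. 0"]) (auto simp: poly_fun_def)
  fix f assume f: "f \<in> vecs (poly_space q N \<Lambda>)"
  then obtain a where a: "f = poly_fun q N \<Lambda> a" by (auto simp: poly_space_mem_iff)
  { fix g assume "g \<in> vecs (poly_space q N \<Lambda>)"
    then obtain b where "g = poly_fun q N \<Lambda> b" by (auto simp: poly_space_mem_iff)
    with a show "(\<lambda>t. f t + g t) \<in> vecs (poly_space q N \<Lambda>)"
      by (simp flip: poly_fun_add)
    show "nrm (poly_space q N \<Lambda>) (\<lambda>t. f t + g t) \<le> nrm (poly_space q N \<Lambda>) f + nrm (poly_space q N \<Lambda>) g"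
      unfolding poly_space_nrm
      by (intro sup_norm_le q norm_triangle_le add_mono sup_norm_ge) }
  fix c
  show "(\<lambda>t. c * f t) \<in> vecs (poly_space q N \<Lambda>)"
    by (simp add: a flip: poly_fun_scale)
  show "nrm (poly_space q N \<Lambda>) (\<lambda>t. c * f t) = cmod c * nrm (poly_space q N \<Lambda>) f"
    unfolding poly_space_nrm
  proof (rule antisym)
    show "sup_norm q N (\<lambda>t. c * f t) \<le> cmod c * sup_norm q N f"
      by (rule sup_norm_le) (auto simp: q norm_mult intro!: mult_left_mono sup_norm_ge)
    show "cmod c * sup_norm q N f \<le> sup_norm q N (\<lambda>t. c * f t)"
    proof (cases "c = 0")
      case True
      then show ?thesis using sup_norm_nonneg[OF q] by simp
    next
      case False
      have "sup_norm q N f \<le> sup_norm q N (\<lambda>t. c * f t) / cmod c"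
        using sup_norm_ge[OF q, of _ N "\<lambda>t. c * f t"] False
        by (intro sup_norm_le q) (auto simp: norm_mult field_simps)
      then show ?thesis using False by (simp add: field_simps)
    qed
  qed
qed

lemma fourier_coeff_add: "fourier_coeff q N (\<lambda>t. f t + g t) \<alpha> = fourier_coeff q N f \<alpha> + fourier_coeff q N g \<alpha>"
  by (simp add: fourier_coeff_def distrib_right sum.distrib add_divide_distrib)

lemma fourier_coeff_scale: "fourier_coeff q N (\<lambda>t. c * f t) \<alpha> = c * fourier_coeff q N f \<alpha>"
  by (simp add: fourier_coeff_def sum_distrib_left mult.assoc)

definition char_fun :: "nat \<Rightarrow> nat \<Rightarrow> (nat \<Rightarrow> nat) \<Rightarrow> (nat \<Rightarrow> complex) \<Rightarrow> complex" where
  "char_fun q N \<alpha> = (\<lambda>x. if x \<in> cyc q N then character N \<alpha> x else 0)"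

lemma poly_fun_eq_sum: "poly_fun q N \<Lambda> a = (\<lambda>x. \<Sum>\<alpha>\<in>\<Lambda>. a \<alpha> * char_fun q N \<alpha> x)"
  by (auto simp: poly_fun_def char_fun_def)

lemma char_fun_eq_poly_fun:
  assumes "finite \<Lambda>" "\<alpha> \<in> \<Lambda>"
  shows "char_fun q N \<alpha> = poly_fun q N \<Lambda> (\<lambda>\<beta>. if \<beta> = \<alpha> then 1 else 0)"
proof -
  have "(\<Sum>\<beta>\<in>\<Lambda>. (if \<beta> = \<alpha> then 1 else 0) * char_fun q N \<beta> x) = (\<Sum>\<beta>\<in>\<Lambda>. if \<beta> = \<alpha> then char_fun q N \<beta> x else 0)" for x
    by (intro sum.cong) auto
  then show ?thesis using assms by (simp add: poly_fun_eq_sum sum.delta)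
qed

text \<open>The group operation. The restriction makes the product extensional on
  \<open>{..<N}\<close>, as membership in \<open>cyc\<close> requires.\<close>

definition cyc_mult :: "nat \<Rightarrow> (nat \<Rightarrow> complex) \<Rightarrow> (nat \<Rightarrow> complex) \<Rightarrow> nat \<Rightarrow> complex" where
  "cyc_mult N x y = (\<lambda>j\<in>{..<N}. x j * y j)"

lemma cyc_mult_mem:
  assumes "x \<in> cyc q N" "y \<in> cyc q N" shows "cyc_mult N x y \<in> cyc q N"
  unfolding cyc_def
proof (rule PiE_I)
  fix j assume j: "j \<in> {..<N}"
  then have "x j ^ q = 1" "y j ^ q = 1"
    using assms by (auto simp only: cyc_def dest: PiE_mem)
  then show "cyc_mult N x y j \<in> {z. z ^ q = 1}"
    using j by (simp add: cyc_mult_def power_mult_distrib)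
qed (simp add: cyc_mult_def)

lemma character_cyc_mult: "character N \<alpha> (cyc_mult N x y) = character N \<alpha> x * character N \<alpha> y"
  by (simp add: character_def cyc_mult_def power_mult_distrib prod.distrib)

text \<open>Multiplying the coefficients by \<open>character N \<alpha> x\<close> is translation by
  \<open>x\<close>, which maps the group into itself.\<close>

lemma sup_norm_translate_le:
  assumes q: "q > 0" and x: "x \<in> cyc q N"
  shows "sup_norm q N (poly_fun q N \<Lambda> (\<lambda>\<alpha>. a \<alpha> * character N \<alpha> x)) \<le> sup_norm q N (poly_fun q N \<Lambda> a)"
proof (rule sup_norm_le[OF q])
  fix y assume y: "y \<in> cyc q N"
  have "poly_fun q N \<Lambda> (\<lambda>\<alpha>. a \<alpha> * character N \<alpha> x) y = poly_fun q N \<Lambda> a (cyc_mult N x y)"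
    using cyc_mult_mem[OF x y] y by (simp add: poly_fun_def character_cyc_mult mult.assoc)
  then show "cmod (poly_fun q N \<Lambda> (\<lambda>\<alpha>. a \<alpha> * character N \<alpha> x) y) \<le> sup_norm q N (poly_fun q N \<Lambda> a)"
    using sup_norm_ge[OF q cyc_mult_mem[OF x y]] by metis
qed

section \<open>The summing norm of the coefficient operator and the trace estimate\<close>

lemma evaluation_in_unit_ball_dual:
  assumes q: "q > 0" and x: "x \<in> cyc q N"
  shows "(\<lambda>f. if f \<in> vecs (poly_space q N \<Lambda>) then f x else 0) \<in> unit_ball (dual (poly_space q N \<Lambda>))"
proof -
  interpret seminormed "poly_space q N \<Lambda>" by (rule seminormed_poly_space[OF q])
  let ?\<phi> = "\<lambda>f. if f \<in> vecs (poly_space q N \<Lambda>) then f x else 0"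
  have "cmod (?\<phi> f) \<le> 1 * nrm (poly_space q N \<Lambda>) f" if "f \<in> vecs (poly_space q N \<Lambda>)" for f
    using that sup_norm_ge[OF q x, of f] by (simp add: poly_space_nrm)
  moreover from this have "?\<phi> \<in> vecs (dual (poly_space q N \<Lambda>))"
    by (rule dual_memI[rotated 3]) (simp_all add: add_mem scale_mem)
  ultimately show ?thesis
    unfolding unit_ball_def using dual_nrm_least[of 1 ?\<phi>] by simp
qed


text \<open>The easy direction of Pietsch domination, with the uniform probability measure on the
  group: the average of the sums is at most their maximum, and evaluation at a maximising point is a
  functional in the dual unit ball.\<close>

lemma pi1_le_if_average_bound:
  assumes q: "q > 0" and B: "0 \<le> B"
    and bound: "\<And>f. f \<in> vecs (poly_space q N \<Lambda>) \<Longrightarrow> nrm Y (u f) \<le> B * ((\<Sum>x\<in>cyc q N. cmod (f x)) / q ^ N)"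
  shows "pi1 (poly_space q N \<Lambda>) Y u \<le> ennreal B"
  unfolding pi1_def
proof (intro Inf_lower CollectI exI[of _ B] conjI allI impI refl B)
  let ?X = "poly_space q N \<Lambda>"
  fix n :: nat and f assume f: "\<forall>j<n. f j \<in> vecs ?X"
  define S where "S = Max ((\<lambda>x. \<Sum>j<n. cmod (f j x)) ` cyc q N)"
  have fin: "finite (cyc q N)" "cyc q N \<noteq> {}" using q by (auto simp: finite_cyc cyc_nonempty)
  have "(\<Sum>j<n. nrm Y (u (f j))) \<le> (\<Sum>j<n. B * ((\<Sum>x\<in>cyc q N. cmod (f j x)) / q ^ N))"
    using f bound by (intro sum_mono) auto
  also have "\<dots> = B * ((\<Sum>x\<in>cyc q N. \<Sum>j<n. cmod (f j x)) / q ^ N)"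
    by (subst sum.swap) (simp add: sum_distrib_left sum_divide_distrib)
  also have "\<dots> \<le> B * ((\<Sum>x\<in>cyc q N. S) / q ^ N)"
    using fin B unfolding S_def by (intro mult_left_mono divide_right_mono sum_mono Max_ge) auto
  also have "\<dots> = B * S" using q by (simp add: card_cyc)
  finally have "ennreal (\<Sum>j<n. nrm Y (u (f j))) \<le> ennreal B * ennreal S"
    using B by (simp add: ennreal_mult'[symmetric] ennreal_leI)
  also have "ennreal S \<le> (SUP \<phi>\<in>unit_ball (dual ?X). ennreal (\<Sum>j<n. cmod (\<phi> (f j))))"
  proof -
    have "S \<in> (\<lambda>x. \<Sum>j<n. cmod (f j x)) ` cyc q N"
      unfolding S_def using fin by (intro Max_in) auto
    then obtain x where x: "x \<in> cyc q N" "S = (\<Sum>j<n. cmod (f j x))" by blast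
    define \<phi> where "\<phi> = (\<lambda>f. if f \<in> vecs ?X then f x else 0)"
    have "\<phi> (f j) = f j x" if "j < n" for j
      using f that by (simp add: \<phi>_def)
    then have S: "ennreal S \<le> ennreal (\<Sum>j<n. cmod (\<phi> (f j)))"
      by (simp add: x(2))
    have "\<phi> \<in> unit_ball (dual ?X)"
      unfolding \<phi>_def by (rule evaluation_in_unit_ball_dual[OF q x(1)])
    then have "ennreal (\<Sum>j<n. cmod (\<phi> (f j))) \<le> (SUP \<phi>\<in>unit_ball (dual ?X). ennreal (\<Sum>j<n. cmod (\<phi> (f j))))"
      by (rule SUP_upper)
    with S show ?thesis by (rule order_trans)
  qed
  finally show "ennreal (\<Sum>j<n. nrm Y (u (f j))) \<le> ennreal B * (SUP \<phi>\<in>unit_ball (dual ?X). ennreal (\<Sum>j<n. cmod (\<phi> (f j))))"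
    by (simp add: mult_left_mono)
qed

text \<open>For fixed \<open>t\<close> the numbers \<open>g \<alpha> t\<close> are the coefficients
  of a polynomial in \<open>x\<close>, to which the norm comparison applies.\<close>

lemma integral_L2_le_L1_poly_fun:
  fixes g :: "(nat \<Rightarrow> nat) \<Rightarrow> 'm \<Rightarrow> complex"
  assumes q: "q > 0" and \<Lambda>: "\<Lambda> \<subseteq> multi_indices q N"
    and B: "\<And>\<alpha>. \<alpha> \<in> \<Lambda> \<Longrightarrow> mweight N \<alpha> \<le> B" "0 \<le> B"
    and e: "bij_betw e {..<n::nat} \<Lambda>"
    and g: "\<And>\<alpha>. integrable M (g \<alpha>)"
  shows "(LINT t|M. L2_set (\<lambda>k. cmod (g (e k) t)) {..<n})
    \<le> B * ((\<Sum>x\<in>cyc q N. LINT t|M. cmod (\<Sum>\<alpha>\<in>\<Lambda>. character N \<alpha> x * g \<alpha> t)) / q ^ N)"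
proof -
  have int: "integrable M (\<lambda>t. cmod (\<Sum>\<alpha>\<in>\<Lambda>. character N \<alpha> x * g \<alpha> t))" for x
    using g by (intro integrable_norm Bochner_Integration.integrable_sum integrable_mult_right)
  have "(LINT t|M. L2_set (\<lambda>k. cmod (g (e k) t)) {..<n})
      \<le> (LINT t|M. B * ((\<Sum>x\<in>cyc q N. cmod (\<Sum>\<alpha>\<in>\<Lambda>. character N \<alpha> x * g \<alpha> t)) / q ^ N))"
  proof (rule integral_mono)
    fix t
    have "L2_set (\<lambda>k. cmod (g (e k) t)) {..<n} = L2_set (\<lambda>\<alpha>. cmod (g \<alpha> t)) \<Lambda>"
      unfolding L2_set_def by (simp add: sum.reindex_bij_betw[OF e, of "\<lambda>\<alpha>. (cmod (g \<alpha> t))\<^sup>2"])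
    also have "\<dots> \<le> B * ((\<Sum>x\<in>cyc q N. cmod (poly_fun q N \<Lambda> (\<lambda>\<alpha>. g \<alpha> t) x)) / q ^ N)"
      by (rule L2_le_L1_poly_fun[OF q \<Lambda> B])
    also have "\<dots> = B * ((\<Sum>x\<in>cyc q N. cmod (\<Sum>\<alpha>\<in>\<Lambda>. character N \<alpha> x * g \<alpha> t)) / q ^ N)"
      by (simp add: poly_fun_def mult.commute)
    finally show "L2_set (\<lambda>k. cmod (g (e k) t)) {..<n} \<le> \<dots>" .
  qed (use g int integrable_L2_set[of M "\<lambda>k. g (e k)"] in auto)
  also have "\<dots> = B * ((\<Sum>x\<in>cyc q N. LINT t|M. cmod (\<Sum>\<alpha>\<in>\<Lambda>. character N \<alpha> x * g \<alpha> t)) / q ^ N)"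
    using int by (subst Bochner_Integration.integral_sum[symmetric]) auto
  finally show ?thesis .
qed

text \<open>The coordinates of \<open>w\<close> are scalar functionals on \<open>L1\<close>. On an
  indicator, their combination with coefficients \<open>b\<close> is \<open>w\<close> evaluated at
  the functional of \<open>b\<close>, so the operator norm of \<open>w\<close> supplies the constant
  in \<open>sum_functionals_le\<close>.\<close>

lemma sum_bidual_functionals_le:
  assumes w: "bounded_op (L1 M) (dual (dual ell2)) w" and g: "\<And>k. integrable M (g k)"
  shows "cmod (\<Sum>k<n. w (g k) (ell2_functional n (\<lambda>i. if i = k then 1 else 0)))
    \<le> op_norm (L1 M) (dual (dual ell2)) w * (LINT t|M. L2_set (\<lambda>k. cmod (g k t)) {..<n})"
proof -
  interpret D: seminormed "dual ell2" by (rule seminormed.seminormed_dual[OF seminormed_ell2])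
  interpret DD: seminormed "dual (dual ell2)" by (rule D.seminormed_dual)
  interpret w: bounded_operator "L1 M" "dual (dual ell2)" w
    using w by (intro bounded_operator.intro seminormed_L1 DD.seminormed_axioms bounded_operator_axioms.intro)
  let ?\<psi> = "\<lambda>k. ell2_functional n (\<lambda>i. if i = k then 1 else (0::complex))"
  let ?W = "op_norm (L1 M) (dual (dual ell2)) w"
  have mem: "f \<in> vecs (L1 M) \<longleftrightarrow> integrable M f" for f by (simp add: L1_def)
  have nrm: "nrm (L1 M) f = (LINT t|M. cmod (f t))" for f by (simp add: L1_def)
  have eqI: "\<Phi> (ell2_functional n b) = \<Psi> (ell2_functional n b)"
    if "\<Phi> \<in> vecs (dual (dual ell2))" "\<Psi> \<in> vecs (dual (dual ell2))" "same_in (dual (dual ell2)) \<Phi> \<Psi>" for \<Phi> \<Psi> b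
    using seminormed.bidual_apply_eq_if_same_in[OF seminormed_ell2 that ell2_functional_mem] .
  have apply_le: "cmod (w f (ell2_functional n b)) \<le> ?W * (LINT t|M. cmod (f t)) * L2_set (\<lambda>k. cmod (b k)) {..<n}"
    if f: "integrable M f" for f b
  proof -
    have f': "f \<in> vecs (L1 M)" using f by (simp add: mem)
    have "cmod (w f (ell2_functional n b)) \<le> nrm (dual (dual ell2)) (w f) * nrm (dual ell2) (ell2_functional n b)"
      by (rule D.dual_apply_le[OF w.mem[OF f'] ell2_functional_mem])
    also have "\<dots> \<le> (?W * nrm (L1 M) f) * L2_set (\<lambda>k. cmod (b k)) {..<n}"
      using w.nrm_le[OF f'] w.op_norm_nonneg w.X.nrm_nonneg[OF f'] D.nrm_nonneg[OF ell2_functional_mem]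
      by (intro mult_mono ell2_functional_nrm_le) auto
    finally show ?thesis by (simp add: nrm)
  qed
  have unit: "L2_set (\<lambda>i. cmod (if i = k then 1 else 0)) {..<n} \<le> 1" for k
  proof -
    have "L2_set (\<lambda>i. cmod (if i = k then 1 else 0)) {..<n} \<le> (\<Sum>i<n. cmod (if i = k then 1 else 0))"
      by (intro L2_set_le_sum) auto
    also have "\<dots> = (\<Sum>i<n. if i = k then 1 else 0)" by (intro sum.cong) auto
    also have "\<dots> \<le> (1::real)" by (simp add: sum.delta)
    finally show ?thesis .
  qed
  show ?thesis
  proof (rule sum_functionals_le[where D="\<lambda>k f. w f (?\<psi> k)" and K="?W"])
    fix k
    show "L1_functional M (\<lambda>f. w f (?\<psi> k)) ?W"
    proof
      fix f g :: "_ \<Rightarrow> complex" assume fg: "integrable M f" "integrable M g"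
      then show "w (\<lambda>t. f t + g t) (?\<psi> k) = w f (?\<psi> k) + w g (?\<psi> k)"
        using eqI[OF _ _ w.add[of f g]] w.mem DD.add_mem by (simp add: mem)
    next
      fix f :: "_ \<Rightarrow> complex" and c assume f: "integrable M f"
      then show "w (\<lambda>t. c * f t) (?\<psi> k) = c * w f (?\<psi> k)"
        using eqI[OF _ _ w.scale[of f c]] w.mem DD.scale_mem by (simp add: mem)
      have "cmod (w f (?\<psi> k)) \<le> ?W * (LINT t|M. cmod (f t)) * L2_set (\<lambda>i. cmod (if i = k then 1 else 0)) {..<n}"
        by (rule apply_le[OF f])
      also have "\<dots> \<le> ?W * (LINT t|M. cmod (f t)) * 1"
        using w.op_norm_nonneg by (intro mult_left_mono unit) auto
      finally show "cmod (w f (?\<psi> k)) \<le> ?W * (LINT t|M. cmod (f t))" by simp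
    qed
  next
    fix A b assume A: "A \<in> sets M" "emeasure M A < \<infinity>"
    let ?f = "\<lambda>t. complex_of_real (indicator A t)"
    have f: "integrable M ?f" using A by (intro integrable_of_real integrable_real_indicator)
    have "(\<Sum>k<n. b k * w ?f (?\<psi> k)) = w ?f (ell2_functional n b)"
    proof -
      have wf: "w ?f \<in> vecs (dual (dual ell2))" using w.mem f by (simp add: mem)
      \<comment> \<open>The expansion into coordinate functionals must hold as an equality of
        functions, hence also off the carrier, where both sides are 0.\<close>
      have "ell2_functional n b = (\<lambda>x. \<Sum>k<n. b k * ?\<psi> k x)"
      proof
        fix x
        have "?\<psi> k x = x k" if "k < n" "x \<in> vecs ell2" for k
        proof -
          have "(\<Sum>i<n. (if i = k then 1 else 0) * x i) = (\<Sum>i<n. if i = k then x i else 0)"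
            by (intro sum.cong) auto
          with that show ?thesis by (simp add: ell2_functional_def sum.delta)
        qed
        then show "ell2_functional n b x = (\<Sum>k<n. b k * ?\<psi> k x)"
          by (cases "x \<in> vecs ell2") (auto simp: ell2_functional_def)
      qed
      then have "w ?f (ell2_functional n b) = (\<Sum>k<n. w ?f (\<lambda>x. b k * ?\<psi> k x))"
        using D.dual_sum[OF wf, of "{..<n}" "\<lambda>k x. b k * ?\<psi> k x"] ell2_functional_mem
        by (simp add: D.scale_mem)
      also have "\<dots> = (\<Sum>k<n. b k * w ?f (?\<psi> k))"
        using wf ell2_functional_mem by (intro sum.cong refl) (auto simp: D.dual_mem_iff)
      finally show ?thesis by simp
    qed
    moreover have "(\<lambda>t. cmod (?f t)) = indicator A"
      by (auto simp: indicator_def)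
    then have "(LINT t|M. cmod (?f t)) = measure M A"
      using A by simp
    ultimately show "cmod (\<Sum>k<n. b k * w ?f (?\<psi> k)) \<le> ?W * (measure M A * L2_set (\<lambda>k. cmod (b k)) {..<n})"
      using apply_le[OF f, of b] by (simp add: mult.assoc)
  qed (simp_all add: w.op_norm_nonneg g)
qed

lemma mult_cnj_sgn: "z * cnj (sgn z) = complex_of_real (cmod z)"
  by (simp add: sgn_div_norm complex_norm_square[symmetric] power2_eq_square divide_simps scaleR_conv_of_real
        flip: of_real_mult)


text \<open>Here \<open>e\<close> enumerates the \<open>n\<close> elements of \<open>\<Lambda>\<close>, and \<open>l\<close> is a diagonal operator on the target.\<close>

definition coeff_op ::
  "nat \<Rightarrow> nat \<Rightarrow> nat \<Rightarrow> (nat \<Rightarrow> nat \<Rightarrow> nat) \<Rightarrow> ((nat \<Rightarrow> nat) \<Rightarrow> complex) \<Rightarrow>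
    ((nat \<Rightarrow> complex) \<Rightarrow> complex) \<Rightarrow> nat \<Rightarrow> complex" where
  "coeff_op q N n e l f = (\<lambda>k. if k < n then l (e k) * fourier_coeff q N f (e k) else 0)"

lemma coeff_op_mem: "coeff_op q N n e l f \<in> vecs ell2"
  by (rule ell2_nrm_finite(1)[of n]) (simp add: coeff_op_def)

lemma coeff_op_nrm_le:
  assumes q: "q > 0" and \<Lambda>: "\<Lambda> \<subseteq> multi_indices q N"
    and B: "\<And>\<alpha>. \<alpha> \<in> \<Lambda> \<Longrightarrow> mweight N \<alpha> \<le> B" "0 \<le> B"
    and e: "bij_betw e {..<n} \<Lambda>" and l: "\<And>\<alpha>. cmod (l \<alpha>) \<le> 1"
    and f: "f \<in> vecs (poly_space q N \<Lambda>)"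
  shows "nrm ell2 (coeff_op q N n e l f) \<le> B * ((\<Sum>x\<in>cyc q N. cmod (f x)) / q ^ N)"
proof -
  obtain a where a: "f = poly_fun q N \<Lambda> a" using f by (auto simp: poly_space_mem_iff)
  have eq: "fourier_coeff q N f (e k) = a (e k)" if "k < n" for k
    unfolding a using bij_betwE[OF e] that by (intro fourier_coeff_poly_fun q \<Lambda>) auto
  have "nrm ell2 (coeff_op q N n e l f) = L2_set (\<lambda>k. cmod (coeff_op q N n e l f k)) {..<n}"
    by (rule ell2_nrm_finite) (simp add: coeff_op_def)
  also have "\<dots> \<le> L2_set (\<lambda>k. cmod (a (e k))) {..<n}"
    using l by (intro L2_set_mono) (auto simp: coeff_op_def eq norm_mult mult_left_le_one_le)
  also have "\<dots> = L2_set (\<lambda>\<alpha>. cmod (a \<alpha>)) \<Lambda>"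
    unfolding L2_set_def by (simp add: sum.reindex_bij_betw[OF e, of "\<lambda>\<alpha>. (cmod (a \<alpha>))\<^sup>2"])
  also have "\<dots> \<le> B * ((\<Sum>x\<in>cyc q N. cmod (f x)) / q ^ N)"
    unfolding a by (rule L2_le_L1_poly_fun[OF q \<Lambda> B])
  finally show ?thesis .
qed

lemma bounded_op_coeff_op:
  assumes q: "q > 0" and \<Lambda>: "\<Lambda> \<subseteq> multi_indices q N"
    and B: "\<And>\<alpha>. \<alpha> \<in> \<Lambda> \<Longrightarrow> mweight N \<alpha> \<le> B" "0 \<le> B"
    and e: "bij_betw e {..<n} \<Lambda>" and l: "\<And>\<alpha>. cmod (l \<alpha>) \<le> 1"
  shows "bounded_op (poly_space q N \<Lambda>) ell2 (coeff_op q N n e l)"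
  unfolding bounded_op_def
proof (intro conjI ballI allI)
  fix f g
  have "coeff_op q N n e l (\<lambda>t. f t + g t) = (\<lambda>k. coeff_op q N n e l f k + coeff_op q N n e l g k)"
    by (auto simp: coeff_op_def fourier_coeff_add distrib_left)
  then show "same_in ell2 (coeff_op q N n e l (\<lambda>t. f t + g t)) (\<lambda>k. coeff_op q N n e l f k + coeff_op q N n e l g k)"
    by (simp add: ell2.same_in_refl)
next
  fix c f
  have "coeff_op q N n e l (\<lambda>t. c * f t) = (\<lambda>k. c * coeff_op q N n e l f k)"
    by (auto simp: coeff_op_def fourier_coeff_scale)
  then show "same_in ell2 (coeff_op q N n e l (\<lambda>t. c * f t)) (\<lambda>k. c * coeff_op q N n e l f k)"
    by (simp add: ell2.same_in_refl)
next
  have "nrm ell2 (coeff_op q N n e l f) \<le> B * nrm (poly_space q N \<Lambda>) f"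
    if f: "f \<in> vecs (poly_space q N \<Lambda>)" for f
  proof -
    have "(\<Sum>x\<in>cyc q N. cmod (f x)) \<le> (\<Sum>x\<in>cyc q N. sup_norm q N f)"
      by (intro sum_mono sup_norm_ge q)
    then have "(\<Sum>x\<in>cyc q N. cmod (f x)) / q ^ N \<le> sup_norm q N f"
      using q by (simp add: card_cyc field_simps)
    with coeff_op_nrm_le[where l=l, OF q \<Lambda> B e l f] B(2) show ?thesis
      unfolding poly_space_nrm by (meson mult_left_mono order_trans)
  qed
  then show "\<exists>K. \<forall>f\<in>vecs (poly_space q N \<Lambda>). nrm ell2 (coeff_op q N n e l f) \<le> K * nrm (poly_space q N \<Lambda>) f"
    by blast
qed (rule coeff_op_mem)

text \<open>The conjugate signs make each diagonal term of the trace equal to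
  \<open>cmod (a \<alpha>)\<close>. The trace is bounded through \<open>w\<close>, then the norm
  comparison under the integral brings in averages over translates of the polynomial, to which the
  bound on \<open>v\<close> applies.\<close>

lemma sum_coeffs_le_if_factorization:
  assumes q: "q > 0" and \<Lambda>: "\<Lambda> \<subseteq> multi_indices q N"
    and B: "\<And>\<alpha>. \<alpha> \<in> \<Lambda> \<Longrightarrow> mweight N \<alpha> \<le> B" "0 \<le> B"
    and e: "bij_betw e {..<n} \<Lambda>"
    and v: "bounded_op (poly_space q N \<Lambda>) (L1 M) v"
    and w: "bounded_op (L1 M) (dual (dual ell2)) w"
    and wv: "\<And>f. f \<in> vecs (poly_space q N \<Lambda>) \<Longrightarrow>
      w (v f) = bidual_emb ell2 (coeff_op q N n e (\<lambda>\<alpha>. cnj (sgn (a \<alpha>))) f)"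
  shows "(\<Sum>\<alpha>\<in>\<Lambda>. cmod (a \<alpha>)) \<le> (op_norm (poly_space q N \<Lambda>) (L1 M) v * op_norm (L1 M) (dual (dual ell2)) w)
    * (B * sup_norm q N (poly_fun q N \<Lambda> a))"
proof -
  let ?X = "poly_space q N \<Lambda>"
  interpret D: seminormed "dual ell2" by (rule seminormed.seminormed_dual[OF seminormed_ell2])
  interpret DD: seminormed "dual (dual ell2)" by (rule D.seminormed_dual)
  interpret v: bounded_operator ?X "L1 M" v
    using v by (intro bounded_operator.intro seminormed_L1 seminormed_poly_space[OF q] bounded_operator_axioms.intro)
  interpret w: bounded_operator "L1 M" "dual (dual ell2)" w
    using w by (intro bounded_operator.intro seminormed_L1 DD.seminormed_axioms bounded_operator_axioms.intro)
  let ?V = "op_norm ?X (L1 M) v" and ?W = "op_norm (L1 M) (dual (dual ell2)) w"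
  let ?f = "poly_fun q N \<Lambda> a"
  let ?\<psi> = "\<lambda>k. ell2_functional n (\<lambda>i. if i = k then 1 else (0::complex))"
  have fin: "finite \<Lambda>" using \<Lambda> finite_multi_indices finite_subset by blast
  have \<chi>: "char_fun q N \<alpha> \<in> vecs ?X" if "\<alpha> \<in> \<Lambda>" for \<alpha>
    unfolding char_fun_eq_poly_fun[OF fin that] by simp
  \<comment> \<open>Set to zero outside \<open>\<Lambda>\<close> so that \<open>g \<alpha>\<close>
    is integrable for every \<open>\<alpha>\<close>, as \<open>integral_L2_le_L1_poly_fun\<close>
    asks.\<close>
  define g where "g \<alpha> = (\<lambda>t. if \<alpha> \<in> \<Lambda> then a \<alpha> * v (char_fun q N \<alpha>) t else 0)" for \<alpha>
  have v\<chi>: "integrable M (v (char_fun q N \<alpha>))" if "\<alpha> \<in> \<Lambda>" for \<alpha>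
    using v.mem[OF \<chi>[OF that]] by (simp add: L1_def)
  then have g: "integrable M (g \<alpha>)" for \<alpha>
    by (cases "\<alpha> \<in> \<Lambda>") (auto simp: g_def)
  have wg: "w (g (e k)) (?\<psi> k) = of_real (cmod (a (e k)))" if k: "k < n" for k
  proof -
    have ek: "e k \<in> \<Lambda>" using bij_betwE[OF e] k by auto
    then have "w (g (e k)) (?\<psi> k) = w (\<lambda>t. a (e k) * v (char_fun q N (e k)) t) (?\<psi> k)"
      by (simp add: g_def)
    also have "\<dots> = a (e k) * w (v (char_fun q N (e k))) (?\<psi> k)"
      using v.mem[OF \<chi>[OF ek]]
      by (intro seminormed.bidual_apply_eq_if_same_in[OF seminormed_ell2 _ _ w.scale ell2_functional_mem])
         (auto intro: w.mem v.Y.scale_mem DD.scale_mem)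
    also have "w (v (char_fun q N (e k))) (?\<psi> k) = ?\<psi> k (coeff_op q N n e (\<lambda>\<alpha>. cnj (sgn (a \<alpha>))) (char_fun q N (e k)))"
      using wv[OF \<chi>[OF ek]] by (simp add: bidual_emb_def ell2_functional_mem)
    also have "\<dots> = cnj (sgn (a (e k))) * fourier_coeff q N (char_fun q N (e k)) (e k)"
    proof -
      have "(\<Sum>i<n. (if i = k then 1 else 0) * y i) = y k" for y :: "nat \<Rightarrow> complex"
      proof -
        have "(\<Sum>i<n. (if i = k then 1 else 0) * y i) = (\<Sum>i<n. if i = k then y i else 0)"
          by (intro sum.cong) auto
        then show ?thesis using k by (simp add: sum.delta)
      qed
      then have "?\<psi> k (coeff_op q N n e l f) = coeff_op q N n e l f k" for l f
        by (simp add: ell2_functional_def coeff_op_mem)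
      then show ?thesis using k by (simp add: coeff_op_def)
    qed
    also have "fourier_coeff q N (char_fun q N (e k)) (e k) = 1"
      unfolding char_fun_eq_poly_fun[OF fin ek] by (simp add: fourier_coeff_poly_fun[OF q \<Lambda> ek])
    also have "a (e k) * (cnj (sgn (a (e k))) * 1) = of_real (cmod (a (e k)))"
      by (simp add: sgn_div_norm complex_norm_square[symmetric] power2_eq_square divide_simps scaleR_conv_of_real
            flip: of_real_mult)
    finally show ?thesis .
  qed
  have "complex_of_real (\<Sum>\<alpha>\<in>\<Lambda>. cmod (a \<alpha>)) = (\<Sum>k<n. w (g (e k)) (?\<psi> k))"
    by (simp add: wg sum.reindex_bij_betw[OF e, of "\<lambda>\<alpha>. complex_of_real (cmod (a \<alpha>))", symmetric])
  then have "(\<Sum>\<alpha>\<in>\<Lambda>. cmod (a \<alpha>)) = cmod (\<Sum>k<n. w (g (e k)) (?\<psi> k))"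
    using norm_of_real[of "\<Sum>\<alpha>\<in>\<Lambda>. cmod (a \<alpha>)", where 'a=complex]
    by (simp only: abs_of_nonneg[OF sum_nonneg[OF norm_ge_zero]])
  also have "\<dots> \<le> ?W * (LINT t|M. L2_set (\<lambda>k. cmod (g (e k) t)) {..<n})"
    by (rule sum_bidual_functionals_le[OF w g])
  also have "\<dots> \<le> ?W * (B * ((\<Sum>x\<in>cyc q N. LINT t|M. cmod (\<Sum>\<alpha>\<in>\<Lambda>. character N \<alpha> x * g \<alpha> t)) / q ^ N))"
    by (intro mult_left_mono integral_L2_le_L1_poly_fun[OF q \<Lambda> B e g] w.op_norm_nonneg)
  also have "\<dots> \<le> ?W * (B * ((\<Sum>x\<in>cyc q N. ?V * sup_norm q N ?f) / q ^ N))"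
  proof (intro mult_left_mono divide_right_mono sum_mono w.op_norm_nonneg B(2))
    fix x assume x: "x \<in> cyc q N"
    \<comment> \<open>These are the coefficients of the translate of \<open>?f\<close> by
      \<open>x\<close>, so \<open>?h\<close> represents the image of that translate under
      \<open>v\<close>.\<close>
    let ?c = "\<lambda>\<alpha>. a \<alpha> * character N \<alpha> x"
    let ?h = "\<lambda>t. \<Sum>\<alpha>\<in>\<Lambda>. ?c \<alpha> * v (char_fun q N \<alpha>) t"
    have h: "?h \<in> vecs (L1 M)"
      by (intro v.Y.sum_mem v.Y.scale_mem v.mem \<chi> fin)
    have "(LINT t|M. cmod (\<Sum>\<alpha>\<in>\<Lambda>. character N \<alpha> x * g \<alpha> t)) = nrm (L1 M) ?h"
      by (simp add: L1_def g_def mult_ac)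
    also have "\<dots> \<le> nrm (L1 M) (v (poly_fun q N \<Lambda> ?c))"
    proof (rule v.Y.nrm_le_if_same_in[OF h v.mem[OF poly_fun_mem]], rule v.Y.same_in_sym[OF v.mem[OF poly_fun_mem] h])
      show "same_in (L1 M) (v (poly_fun q N \<Lambda> ?c)) ?h"
        unfolding poly_fun_eq_sum by (rule v.sum_scale[OF fin \<chi>])
    qed
    also have "\<dots> \<le> ?V * nrm ?X (poly_fun q N \<Lambda> ?c)"
      by (rule v.nrm_le) simp
    also have "\<dots> \<le> ?V * sup_norm q N ?f"
      unfolding poly_space_nrm by (intro mult_left_mono sup_norm_translate_le q x v.op_norm_nonneg)
    finally show "(LINT t|M. cmod (\<Sum>\<alpha>\<in>\<Lambda>. character N \<alpha> x * g \<alpha> t)) \<le> ?V * sup_norm q N ?f" .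
  qed simp
  also have "\<dots> = (?V * ?W) * (B * sup_norm q N ?f)"
    using q by (simp add: card_cyc)
  finally show ?thesis .
qed

text \<open>Multiplication by \<open>ennreal k\<close> is invertible for real \<open>k > 0\<close>,
  so it commutes with infima, including the infinite infimum of the empty set.\<close>

lemma le_mult_Inf_ennreal:
  fixes a :: ennreal
  assumes "0 < k" "\<And>s. s \<in> S \<Longrightarrow> a \<le> ennreal k * s"
  shows "a \<le> ennreal k * Inf S"
proof -
  have cancel: "ennreal (1 / k) * (ennreal k * s) = s" "ennreal k * (ennreal (1 / k) * s) = s" for s
    using assms(1) by (simp_all add: mult.assoc[symmetric] ennreal_mult'[symmetric])
  have "ennreal (1 / k) * a \<le> Inf S"
    using assms(2) cancel(1) by (intro Inf_greatest) (metis mult_left_mono zero_le)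
  then have "ennreal k * (ennreal (1 / k) * a) \<le> ennreal k * Inf S"
    by (rule mult_left_mono) simp
  then show ?thesis by (simp only: cancel(2))
qed

text \<open>One factor \<open>B\<close> bounds the summing norm of the coefficient operator, the
  other comes from the trace estimate. The operator depends on the signs of \<open>a\<close>, but
  the bound does not.\<close>

theorem sidon_le_gordon_lewis:
  assumes q: "q > 0" and \<Lambda>: "\<Lambda> \<subseteq> multi_indices q N"
    and B: "\<And>\<alpha>. \<alpha> \<in> \<Lambda> \<Longrightarrow> mweight N \<alpha> \<le> B" "0 < B"
  shows "Sid q N \<Lambda> \<le> ennreal (B\<^sup>2) * gl (poly_space q N \<Lambda>)"
  unfolding gl_def
proof (rule le_mult_Inf_ennreal)
  let ?X = "poly_space q N \<Lambda>"
  fix s assume "s \<in> {ennreal c | c. c > 0 \<and>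
     (\<forall>u. bounded_op ?X ell2 u \<and> pi1 ?X ell2 u < \<infinity> \<longrightarrow> gamma1 ?X ell2 u \<le> ennreal c * pi1 ?X ell2 u)}"
  then obtain c where c: "s = ennreal c" "c > 0"
    and gl: "\<And>u. bounded_op ?X ell2 u \<Longrightarrow> pi1 ?X ell2 u < \<infinity> \<Longrightarrow> gamma1 ?X ell2 u \<le> ennreal c * pi1 ?X ell2 u"
    by auto
  have fin: "finite \<Lambda>" using \<Lambda> finite_multi_indices finite_subset by blast
  then obtain e n where e: "bij_betw e {..<n::nat} \<Lambda>"
    using ex_bij_betw_nat_finite lessThan_atLeast0 by metis
  have B0: "0 \<le> B" using B(2) by simp
  have "(\<Sum>\<alpha>\<in>\<Lambda>. cmod (a \<alpha>)) \<le> (B\<^sup>2 * c) * sup_norm q N (poly_fun q N \<Lambda> a)" for a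
  proof -
    let ?u = "coeff_op q N n e (\<lambda>\<alpha>. cnj (sgn (a \<alpha>)))"
    let ?S = "B * sup_norm q N (poly_fun q N \<Lambda> a)"
    have l: "cmod (cnj (sgn (a \<alpha>))) \<le> 1" for \<alpha> by (simp add: norm_sgn)
    have S: "0 \<le> ?S" using B0 sup_norm_nonneg[OF q] by simp
    have pi: "pi1 ?X ell2 ?u \<le> ennreal B"
      by (rule pi1_le_if_average_bound[OF q B0 coeff_op_nrm_le[OF q \<Lambda> B(1) B0 e l]])
    then have "gamma1 ?X ell2 ?u \<le> ennreal c * pi1 ?X ell2 ?u"
      by (intro gl bounded_op_coeff_op[OF q \<Lambda> B(1) B0 e l])
         (auto simp: less_top[symmetric] top_unique)
    also have "\<dots> \<le> ennreal c * ennreal B" using pi by (intro mult_left_mono) auto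
    also have "\<dots> = ennreal (c * B)" using c B0 by (simp add: ennreal_mult')
    finally have gamma: "gamma1 ?X ell2 ?u \<le> ennreal (c * B)" .
    have "(\<Sum>\<alpha>\<in>\<Lambda>. cmod (a \<alpha>)) \<le> (c * B) * ?S + \<epsilon>" if "\<epsilon> > 0" for \<epsilon>
    proof -
      \<comment> \<open>The infimum in \<open>gamma1\<close> need not be attained. This slack costs
        at most \<open>\<epsilon>\<close> after multiplication by \<open>?S\<close>, and the
        \<open>+ 1\<close> covers \<open>?S = 0\<close>.\<close>
      define \<eta> where "\<eta> = \<epsilon> / (?S + 1)"
      have \<eta>: "\<eta> > 0" "\<eta> * ?S \<le> \<epsilon>"
        using S that by (auto simp: \<eta>_def field_simps)
      have "gamma1 ?X ell2 ?u < ennreal (c * B + \<eta>)"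
        by (rule le_less_trans[OF gamma]) (use c B0 \<eta> in \<open>simp add: ennreal_lessI\<close>)
      then obtain M :: "(((nat \<Rightarrow> complex) \<Rightarrow> complex) \<Rightarrow> complex) measure" and v w
        where less: "ennreal (op_norm ?X (L1 M) v * op_norm (L1 M) (dual (dual ell2)) w) < ennreal (c * B + \<eta>)"
          and v: "bounded_op ?X (L1 M) v" and w: "bounded_op (L1 M) (dual (dual ell2)) w"
          and wv: "\<And>f. f \<in> vecs ?X \<Longrightarrow> w (v f) = bidual_emb ell2 (?u f)"
        unfolding gamma1_def Inf_less_iff by blast
      have "op_norm ?X (L1 M) v * op_norm (L1 M) (dual (dual ell2)) w < c * B + \<eta>"
        using less by (meson ennreal_leI not_le)
      then have "op_norm ?X (L1 M) v * op_norm (L1 M) (dual (dual ell2)) w * ?S \<le> (c * B + \<eta>) * ?S"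
        using S by (intro mult_right_mono) auto
      moreover have "(\<Sum>\<alpha>\<in>\<Lambda>. cmod (a \<alpha>)) \<le> op_norm ?X (L1 M) v * op_norm (L1 M) (dual (dual ell2)) w * ?S"
        by (rule sum_coeffs_le_if_factorization[OF q \<Lambda> _ B0 e v w]) (simp_all add: B(1) wv)
      ultimately show ?thesis using \<eta>(2) by (simp add: distrib_right)
    qed
    then have "(\<Sum>\<alpha>\<in>\<Lambda>. cmod (a \<alpha>)) \<le> (c * B) * ?S" by (rule field_le_epsilon)
    then show ?thesis by (simp add: power2_eq_square mult_ac)
  qed
  then have "Sid q N \<Lambda> \<le> ennreal (B\<^sup>2 * c)"
    unfolding Sid_def using B(2) c by (intro Inf_lower) auto
  then show "Sid q N \<Lambda> \<le> ennreal (B\<^sup>2) * s"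
    using c by (simp add: ennreal_mult')
qed (use B in simp)


section \<open>Unconditional bases\<close>

lemma unimodular_rotation:
  obtains s :: complex where "cmod s = 1" "s * z = of_real (cmod z)"
proof (cases "z = 0")
  case True
  then show thesis using that[of 1] by simp
next
  case False
  have "cnj (sgn z) * z = of_real (cmod z)"
    using mult_cnj_sgn[of z] by (simp only: mult.commute)
  then show thesis using that[of "cnj (sgn z)"] False by (simp add: norm_sgn)
qed

lemma tendsto_principal_singleton_iff:
  fixes h :: "'a \<Rightarrow> real"
  shows "(h \<longlongrightarrow> L) (principal {x}) \<longleftrightarrow> h x = L"
proof
  assume "(h \<longlongrightarrow> L) (principal {x})"
  then have "dist (h x) L < \<epsilon>" if "\<epsilon> > 0" for \<epsilon>
    using that by (auto simp: tendsto_iff eventually_principal)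
  then have "\<not> 0 < dist (h x) L" by blast
  then show "h x = L" by simp
qed (auto simp: tendsto_iff eventually_principal)

text \<open>The finite subsets of a finite \<open>I\<close> have a largest element, so the filter is
  principal and the limit is the value at \<open>I\<close>.\<close>

lemma unconditional_basis_finite_iff:
  assumes "finite I"
  shows "unconditional_basis X I e \<longleftrightarrow> (\<forall>i\<in>I. e i \<in> vecs X) \<and>
    (\<forall>f\<in>vecs X. \<exists>!a. (\<forall>i. i \<notin> I \<longrightarrow> a i = 0) \<and> same_in X f (\<lambda>t. \<Sum>i\<in>I. a i * e i t))"
  unfolding unconditional_basis_def finite_subsets_at_top_finite[OF assms]
    tendsto_principal_singleton_iff same_in_def ..

text \<open>The summing inequality is applied to the vectors \<open>a i * e i\<close>. For a
  functional in the unit ball, unimodular factors turn the sum of moduli into the modulus of one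
  value, and the basis constant removes these factors at the price of \<open>K\<close>.\<close>

lemma sum_basis_coeffs_le:
  assumes X: "seminormed X" and I: "finite I" and e: "\<And>i. i \<in> I \<Longrightarrow> e i \<in> vecs X"
    and u: "bounded_op X ell2 u"
    and K: "0 \<le> K" "\<And>a \<epsilon>. \<forall>i\<in>I. cmod (\<epsilon> i) = 1 \<Longrightarrow>
      nrm X (\<lambda>t. \<Sum>i\<in>I. \<epsilon> i * a i * e i t) \<le> K * nrm X (\<lambda>t. \<Sum>i\<in>I. a i * e i t)"
    and c: "0 \<le> c" "\<And>(n::nat) x. \<forall>j<n. x j \<in> vecs X \<Longrightarrow> ennreal (\<Sum>j<n. nrm ell2 (u (x j))) \<le>
      ennreal c * (SUP \<phi>\<in>unit_ball (dual X). ennreal (\<Sum>j<n. cmod (\<phi> (x j))))"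
  shows "(\<Sum>i\<in>I. cmod (a i) * nrm ell2 (u (e i))) \<le> (K * c) * nrm X (\<lambda>t. \<Sum>i\<in>I. a i * e i t)"
proof -
  interpret u: bounded_operator X ell2 u
    using u X by (intro bounded_operator.intro seminormed_ell2 bounded_operator_axioms.intro)
  let ?f = "\<lambda>t. \<Sum>i\<in>I. a i * e i t"
  define x where "x i = (\<lambda>t. a i * e i t)" for i
  have x: "x i \<in> vecs X" if "i \<in> I" for i
    unfolding x_def using e that by (intro u.X.scale_mem)
  have f: "?f \<in> vecs X" using u.X.sum_mem[OF I x] by (simp add: x_def)
  obtain h where h: "bij_betw h {..<card I} I"
    using ex_bij_betw_nat_finite[OF I] lessThan_atLeast0 by metis
  have ux: "nrm ell2 (u (x i)) = cmod (a i) * nrm ell2 (u (e i))" if "i \<in> I" for i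
  proof -
    have "u (x i) = (\<lambda>s. a i * u (e i) s)"
      unfolding x_def using e[OF that]
      by (intro ell2_eq_if_same_in u.scale u.mem u.X.scale_mem ell2.scale_mem)
    then show ?thesis using ell2.nrm_scale[OF u.mem[OF e[OF that]]] by simp
  qed
  have "(SUP \<phi>\<in>unit_ball (dual X). ennreal (\<Sum>j<card I. cmod (\<phi> (x (h j))))) \<le> ennreal (K * nrm X ?f)"
  proof (rule SUP_least)
    fix \<phi> assume "\<phi> \<in> unit_ball (dual X)"
    then have \<phi>: "\<phi> \<in> vecs (dual X)" "nrm (dual X) \<phi> \<le> 1" by (auto simp: unit_ball_def)
    have "\<forall>i. \<exists>s. cmod s = 1 \<and> s * \<phi> (x i) = of_real (cmod (\<phi> (x i)))"
      using unimodular_rotation by metis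
    then obtain s where s: "\<And>i. cmod (s i) = 1" "\<And>i. s i * \<phi> (x i) = of_real (cmod (\<phi> (x i)))"
      by metis
    let ?g = "\<lambda>t. \<Sum>i\<in>I. s i * a i * e i t"
    have sx: "(\<lambda>t. s i * x i t) \<in> vecs X" if "i \<in> I" for i
      using x that by (intro u.X.scale_mem)
    have g: "?g = (\<lambda>t. \<Sum>i\<in>I. s i * x i t)" by (simp add: x_def mult.assoc)
    have "complex_of_real (\<Sum>i\<in>I. cmod (\<phi> (x i))) = (\<Sum>i\<in>I. \<phi> (\<lambda>t. s i * x i t))"
      using \<phi>(1) x by (simp add: s(2)[symmetric] u.X.dual_scale)
    also have "\<dots> = \<phi> ?g"
      unfolding g using u.X.dual_sum[OF \<phi>(1) I sx] by simp
    finally have "(\<Sum>i\<in>I. cmod (\<phi> (x i))) = cmod (\<phi> ?g)"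
      using norm_of_real[of "\<Sum>i\<in>I. cmod (\<phi> (x i))", where 'a=complex]
      by (simp only: abs_of_nonneg[OF sum_nonneg[OF norm_ge_zero]])
    also have gX: "?g \<in> vecs X" unfolding g by (rule u.X.sum_mem[OF I sx])
    have "cmod (\<phi> ?g) \<le> nrm (dual X) \<phi> * nrm X ?g"
      by (rule u.X.dual_apply_le[OF \<phi>(1) gX])
    also have "\<dots> \<le> 1 * nrm X ?g"
      using \<phi>(2) u.X.nrm_nonneg[OF gX] by (rule mult_right_mono)
    also have "\<dots> \<le> K * nrm X ?f"
      using K(2)[of s a] s(1) by simp
    finally have "(\<Sum>i\<in>I. cmod (\<phi> (x i))) \<le> K * nrm X ?f" .
    then show "ennreal (\<Sum>j<card I. cmod (\<phi> (x (h j)))) \<le> ennreal (K * nrm X ?f)"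
      unfolding sum.reindex_bij_betw[OF h, of "\<lambda>i. cmod (\<phi> (x i))"] by (rule ennreal_leI)
  qed
  then have "ennreal c * (SUP \<phi>\<in>unit_ball (dual X). ennreal (\<Sum>j<card I. cmod (\<phi> (x (h j))))) \<le> ennreal c * ennreal (K * nrm X ?f)"
    by (rule mult_left_mono) simp
  moreover have "ennreal (\<Sum>j<card I. nrm ell2 (u (x (h j)))) \<le>
      ennreal c * (SUP \<phi>\<in>unit_ball (dual X). ennreal (\<Sum>j<card I. cmod (\<phi> (x (h j)))))"
    using bij_betwE[OF h] x by (intro c(2)) auto
  ultimately have "ennreal (\<Sum>j<card I. nrm ell2 (u (x (h j)))) \<le> ennreal c * ennreal (K * nrm X ?f)"
    by (rule order_trans[rotated])
  also have "\<dots> = ennreal (c * (K * nrm X ?f))" using c(1) by (simp add: ennreal_mult')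
  finally have "(\<Sum>j<card I. nrm ell2 (u (x (h j)))) \<le> c * (K * nrm X ?f)"
    using c(1) K(1) u.X.nrm_nonneg[OF f] by (subst (asm) ennreal_le_iff) auto
  moreover have "(\<Sum>j<card I. nrm ell2 (u (x (h j)))) = (\<Sum>i\<in>I. cmod (a i) * nrm ell2 (u (e i)))"
    unfolding sum.reindex_bij_betw[OF h, of "\<lambda>i. nrm ell2 (u (x i))"] using ux by simp
  ultimately show ?thesis by (simp add: mult_ac)
qed

text \<open>The factor into \<open>L1\<close> has norm at most \<open>K * c\<close> by
  \<open>sum_basis_coeffs_le\<close>, the factor out of it at most 1. Here \<open>c\<close> is
  admissible for \<open>pi1\<close> and \<open>K\<close> for \<open>basis_const\<close>; both infima
  are taken afterwards.\<close>

lemma gl_le_basis_const: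
  fixes X :: "'i cfs" and I :: "('i \<Rightarrow> complex) set"
  assumes X: "seminormed X"
    and normed: "\<And>f g. f \<in> vecs X \<Longrightarrow> g \<in> vecs X \<Longrightarrow> same_in X f g \<Longrightarrow> f = g"
    and I: "finite I" and basis: "unconditional_basis X I e"
  shows "gl X \<le> basis_const X I e"
  unfolding basis_const_def
proof (rule Inf_greatest)
  interpret X: seminormed X by (rule X)
  interpret D: seminormed "dual ell2" by (rule ell2.seminormed_dual)
  interpret DD: seminormed "dual (dual ell2)" by (rule D.seminormed_dual)
  have e: "e i \<in> vecs X" if "i \<in> I" for i
    using basis that by (simp add: unconditional_basis_finite_iff[OF I])
  have span: "(\<lambda>t. \<Sum>i\<in>I. a i * e i t) \<in> vecs X" for a
    using e I by (intro X.sum_mem X.scale_mem)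
  have "\<forall>f\<in>vecs X. \<exists>a. (\<forall>i. i \<notin> I \<longrightarrow> a i = 0) \<and> f = (\<lambda>t. \<Sum>i\<in>I. a i * e i t)"
    using basis normed span unfolding unconditional_basis_finite_iff[OF I] by blast
  then obtain A where A0: "\<And>f i. f \<in> vecs X \<Longrightarrow> i \<notin> I \<Longrightarrow> A f i = 0"
    and A: "\<And>f. f \<in> vecs X \<Longrightarrow> f = (\<lambda>t. \<Sum>i\<in>I. A f i * e i t)" by metis
  \<comment> \<open>Uniqueness of expansions makes the coordinate maps linear.\<close>
  have A_unique: "a i = A f i" if "f \<in> vecs X" "\<And>i. i \<notin> I \<Longrightarrow> a i = 0" "f = (\<lambda>t. \<Sum>i\<in>I. a i * e i t)" for f a i
  proof -
    define P where "P a \<longleftrightarrow> (\<forall>i. i \<notin> I \<longrightarrow> a i = 0) \<and> same_in X f (\<lambda>t. \<Sum>i\<in>I. a i * e i t)" for a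
    have "\<exists>!a. P a"
      using basis that(1) unfolding unconditional_basis_finite_iff[OF I] P_def by blast
    moreover have "P a"
      using that(2,3) X.same_in_refl[of f] by (simp add: P_def)
    moreover have "P (A f)"
      using A0 A[symmetric] that(1) X.same_in_refl[of f] by (simp add: P_def)
    ultimately have "a = A f" by blast
    then show ?thesis by simp
  qed
  have A_add: "A (\<lambda>t. f t + g t) i = A f i + A g i" if fg: "f \<in> vecs X" "g \<in> vecs X" for f g i
  proof (rule A_unique[symmetric, OF X.add_mem[OF fg]])
    show "A f i + A g i = 0" if "i \<notin> I" for i using A0 fg that by simp
    show "(\<lambda>t. f t + g t) = (\<lambda>t. \<Sum>i\<in>I. (A f i + A g i) * e i t)"
      by (subst A[OF fg(1)], subst A[OF fg(2)]) (simp add: distrib_right sum.distrib)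
  qed
  have A_scale: "A (\<lambda>t. c * f t) i = c * A f i" if f: "f \<in> vecs X" for c f i
  proof (rule A_unique[symmetric, OF X.scale_mem[OF f]])
    show "c * A f i = 0" if "i \<notin> I" for i using A0 f that by simp
    show "(\<lambda>t. c * f t) = (\<lambda>t. \<Sum>i\<in>I. (c * A f i) * e i t)"
      by (subst A[OF f]) (simp add: sum_distrib_left mult.assoc)
  qed
  \<comment> \<open>\<^const>\<open>gamma1\<close> asks for a measure on this type, so \<open>I\<close> is copied into it.\<close>
  define J :: "('i \<Rightarrow> complex) \<Rightarrow> ('i \<Rightarrow> complex) \<Rightarrow> complex" where "J i = indicator {i}" for i
  have "inj J" by (rule injI) (metis J_def indicator_eq_1_iff singleton_iff)
  then have J: "inj_on J I" by (rule inj_on_subset) simp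
  let ?R = "inv_into I J"
  have R: "?R (J i) = i" if "i \<in> I" for i using inv_into_f_f[OF J that] .
  define M where "M = count_space (J ` I)"
  have L1_mem: "g \<in> vecs (L1 M)" for g
    using I by (simp add: L1_def M_def integrable_count_space)
  have L1_nrm: "nrm (L1 M) g = (\<Sum>i\<in>I. cmod (g (J i)))" for g
    using I J by (simp add: L1_def M_def lebesgue_integral_count_space_finite sum.reindex)
  interpret L: seminormed "L1 M" by (rule seminormed_L1)
  fix K' assume "K' \<in> {ennreal K | K. K > 0 \<and>
     (\<forall>F a \<epsilon>. finite F \<and> F \<subseteq> I \<and> (\<forall>i\<in>F. cmod (\<epsilon> i) = 1) \<longrightarrow>
        nrm X (\<lambda>t. \<Sum>i\<in>F. \<epsilon> i * a i * e i t) \<le> K * nrm X (\<lambda>t. \<Sum>i\<in>F. a i * e i t))}"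
  then obtain K where K': "K' = ennreal K" and K: "K > 0"
    and bound_all: "\<forall>F a \<epsilon>. finite F \<and> F \<subseteq> I \<and> (\<forall>i\<in>F. cmod (\<epsilon> i) = 1) \<longrightarrow>
        nrm X (\<lambda>t. \<Sum>i\<in>F. \<epsilon> i * a i * e i t) \<le> K * nrm X (\<lambda>t. \<Sum>i\<in>F. a i * e i t)"
    by (elim CollectE exE conjE) (rule that)
  have bound: "nrm X (\<lambda>t. \<Sum>i\<in>I. \<epsilon> i * a i * e i t) \<le> K * nrm X (\<lambda>t. \<Sum>i\<in>I. a i * e i t)"
    if "\<forall>i\<in>I. cmod (\<epsilon> i) = 1" for a \<epsilon>
    using bound_all[THEN spec[of _ I], THEN spec[of _ a], THEN spec[of _ \<epsilon>]] I that by simp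
  have "gamma1 X ell2 u \<le> ennreal K * pi1 X ell2 u" if u: "bounded_op X ell2 u" for u
    unfolding pi1_def
  proof (rule le_mult_Inf_ennreal[OF K])
    interpret u: bounded_operator X ell2 u
      using u X by (intro bounded_operator.intro seminormed_ell2 bounded_operator_axioms.intro)
    fix c' assume "c' \<in> {ennreal c | c. c \<ge> 0 \<and>
     (\<forall>(n::nat) x. (\<forall>j<n. x j \<in> vecs X) \<longrightarrow>
        ennreal (\<Sum>j<n. nrm ell2 (u (x j))) \<le>
        ennreal c * (SUP \<phi>\<in>unit_ball (dual X). ennreal (\<Sum>j<n. cmod (\<phi> (x j)))))}"
    then obtain c where c': "c' = ennreal c" and c: "0 \<le> c"
      and summing_all: "\<forall>(n::nat) x. (\<forall>j<n. x j \<in> vecs X) \<longrightarrow> ennreal (\<Sum>j<n. nrm ell2 (u (x j))) \<le>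
        ennreal c * (SUP \<phi>\<in>unit_ball (dual X). ennreal (\<Sum>j<n. cmod (\<phi> (x j))))"
      by (elim CollectE exE conjE) (rule that)
    note summing = summing_all[THEN spec, THEN spec, THEN mp]
    define r where "r i = nrm ell2 (u (e i))" for i
    have ue: "u (e i) \<in> vecs ell2" if "i \<in> I" for i using u.mem e that by simp
    have r0: "0 \<le> r i" if "i \<in> I" for i using ell2.nrm_nonneg[OF ue[OF that]] by (simp add: r_def)
    \<comment> \<open>The normalised image of \<open>e i\<close>. If \<open>r i = 0\<close>,
      division by zero gives the zero vector, which is correct because \<open>u (e i)\<close> then
      vanishes.\<close>
    define Z where "Z i = (\<lambda>n. complex_of_real (1 / r i) * u (e i) n)" for i
    have Z: "Z i \<in> vecs ell2" if "i \<in> I" for i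
      unfolding Z_def using ue that by (intro ell2.scale_mem)
    have Z_nrm: "nrm ell2 (Z i) \<le> 1" if "i \<in> I" for i
      unfolding Z_def ell2.nrm_scale[OF ue[OF that]] using r0[OF that] by (simp add: r_def[symmetric] norm_divide)
    have rZ: "complex_of_real (r i) * Z i n = u (e i) n" if i: "i \<in> I" for i n
    proof (cases "r i = 0")
      case True
      then have "u (e i) = (\<lambda>_. 0)"
        using ue[OF i] ell2.zero_mem by (intro ell2_eq_if_same_in) (simp_all add: same_in_def r_def)
      then show ?thesis using True by simp
    qed (simp add: Z_def)
    \<comment> \<open>The coordinates of \<open>f\<close>, weighted by the norms of the images
      \<open>u (e i)\<close>; \<open>?R\<close> recovers \<open>i\<close> from its copy
      \<open>J i\<close>.\<close>
    define v where "v f = (\<lambda>s. A f (?R s) * complex_of_real (r (?R s)))" for f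
    define y where "y g = (\<lambda>n. \<Sum>i\<in>I. g (J i) * Z i n)" for g
    define w where "w g = bidual_emb ell2 (y g)" for g
    have y: "y g \<in> vecs ell2" for g
      unfolding y_def using Z I by (intro ell2.sum_mem ell2.scale_mem)
    have v_bound: "nrm (L1 M) (v f) \<le> (K * c) * nrm X f" if f: "f \<in> vecs X" for f
    proof -
      have "nrm (L1 M) (v f) = (\<Sum>i\<in>I. cmod (A f i) * nrm ell2 (u (e i)))"
        unfolding L1_nrm using R r0 by (intro sum.cong) (auto simp: v_def norm_mult r_def[symmetric])
      also have "\<dots> \<le> (K * c) * nrm X (\<lambda>t. \<Sum>i\<in>I. A f i * e i t)"
        by (rule sum_basis_coeffs_le[OF X I e u less_imp_le[OF K] bound c summing])
      finally show ?thesis using A[OF f, symmetric] by simp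
    qed
    have w_bound: "nrm (dual (dual ell2)) (w g) \<le> 1 * nrm (L1 M) g" for g
    proof -
      have "nrm (dual (dual ell2)) (w g) \<le> nrm ell2 (y g)"
        unfolding w_def by (rule ell2.bidual_emb_nrm_le[OF y])
      also have "\<dots> \<le> (\<Sum>i\<in>I. nrm ell2 (\<lambda>n. g (J i) * Z i n))"
        unfolding y_def using Z by (intro ell2.nrm_sum_le I ell2.scale_mem)
      also have "\<dots> \<le> (\<Sum>i\<in>I. cmod (g (J i)))"
        using Z Z_nrm by (intro sum_mono) (simp add: ell2.nrm_scale mult_left_le)
      finally show ?thesis by (simp add: L1_nrm)
    qed
    have v_op: "bounded_op X (L1 M) v"
      unfolding bounded_op_def
    proof (intro conjI ballI allI)
      fix f g assume "f \<in> vecs X" "g \<in> vecs X"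
      then have "v (\<lambda>t. f t + g t) = (\<lambda>s. v f s + v g s)"
        by (simp add: v_def A_add distrib_right)
      then show "same_in (L1 M) (v (\<lambda>t. f t + g t)) (\<lambda>s. v f s + v g s)"
        by (simp only: L.same_in_refl)
    next
      fix a f assume "f \<in> vecs X"
      then have "v (\<lambda>t. a * f t) = (\<lambda>s. a * v f s)"
        by (simp add: v_def A_scale mult.assoc)
      then show "same_in (L1 M) (v (\<lambda>t. a * f t)) (\<lambda>s. a * v f s)"
        by (simp only: L.same_in_refl)
    next
      show "\<exists>K. \<forall>f\<in>vecs X. nrm (L1 M) (v f) \<le> K * nrm X f" using v_bound by blast
    qed (rule L1_mem)
    have w_op: "bounded_op (L1 M) (dual (dual ell2)) w"
      unfolding bounded_op_def
    proof (intro conjI ballI allI)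
      show "w f \<in> vecs (dual (dual ell2))" for f
        unfolding w_def by (rule ell2.bidual_emb_mem[OF y])
      fix f g :: "(('i \<Rightarrow> complex) \<Rightarrow> complex) \<Rightarrow> complex"
      have "y (\<lambda>t. f t + g t) = (\<lambda>n. y f n + y g n)"
        by (simp add: y_def distrib_right sum.distrib)
      then have "w (\<lambda>t. f t + g t) = (\<lambda>\<phi>. w f \<phi> + w g \<phi>)"
        by (simp add: w_def ell2.bidual_emb_add[OF y y])
      then show "same_in (dual (dual ell2)) (w (\<lambda>t. f t + g t)) (\<lambda>s. w f s + w g s)"
        by (simp only: DD.same_in_refl)
    next
      fix a and f :: "(('i \<Rightarrow> complex) \<Rightarrow> complex) \<Rightarrow> complex"
      have "y (\<lambda>t. a * f t) = (\<lambda>n. a * y f n)"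
        by (simp add: y_def sum_distrib_left mult.assoc)
      then have "w (\<lambda>t. a * f t) = (\<lambda>\<phi>. a * w f \<phi>)"
        by (simp add: w_def ell2.bidual_emb_scale[OF y])
      then show "same_in (dual (dual ell2)) (w (\<lambda>t. a * f t)) (\<lambda>s. a * w f s)"
        by (simp only: DD.same_in_refl)
    next
      show "\<exists>K. \<forall>f\<in>vecs (L1 M). nrm (dual (dual ell2)) (w f) \<le> K * nrm (L1 M) f" using w_bound by blast
    qed
    have "w (v f) = bidual_emb ell2 (u f)" if f: "f \<in> vecs X" for f
    proof -
      have "y (v f) = (\<lambda>n. \<Sum>i\<in>I. A f i * u (e i) n)"
        unfolding y_def v_def using R rZ by (intro ext sum.cong refl) (simp add: mult.assoc)
      also have "\<dots> = u (\<lambda>t. \<Sum>i\<in>I. A f i * e i t)"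
        using ue
        by (intro ell2_eq_if_same_in[symmetric] u.sum_scale I e u.mem span ell2.sum_mem ell2.scale_mem)
      also have "\<dots> = u f" using A[OF f, symmetric] by simp
      finally show ?thesis by (simp add: w_def)
    qed
    then have "gamma1 X ell2 u \<le> ennreal (op_norm X (L1 M) v * op_norm (L1 M) (dual (dual ell2)) w)"
      unfolding gamma1_def using v_op w_op by (intro Inf_lower) blast
    also have "\<dots> \<le> ennreal ((K * c) * 1)"
    proof (intro ennreal_leI mult_mono)
      show "op_norm X (L1 M) v \<le> K * c"
        using K c by (intro op_norm_le X v_bound) auto
      show "op_norm (L1 M) (dual (dual ell2)) w \<le> 1"
        by (intro op_norm_le seminormed_L1 w_bound) auto
      interpret w: bounded_operator "L1 M" "dual (dual ell2)" w
        using w_op by (intro bounded_operator.intro seminormed_L1 DD.seminormed_axioms bounded_operator_axioms.intro)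
      show "0 \<le> op_norm (L1 M) (dual (dual ell2)) w" by (rule w.op_norm_nonneg)
    qed (use K c in auto)
    also have "\<dots> = ennreal K * c'"
      using K c by (simp add: c' ennreal_mult')
    finally show "gamma1 X ell2 u \<le> ennreal K * c'" .
  qed
  then show "gl X \<le> K'"
    unfolding gl_def K' using K by (intro Inf_lower) blast
qed

section \<open>Finiteness of unconditional bases\<close>

lemma sum_fun_apply: "(\<Sum>i\<in>I. f i) x = (\<Sum>i\<in>I. f i x)" for f :: "'k \<Rightarrow> 'a \<Rightarrow> 'b::comm_monoid_add"
  by (induction I rule: infinite_finite_induct) auto

text \<open>Gives access to the bound of an independent set by the size of a finite spanning
  set.\<close>

interpretation fun_space: vector_space "\<lambda>(c::complex) f (t::'a). c * f t"
  by unfold_locales (auto simp: fun_eq_iff algebra_simps)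

lemma poly_space_eq_if_same_in:
  assumes q: "q > 0" and fg: "f \<in> vecs (poly_space q N \<Lambda>)" "g \<in> vecs (poly_space q N \<Lambda>)"
    and same: "same_in (poly_space q N \<Lambda>) f g"
  shows "f = g"
proof
  fix x
  show "f x = g x"
  proof (cases "x \<in> cyc q N")
    case True
    then have "cmod (f x - g x) \<le> 0"
      using sup_norm_ge[OF q True, of "\<lambda>t. f t - g t"] same by (simp add: same_in_def poly_space_nrm)
    then show ?thesis by simp
  next
    case False
    then show ?thesis using fg by (auto simp: poly_space_mem_iff poly_fun_off_cyc)
  qed
qed

text \<open>Expansions of the zero vector along finite subsets are eventually constant, so uniqueness
  of expansions yields linear independence, and the dimension is at most \<open>card \<Lambda>\<close>.\<close>

lemma finite_unconditional_basis_poly_space: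
  assumes q: "q > 0" and \<Lambda>: "finite \<Lambda>" and basis: "unconditional_basis (poly_space q N \<Lambda>) I e"
  shows "finite I"
proof -
  let ?X = "poly_space q N \<Lambda>"
  interpret seminormed ?X by (rule seminormed_poly_space[OF q])
  have indep: "c i = 0" if F: "finite F" "F \<subseteq> I" and c: "\<And>t. (\<Sum>i\<in>F. c i * e i t) = 0" and i: "i \<in> F" for F c i
  proof -
    define P where "P a \<longleftrightarrow> (\<forall>i. i \<notin> I \<longrightarrow> a i = 0) \<and>
        ((\<lambda>F. nrm ?X (\<lambda>t. 0 - (\<Sum>i\<in>F. a i * e i t))) \<longlongrightarrow> 0) (finite_subsets_at_top I)" for a
    have "\<exists>!a. P a"
      using bspec[OF conjunct2[OF basis[unfolded unconditional_basis_def]] zero_mem]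
      unfolding P_def .
    moreover have "P (\<lambda>_. 0)" by (simp add: P_def nrm_zero)
    \<comment> \<open>A vanishing linear combination, extended by zero, is a second expansion of the
      zero vector: partial sums over every finite set containing \<open>F\<close> are zero.\<close>
    moreover have "P (\<lambda>i. if i \<in> F then c i else 0)"
      unfolding P_def
    proof (intro conjI tendsto_eventually)
      show "\<forall>\<^sub>F G in finite_subsets_at_top I. nrm ?X (\<lambda>t. 0 - (\<Sum>i\<in>G. (if i \<in> F then c i else 0) * e i t)) = 0"
        unfolding eventually_finite_subsets_at_top
      proof (intro exI[of _ F] conjI allI impI F)
        fix G assume G: "finite G \<and> F \<subseteq> G \<and> G \<subseteq> I"
        have "(\<Sum>i\<in>G. (if i \<in> F then c i else 0) * e i t) = (\<Sum>i\<in>F. c i * e i t)" for t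
          using G by (intro sum.mono_neutral_cong_right) auto
        then show "nrm ?X (\<lambda>t. 0 - (\<Sum>i\<in>G. (if i \<in> F then c i else 0) * e i t)) = 0"
          by (simp add: c nrm_zero)
      qed
    qed (use F in auto)
    ultimately have "(\<lambda>i. if i \<in> F then c i else 0) = (\<lambda>_. 0)" by blast
    from fun_cong[OF this, of i] i show ?thesis by simp
  qed
  have inj: "inj_on e I"
  proof (rule inj_onI, rule ccontr)
    fix i j assume ij: "i \<in> I" "j \<in> I" "e i = e j" "i \<noteq> j"
    \<comment> \<open>Two indices with the same vector satisfy the relation with coefficients 1 and
      -1. The conditional is left unreduced to match the instance of \<open>indep\<close>.\<close>
    have "(if i = i then 1 else -1 :: complex) = 0"
      by (rule indep[of "{i, j}" "\<lambda>k. if k = i then 1 else -1"]) (use ij in auto)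
    then show False by simp
  qed
  have "fun_space.independent (e ` I)"
  proof
    assume "fun_space.dependent (e ` I)"
    then obtain S u v where S: "finite S" "S \<subseteq> e ` I" and z: "(\<Sum>v\<in>S. (\<lambda>t. u v * v t)) = 0"
      and v: "v \<in> S" "u v \<noteq> 0"
      unfolding fun_space.dependent_explicit by blast
    obtain F where F: "F \<subseteq> I" "finite F" "S = e ` F"
      using finite_subset_image[OF S] by blast
    have "inj_on e F" using inj F(1) by (rule inj_on_subset)
    then have "(\<Sum>i\<in>F. u (e i) * e i t) = 0" for t
      using fun_cong[OF z, of t] by (simp add: sum_fun_apply F(3) sum.reindex)
    moreover obtain i where "i \<in> F" "v = e i" using v(1) F(3) by blast
    ultimately show False using indep[OF F(2,1), of "\<lambda>i. u (e i)"] v(2) by simp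
  qed
  moreover have "e ` I \<subseteq> fun_space.span (char_fun q N ` \<Lambda>)"
  proof safe
    fix i assume "i \<in> I"
    then obtain a where a: "e i = poly_fun q N \<Lambda> a"
      using basis by (auto simp: unconditional_basis_def poly_space_mem_iff)
    have "e i = (\<Sum>\<alpha>\<in>\<Lambda>. (\<lambda>t. a \<alpha> * char_fun q N \<alpha> t))"
      unfolding a poly_fun_eq_sum by (simp add: fun_eq_iff sum_fun_apply)
    also have "\<dots> \<in> fun_space.span (char_fun q N ` \<Lambda>)"
      by (intro fun_space.span_sum fun_space.span_scale fun_space.span_base) auto
    finally show "e i \<in> fun_space.span (char_fun q N ` \<Lambda>)" .
  qed
  ultimately have "finite (e ` I)"
    using fun_space.independent_span_bound[of "char_fun q N ` \<Lambda>" "e ` I"] \<Lambda> by blast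
  then show ?thesis using inj by (simp add: finite_image_iff)
qed

theorem gl_le_uncond_const:
  assumes q: "q > 0" and \<Lambda>: "finite \<Lambda>"
  shows "gl (poly_space q N \<Lambda>) \<le> uncond_const (poly_space q N \<Lambda>)"
  unfolding uncond_const_def
proof (rule Inf_greatest)
  fix b assume "b \<in> {basis_const (poly_space q N \<Lambda>) I e | (I :: ((nat \<Rightarrow> complex) \<Rightarrow> complex) set) e.
     unconditional_basis (poly_space q N \<Lambda>) I e}"
  then obtain I :: "((nat \<Rightarrow> complex) \<Rightarrow> complex) set" and e
    where b: "b = basis_const (poly_space q N \<Lambda>) I e" and basis: "unconditional_basis (poly_space q N \<Lambda>) I e"
    by blast
  show "gl (poly_space q N \<Lambda>) \<le> b"
    unfolding b
    by (rule gl_le_basis_const[OF seminormed_poly_space[OF q] poly_space_eq_if_same_in[OF q]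
          finite_unconditional_basis_poly_space[OF q \<Lambda> basis] basis])
qed

section \<open>The characters as an unconditional basis\<close>

lemma fourier_coeff_eq:
  "fourier_coeff q N f \<alpha> = (\<Sum>x\<in>cyc q N. f x * cnj (char_fun q N \<alpha> x)) / of_nat (q ^ N)"
  by (simp add: fourier_coeff_def char_fun_def)

text \<open>The Fourier coefficient at \<open>\<alpha>\<close> tells
  \<open>char_fun q N \<alpha>\<close> from the other characters.\<close>

lemma inj_on_char_fun:
  assumes q: "q > 0" and \<Lambda>: "\<Lambda> \<subseteq> multi_indices q N" shows "inj_on (char_fun q N) \<Lambda>"
proof (rule inj_onI)
  fix \<alpha> \<beta> assume ab: "\<alpha> \<in> \<Lambda>" "\<beta> \<in> \<Lambda>" and eq: "char_fun q N \<alpha> = char_fun q N \<beta>"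
  have fin: "finite \<Lambda>" using \<Lambda> finite_multi_indices finite_subset by blast
  have "(if \<alpha> = \<alpha> then 1 else 0 :: complex) = fourier_coeff q N (char_fun q N \<alpha>) \<alpha>"
    unfolding char_fun_eq_poly_fun[OF fin ab(1)] using fourier_coeff_poly_fun[OF q \<Lambda> ab(1)] by simp
  also have "\<dots> = fourier_coeff q N (char_fun q N \<beta>) \<alpha>" using eq by simp
  also have "\<dots> = (if \<alpha> = \<beta> then 1 else 0)"
    unfolding char_fun_eq_poly_fun[OF fin ab(2)] by (rule fourier_coeff_poly_fun[OF q \<Lambda> ab(1)])
  finally show "\<alpha> = \<beta>" by (simp split: if_splits)
qed

text \<open>The basis is indexed by its own members, as in \<open>uncond_const\<close>; existence
  and uniqueness of expansions come from Fourier inversion.\<close>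

lemma unconditional_basis_characters:
  assumes q: "q > 0" and \<Lambda>: "\<Lambda> \<subseteq> multi_indices q N"
  shows "unconditional_basis (poly_space q N \<Lambda>) (char_fun q N ` \<Lambda>) (\<lambda>i. i)"
proof -
  interpret seminormed "poly_space q N \<Lambda>" by (rule seminormed_poly_space[OF q])
  have fin: "finite \<Lambda>" using \<Lambda> finite_multi_indices finite_subset by blast
  let ?I = "char_fun q N ` \<Lambda>"
  have inj: "inj_on (char_fun q N) \<Lambda>" by (rule inj_on_char_fun[OF q \<Lambda>])
  have expand: "(\<lambda>t. \<Sum>i\<in>?I. a i * i t) = poly_fun q N \<Lambda> (\<lambda>\<alpha>. a (char_fun q N \<alpha>))" for a
    by (simp add: sum.reindex[OF inj] poly_fun_eq_sum)
  show ?thesis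
    unfolding unconditional_basis_finite_iff[OF finite_imageI[OF fin]]
  proof (intro conjI ballI)
    fix i assume "i \<in> ?I"
    then show "i \<in> vecs (poly_space q N \<Lambda>)"
      using char_fun_eq_poly_fun[OF fin] by (auto simp: poly_space_mem_iff)
  next
    fix f assume f: "f \<in> vecs (poly_space q N \<Lambda>)"
    then obtain b where b: "f = poly_fun q N \<Lambda> b" by (auto simp: poly_space_mem_iff)
    \<comment> \<open>The Fourier coefficient, expressed through the character \<open>i\<close> as a
      function because the index is a vector and not a multi-index.\<close>
    define A where "A i = (if i \<in> ?I then (\<Sum>x\<in>cyc q N. f x * cnj (i x)) / of_nat (q ^ N) else 0)" for i
    have A: "A (char_fun q N \<alpha>) = fourier_coeff q N f \<alpha>" if "\<alpha> \<in> \<Lambda>" for \<alpha>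
      using that by (simp add: A_def fourier_coeff_eq)
    show "\<exists>!a. (\<forall>i. i \<notin> ?I \<longrightarrow> a i = 0) \<and> same_in (poly_space q N \<Lambda>) f (\<lambda>t. \<Sum>i\<in>?I. a i * i t)"
    proof (rule ex1I[of _ A])
      have "poly_fun q N \<Lambda> (\<lambda>\<alpha>. A (char_fun q N \<alpha>)) = f"
        using A fourier_coeff_poly_fun[OF q \<Lambda>] by (simp add: b poly_fun_eq_sum cong: sum.cong)
      then show "(\<forall>i. i \<notin> ?I \<longrightarrow> A i = 0) \<and> same_in (poly_space q N \<Lambda>) f (\<lambda>t. \<Sum>i\<in>?I. A i * i t)"
        unfolding expand by (simp add: A_def same_in_refl)
    next
      fix a assume a: "(\<forall>i. i \<notin> ?I \<longrightarrow> a i = 0) \<and> same_in (poly_space q N \<Lambda>) f (\<lambda>t. \<Sum>i\<in>?I. a i * i t)"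
      then have "f = poly_fun q N \<Lambda> (\<lambda>\<alpha>. a (char_fun q N \<alpha>))"
        unfolding expand by (intro poly_space_eq_if_same_in[OF q f poly_fun_mem]) simp
      then have "a (char_fun q N \<alpha>) = A (char_fun q N \<alpha>)" if "\<alpha> \<in> \<Lambda>" for \<alpha>
        using A[OF that] fourier_coeff_poly_fun[OF q \<Lambda> that, of "\<lambda>\<alpha>. a (char_fun q N \<alpha>)"] by simp
      then show "a = A"
        using a by (auto simp: fun_eq_iff A_def)
    qed
  qed
qed

text \<open>Unimodular factors leave the sum of the moduli of the coefficients unchanged. This sum
  dominates the new norm and is at most \<open>c\<close> times the old one.\<close>

theorem uncond_const_le_Sid:
  assumes q: "q > 0" and \<Lambda>: "\<Lambda> \<subseteq> multi_indices q N"
  shows "uncond_const (poly_space q N \<Lambda>) \<le> Sid q N \<Lambda>"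
  unfolding Sid_def
proof (rule Inf_greatest)
  have fin: "finite \<Lambda>" using \<Lambda> finite_multi_indices finite_subset by blast
  let ?\<chi> = "char_fun q N"
  fix s assume "s \<in> {ennreal c | c. c > 0 \<and>
     (\<forall>a. (\<Sum>\<alpha>\<in>\<Lambda>. cmod (a \<alpha>)) \<le> c * sup_norm q N (poly_fun q N \<Lambda> a))}"
  then obtain c where s: "s = ennreal c" and c: "c > 0"
    and sid: "\<And>a. (\<Sum>\<alpha>\<in>\<Lambda>. cmod (a \<alpha>)) \<le> c * sup_norm q N (poly_fun q N \<Lambda> a)"
    by auto
  have "sup_norm q N (\<lambda>t. \<Sum>i\<in>F. \<epsilon> i * a i * i t) \<le> c * sup_norm q N (\<lambda>t. \<Sum>i\<in>F. a i * i t)"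
    if F: "F \<subseteq> ?\<chi> ` \<Lambda>" and \<epsilon>: "\<forall>i\<in>F. cmod (\<epsilon> i) = 1" for F a \<epsilon>
  proof -
    obtain \<Gamma> where \<Gamma>: "\<Gamma> \<subseteq> \<Lambda>" "F = ?\<chi> ` \<Gamma>" using F by (rule subset_imageE)
    have inj: "inj_on ?\<chi> \<Gamma>" using inj_on_char_fun[OF q \<Lambda>] \<Gamma>(1) by (rule inj_on_subset)
    \<comment> \<open>The Sidon inequality concerns polynomials on all of \<open>\<Lambda>\<close>,
      so coefficients on a subset are extended by zero.\<close>
    define b where "b \<alpha> = (if \<alpha> \<in> \<Gamma> then a (?\<chi> \<alpha>) else 0)" for \<alpha>
    have "poly_fun q N \<Lambda> b = (\<lambda>t. \<Sum>i\<in>F. a i * i t)"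
      unfolding poly_fun_eq_sum \<Gamma>(2) sum.reindex[OF inj]
      using \<Gamma>(1) fin by (intro ext sum.mono_neutral_cong_right) (auto simp: b_def)
    moreover have "(\<Sum>\<alpha>\<in>\<Lambda>. cmod (b \<alpha>)) = (\<Sum>i\<in>F. cmod (a i))"
      unfolding \<Gamma>(2) sum.reindex[OF inj]
      using \<Gamma>(1) fin by (intro sum.mono_neutral_cong_right) (auto simp: b_def)
    ultimately have "(\<Sum>i\<in>F. cmod (a i)) \<le> c * sup_norm q N (\<lambda>t. \<Sum>i\<in>F. a i * i t)"
      using sid[of b] by simp
    moreover have "sup_norm q N (\<lambda>t. \<Sum>i\<in>F. \<epsilon> i * a i * i t) \<le> (\<Sum>i\<in>F. cmod (a i))"
    proof (rule sup_norm_le[OF q])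
      fix x assume x: "x \<in> cyc q N"
      have "cmod (i x) = 1" if "i \<in> F" for i
        using that x F norm_character[OF q x] by (auto simp: char_fun_def)
      then show "cmod (\<Sum>i\<in>F. \<epsilon> i * a i * i x) \<le> (\<Sum>i\<in>F. cmod (a i))"
        using \<epsilon> by (intro sum_norm_le) (simp add: norm_mult)
    qed
    ultimately show ?thesis by linarith
  qed
  then have "basis_const (poly_space q N \<Lambda>) (?\<chi> ` \<Lambda>) (\<lambda>i. i) \<le> s"
    unfolding basis_const_def s poly_space_nrm using c by (intro Inf_lower) blast
  moreover have "uncond_const (poly_space q N \<Lambda>) \<le> basis_const (poly_space q N \<Lambda>) (?\<chi> ` \<Lambda>) (\<lambda>i. i)"
    unfolding uncond_const_def using unconditional_basis_characters[OF q \<Lambda>] by (intro Inf_lower) blast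
  ultimately show "uncond_const (poly_space q N \<Lambda>) \<le> s" by (rule order_trans[rotated])
qed

text \<open>Stated for any degree bound \<open>m\<close>. The weights are at most
  \<open>B = 10 ^ d * sqrt 2 ^ m\<close>, and squaring turns this into
  \<open>10 ^ (2 * d) * 2 ^ m\<close>.\<close>

lemma gl_uncond_Sid_chain:
  assumes q: "q \<ge> 2" and \<Lambda>: "\<Lambda> \<subseteq> Lambda_le d q N" and m: "\<And>\<alpha>. \<alpha> \<in> \<Lambda> \<Longrightarrow> mdeg N \<alpha> \<le> m"
  shows "gl (poly_space q N \<Lambda>) \<le> uncond_const (poly_space q N \<Lambda>)"
    and "uncond_const (poly_space q N \<Lambda>) \<le> Sid q N \<Lambda>"
    and "Sid q N \<Lambda> \<le> ennreal ((10 / ln 2 * ln (real q)) ^ (2 * d) * 2 ^ m) * gl (poly_space q N \<Lambda>)"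
proof -
  have q0: "q > 0" using q by simp
  have \<Lambda>': "\<Lambda> \<subseteq> multi_indices q N" using \<Lambda> by (auto simp: Lambda_le_def)
  then have fin: "finite \<Lambda>" using finite_multi_indices finite_subset by blast
  show "gl (poly_space q N \<Lambda>) \<le> uncond_const (poly_space q N \<Lambda>)"
    by (rule gl_le_uncond_const[OF q0 fin])
  show "uncond_const (poly_space q N \<Lambda>) \<le> Sid q N \<Lambda>"
    by (rule uncond_const_le_Sid[OF q0 \<Lambda>'])
  define B where "B = 10 ^ d * sqrt 2 ^ m"
  have "Sid q N \<Lambda> \<le> ennreal (B\<^sup>2) * gl (poly_space q N \<Lambda>)"
    using sidon_le_gordon_lewis[OF q0 \<Lambda>', of B] mweight_le[of _ d q N m] \<Lambda> m by (auto simp: B_def)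
  also have "B\<^sup>2 = 10 ^ (2 * d) * 2 ^ m"
  proof -
    have "(sqrt 2 ^ m)\<^sup>2 = (sqrt 2)\<^sup>2 ^ m" "(10 ^ d)\<^sup>2 = (10 ^ (2 * d) :: real)"
      by (simp_all only: power_mult[symmetric] mult.commute)
    then show ?thesis by (simp add: B_def power_mult_distrib)
  qed
  \<comment> \<open>The constant \<open>10 / ln 2\<close> is chosen so that its product with
    \<open>ln q\<close> is at least 10 for every \<open>q \<ge> 2\<close>.\<close>
  also have "ennreal (10 ^ (2 * d) * 2 ^ m) \<le> ennreal ((10 / ln 2 * ln (real q)) ^ (2 * d) * 2 ^ m)"
  proof (intro ennreal_leI mult_right_mono power_mono)
    have "ln 2 \<le> ln (real q)" using q by simp
    then show "10 \<le> 10 / ln 2 * ln (real q)" by (simp add: field_simps)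
  qed auto
  finally show "Sid q N \<Lambda> \<le> ennreal ((10 / ln 2 * ln (real q)) ^ (2 * d) * 2 ^ m) * gl (poly_space q N \<Lambda>)"
    by (simp add: mult_right_mono)
qed

section \<open>Supports and degrees of the three index families\<close>

lemma mdeg_eq_sum_msupp: "mdeg N \<alpha> = (\<Sum>j\<in>msupp N \<alpha>. \<alpha> j)"
  unfolding mdeg_def by (rule sum.mono_neutral_right) (auto simp: msupp_def)

lemma card_msupp_le_mdeg: "card (msupp N \<alpha>) \<le> mdeg N \<alpha>"
proof -
  have "card (msupp N \<alpha>) = (\<Sum>j\<in>msupp N \<alpha>. 1)" by simp
  also have "\<dots> \<le> mdeg N \<alpha>"
    unfolding mdeg_eq_sum_msupp by (rule sum_mono) (auto simp: msupp_def)
  finally show ?thesis .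
qed

lemma mdeg_le_if_mem_Lambda_le:
  assumes "\<alpha> \<in> Lambda_le d q N" shows "mdeg N \<alpha> \<le> (q - 1) * d"
proof -
  have "\<alpha> j \<le> q - 1" if "j \<in> msupp N \<alpha>" for j
    using assms that by (auto simp: Lambda_le_def multi_indices_def msupp_def dest!: PiE_mem[of _ _ _ j])
  then have "mdeg N \<alpha> \<le> card (msupp N \<alpha>) * (q - 1)"
    unfolding mdeg_eq_sum_msupp using sum_bounded_above[of "msupp N \<alpha>" \<alpha> "q - 1"] by simp
  also have "\<dots> \<le> d * (q - 1)" using assms by (simp add: Lambda_le_def)
  finally show ?thesis by (simp add: mult.commute)
qed

lemma B_index_subset: "B_index d q N \<subseteq> Lambda_le d q N"
  by (auto simp: B_index_def Lambda_le_def)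

lemma P_index_subset: "P_index d q N \<subseteq> Lambda_le d q N"
  using card_msupp_le_mdeg by (auto simp: P_index_def Lambda_le_def)

lemma T_index_subset: "T_index d q N \<subseteq> P_index d q N"
  by (auto simp: T_index_def P_index_def)

lemma finite_Lambda_le: "finite (Lambda_le d q N)"
  using finite_multi_indices by (auto simp: Lambda_le_def)

lemma max_deg_B_index:
  assumes q: "q \<ge> 2" and ne: "B_index d q N \<noteq> {}"
  shows "max_deg N (B_index d q N) = (q - 1) * d"
  unfolding max_deg_def
proof (rule Max_eqI)
  show "finite (mdeg N ` B_index d q N)"
    using finite_subset[OF B_index_subset finite_Lambda_le] by simp
  show "y \<le> (q - 1) * d" if "y \<in> mdeg N ` B_index d q N" for y
    using that mdeg_le_if_mem_Lambda_le B_index_subset by blast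
  obtain \<alpha> where \<alpha>: "\<alpha> \<in> multi_indices q N" "card (msupp N \<alpha>) = d"
    using ne by (auto simp: B_index_def)
  \<comment> \<open>The witness of maximal degree raises every nonzero entry of
    \<open>\<alpha>\<close> to \<open>q - 1\<close>; since \<open>q \<ge> 2\<close>, the support
    does not change.\<close>
  define \<beta> where "\<beta> = (\<lambda>j\<in>{..<N}. if j \<in> msupp N \<alpha> then q - 1 else 0)"
  have supp: "msupp N \<beta> = msupp N \<alpha>"
    using q by (auto simp: msupp_def \<beta>_def)
  have "\<beta> \<in> multi_indices q N"
    by (auto simp: multi_indices_def \<beta>_def)
  then have "\<beta> \<in> B_index d q N"
    using \<alpha>(2) by (simp add: B_index_def supp)
  moreover have "mdeg N \<beta> = (\<Sum>j\<in>msupp N \<alpha>. q - 1)"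
    unfolding mdeg_eq_sum_msupp supp by (intro sum.cong) (auto simp: \<beta>_def msupp_def)
  then have "mdeg N \<beta> = (q - 1) * d" using \<alpha>(2) by simp
  ultimately show "(q - 1) * d \<in> mdeg N ` B_index d q N" by force
qed

lemma max_deg_eq_if_homogeneous:
  assumes "\<Lambda> \<subseteq> P_index d q N" "\<Lambda> \<noteq> {}" shows "max_deg N \<Lambda> = d"
proof -
  have "mdeg N ` \<Lambda> = {d}" using assms by (auto simp: P_index_def image_iff)
  then show ?thesis by (simp add: max_deg_def)
qed

theorem corollary3p2:
  "\<exists>C::real. C \<ge> 1 \<and> (\<forall>q d N :: nat. q \<ge> 2 \<and> d \<ge> 1 \<and> N \<ge> 1 \<longrightarrow>
      (\<forall>\<Lambda>. \<Lambda> \<subseteq> Lambda_le d q N \<and> \<Lambda> \<noteq> {} \<longrightarrow>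
         gl (poly_space q N \<Lambda>) \<le> uncond_const (poly_space q N \<Lambda>) \<and>
         uncond_const (poly_space q N \<Lambda>) \<le> Sid q N \<Lambda> \<and>
         Sid q N \<Lambda> \<le> ennreal ((C * ln (real q)) ^ (2 * d) * 2 ^ (max_deg N \<Lambda>)) * gl (poly_space q N \<Lambda>)) \<and>
      (B_index d q N \<noteq> {} \<longrightarrow>
         B_index d q N \<subseteq> Lambda_le d q N \<and> max_deg N (B_index d q N) = (q - 1) * d \<and>
         gl (poly_space q N (B_index d q N)) \<le> uncond_const (poly_space q N (B_index d q N)) \<and>
         uncond_const (poly_space q N (B_index d q N)) \<le> Sid q N (B_index d q N) \<and>
         Sid q N (B_index d q N) \<le> ennreal ((C * ln (real q)) ^ (2 * d) * 2 ^ ((q - 1) * d)) * gl (poly_space q N (B_index d q N))) \<and>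
      (P_index d q N \<noteq> {} \<longrightarrow>
         P_index d q N \<subseteq> Lambda_le d q N \<and> max_deg N (P_index d q N) = d \<and>
         gl (poly_space q N (P_index d q N)) \<le> uncond_const (poly_space q N (P_index d q N)) \<and>
         uncond_const (poly_space q N (P_index d q N)) \<le> Sid q N (P_index d q N) \<and>
         Sid q N (P_index d q N) \<le> ennreal ((C * ln (real q)) ^ (2 * d) * 2 ^ d) * gl (poly_space q N (P_index d q N))) \<and>
      (T_index d q N \<noteq> {} \<longrightarrow>
         T_index d q N \<subseteq> Lambda_le d q N \<and> max_deg N (T_index d q N) = d \<and>
         gl (poly_space q N (T_index d q N)) \<le> uncond_const (poly_space q N (T_index d q N)) \<and>
         uncond_const (poly_space q N (T_index d q N)) \<le> Sid q N (T_index d q N) \<and>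
         Sid q N (T_index d q N) \<le> ennreal ((C * ln (real q)) ^ (2 * d) * 2 ^ d) * gl (poly_space q N (T_index d q N))))"
proof (intro exI[of _ "10 / ln 2"] conjI allI impI; (elim conjE)?)
  have "ln 2 \<le> (1 :: real)" using ln_2_less_1 by simp
  then show "10 / ln 2 \<ge> (1 :: real)" by (simp add: field_simps)
  fix q d N :: nat assume q: "q \<ge> 2"
  show "B_index d q N \<subseteq> Lambda_le d q N" by (rule B_index_subset)
  show "P_index d q N \<subseteq> Lambda_le d q N" by (rule P_index_subset)
  show T: "T_index d q N \<subseteq> Lambda_le d q N" using T_index_subset P_index_subset by (rule order_trans)
  \<comment> \<open>The chain for general \<open>\<Lambda>\<close> is proved once and reused for the
    three families, whose maximal degrees are then substituted.\<close>
  { fix \<Lambda> assume \<Lambda>: "\<Lambda> \<subseteq> Lambda_le d q N"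
    then have "mdeg N \<alpha> \<le> max_deg N \<Lambda>" if "\<alpha> \<in> \<Lambda>" for \<alpha>
      unfolding max_deg_def using that finite_subset[OF \<Lambda> finite_Lambda_le] by (intro Max_ge) auto
    from gl_uncond_Sid_chain[OF q \<Lambda> this]
    show "gl (poly_space q N \<Lambda>) \<le> uncond_const (poly_space q N \<Lambda>)"
      "uncond_const (poly_space q N \<Lambda>) \<le> Sid q N \<Lambda>"
      "Sid q N \<Lambda> \<le> ennreal ((10 / ln 2 * ln (real q)) ^ (2 * d) * 2 ^ (max_deg N \<Lambda>)) * gl (poly_space q N \<Lambda>)"
      by auto }
  note chain = this
  show "gl (poly_space q N (B_index d q N)) \<le> uncond_const (poly_space q N (B_index d q N))"
    "uncond_const (poly_space q N (B_index d q N)) \<le> Sid q N (B_index d q N)"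
    by (rule chain(1,2)[OF B_index_subset])+
  show "gl (poly_space q N (P_index d q N)) \<le> uncond_const (poly_space q N (P_index d q N))"
    "uncond_const (poly_space q N (P_index d q N)) \<le> Sid q N (P_index d q N)"
    by (rule chain(1,2)[OF P_index_subset])+
  show "gl (poly_space q N (T_index d q N)) \<le> uncond_const (poly_space q N (T_index d q N))"
    "uncond_const (poly_space q N (T_index d q N)) \<le> Sid q N (T_index d q N)"
    by (rule chain(1,2)[OF T])+
  { assume "B_index d q N \<noteq> {}"
    then show deg: "max_deg N (B_index d q N) = (q - 1) * d" by (rule max_deg_B_index[OF q])
    show "Sid q N (B_index d q N) \<le> ennreal ((10 / ln 2 * ln (real q)) ^ (2 * d) * 2 ^ ((q - 1) * d)) * gl (poly_space q N (B_index d q N))"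
      using chain(3)[OF B_index_subset] unfolding deg . }
  { assume "P_index d q N \<noteq> {}"
    then show deg: "max_deg N (P_index d q N) = d" by (rule max_deg_eq_if_homogeneous[OF order_refl])
    show "Sid q N (P_index d q N) \<le> ennreal ((10 / ln 2 * ln (real q)) ^ (2 * d) * 2 ^ d) * gl (poly_space q N (P_index d q N))"
      using chain(3)[OF P_index_subset] unfolding deg . }
  { assume "T_index d q N \<noteq> {}"
    then show deg: "max_deg N (T_index d q N) = d" by (rule max_deg_eq_if_homogeneous[OF T_index_subset])
    show "Sid q N (T_index d q N) \<le> ennreal ((10 / ln 2 * ln (real q)) ^ (2 * d) * 2 ^ d) * gl (poly_space q N (T_index d q N))"
      using chain(3)[OF T] unfolding deg . }
qed

end
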